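(* Let $n\ge1$ and let $p>m\ge1$ be integers. Let $\mathcal E,\mathcal E_*$ be Hilbert spaces and let $\mathcal Q_1$ and $\mathcal Q_2$ be co-invariant subspaces of $\mathbb H_m(\mathbb B^n,\mathcal E)$ and $\mathbb H_p(\mathbb B^n,\mathcal E_* )$ respectively. Let $X\in\mathcal B(\mathcal Q_1,\mathcal Q_2)$ be a contraction such that $$X(P_{\mathcal Q_1}M_{z_i}|_{\mathcal Q_1})=(P_{\mathcal Q_2}M_{z_i}|_{\mathcal Q_2})X\qquad(i=1,\dots,n).$$ Then there exist a Hilbert space $\mathcal F$, a Schur-Agler function $\Phi_1:\mathbb B^n\to\mathcal B(\mathcal E,\mathcal F)$ and a co-isometric multiplier $\Phi_2\in\mathcal M_1(\mathbb H_m(\mathbb B^n,\mathcal F),\mathbb H_p(\mathbb B^n,\mathcal E_* ))$ such that $X^*=M_\Phi^*|_{\mathcal Q_2}$, where $\Phi=\Phi_2\Phi_1$, if and only if $$(1-\sigma_S)^{m-1}(I-XX^* )\ge0,$$ where $S=(P_{\mathcal Q_2}M_{z_1}|_{\mathcal Q_2},\dots,P_{\mathcal Q_2}M_{z_n}|_{\mathcal Q_2})$.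
   Context: All Hilbert spaces are complex; $\mathbb B^n$ is the open unit ball of $\mathbb C^n$. For an integer $m\ge1$ and a Hilbert space $\mathcal E$, $\mathbb H_m(\mathbb B^n,\mathcal E)$ is the $\mathcal E$-valued reproducing kernel Hilbert space of holomorphic functions on $\mathbb B^n$ with kernel $(1-\langle\boldsymbol z,\boldsymbol w\rangle)^{-m}I_{\mathcal E}$. $M_{z_i}$ is multiplication by the coordinate $z_i$ (on whichever space is relevant). A closed subspace $\mathcal Q$ is co-invariant if $M_{z_i}^*\mathcal Q\subseteq\mathcal Q$ for all $i$; $P_{\mathcal Q}$ is the orthogonal projection onto $\mathcal Q$. $\mathcal M_1(\mathbb H_m(\mathbb B^n,\mathcal E_1),\mathbb H_p(\mathbb B^n,\mathcal E_2))$ is the set of holomorphic $\Phi:\mathbb B^n\to\mathcal B(\mathcal E_1,\mathcal E_2)$ such that $M_\Phi:f\mapsto\Phi f$ is a contraction from $\mathbb H_m(\mathbb B^n,\mathcal E_1)$ to $\mathbb H_p(\mathbb B^n,\mathcal E_2)$; such a multiplier is co-isometric if $M_\Phi M_\Phi^*=I$. A Schur-Agler function $\mathbb B^n\to\mathcal B(\mathcal E_1,\mathcal E_2)$ is an element of $\mathcal M_1(\mathbb H_1(\mathbb B^n,\mathcal E_1),\mathbb H_1(\mathbb B^n,\mathcal E_2))$; such a function also belongs to $\mathcal M_1(\mathbb H_m(\mathbb B^n,\mathcal E_1),\mathbb H_m(\mathbb B^n,\mathcal E_2))$ for every $m\ge1$. For an $n$-tuple $S$ on a Hilbert space $\mathcal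 K$, $\sigma_S(Y)=\sum_{i=1}^nS_iYS_i^*$ for $Y\in\mathcal B(\mathcal K)$, and $(1-\sigma_S)^j$ is the $j$-th power (composition) of $\mathrm{id}-\sigma_S$. The identity $X^*=M_\Phi^*|_{\mathcal Q_2}$, with $M_\Phi:\mathbb H_m(\mathbb B^n,\mathcal E)\to\mathbb H_p(\mathbb B^n,\mathcal E_* )$, means $M_\Phi^*f=X^*f\in\mathcal Q_1$ for every $f\in\mathcal Q_2$. *)

theory Defs
  imports "HOL-Analysis.Analysis" "HOL-Library.Function_Algebras"
begin

section \<open>Complex vector spaces\<close>

class complex_vector = ab_group_add +
  fixes scaleC :: "complex \<Rightarrow> 'a \<Rightarrow> 'a"  (infixr "*\<^sub>C" 75)
  assumes scaleC_add_right: "a *\<^sub>C (x + y) = a *\<^sub>C x + a *\<^sub>C y"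
    and scaleC_add_left: "(a + b) *\<^sub>C x = a *\<^sub>C x + b *\<^sub>C x"
    and scaleC_scaleC: "a *\<^sub>C (b *\<^sub>C x) = (a * b) *\<^sub>C x"
    and scaleC_one: "1 *\<^sub>C x = x"

instantiation complex :: complex_vector
begin
definition scaleC_complex_def: "a *\<^sub>C (x :: complex) = a * x"
instance by standard (simp_all add: scaleC_complex_def algebra_simps)
end

text \<open>Functions form a vector space under the pointwise operations of Function_Algebras.\<close>

instantiation "fun" :: (type, complex_vector) complex_vector
begin
definition scaleC_fun_def: "a *\<^sub>C f = (\<lambda>x. a *\<^sub>C f x)"
instance
  by standard
    (simp_all add: scaleC_fun_def plus_fun_def fun_eq_iff scaleC_add_right scaleC_add_left
      scaleC_scaleC scaleC_one)
end

global_interpretation complex_vector: vector_space "scaleC :: complex \<Rightarrow> 'a \<Rightarrow> 'a::complex_vector"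
  by standard (simp_all add: scaleC_add_right scaleC_add_left scaleC_scaleC scaleC_one)

section \<open>Hilbert spaces\<close>

text \<open>A Hilbert space is carried by a linear subspace of an ambient vector space type, with an
  inner product of its own (linear in the first argument). The values of the inner product off the
  carrier are irrelevant; in particular closed subspaces and spaces of functions are again Hilbert
  spaces in this sense.\<close>

record 'a hspace =
  vecs :: "'a set"
  ip :: "'a \<Rightarrow> 'a \<Rightarrow> complex"

definition hnorm :: "'a hspace \<Rightarrow> 'a \<Rightarrow> real" where
  "hnorm H x = sqrt (Re (ip H x x))"

locale hilbert_space =
  fixes H :: "'a::complex_vector hspace"
  assumes subspace_vecs: "complex_vector.subspace (vecs H)"
    and ip_add_left: "\<lbrakk>x \<in> vecs H; y \<in> vecs H; z \<in> vecs H\<rbrakk> \<Longrightarrow> ip H (x + y) z = ip H x z + ip H y z"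
    and ip_scaleC_left: "\<lbrakk>x \<in> vecs H; y \<in> vecs H\<rbrakk> \<Longrightarrow> ip H (c *\<^sub>C x) y = c * ip H x y"
    and ip_commute: "\<lbrakk>x \<in> vecs H; y \<in> vecs H\<rbrakk> \<Longrightarrow> ip H y x = cnj (ip H x y)"
    and ip_pos: "\<lbrakk>x \<in> vecs H; x \<noteq> 0\<rbrakk> \<Longrightarrow> 0 < Re (ip H x x)"
    and complete_vecs: "\<lbrakk>\<And>k::nat. s k \<in> vecs H;
        \<And>e. e > 0 \<Longrightarrow> \<exists>N. \<forall>j\<ge>N. \<forall>k\<ge>N. hnorm H (s j - s k) < e\<rbrakk>
      \<Longrightarrow> \<exists>l\<in>vecs H. (\<lambda>k. hnorm H (s k - l)) \<longlonglongrightarrow> 0"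

definition closed_subspace :: "'a::complex_vector hspace \<Rightarrow> 'a set \<Rightarrow> bool" where
  "closed_subspace H Q \<longleftrightarrow> Q \<subseteq> vecs H \<and> complex_vector.subspace Q \<and>
     (\<forall>s l. (\<forall>k::nat. s k \<in> Q) \<and> l \<in> vecs H \<and> (\<lambda>k. hnorm H (s k - l)) \<longlonglongrightarrow> 0 \<longrightarrow> l \<in> Q)"

definition restrict_hspace :: "'a hspace \<Rightarrow> 'a set \<Rightarrow> 'a hspace" (infixl "\<restriction>\<^sub>H" 90) where
  "H \<restriction>\<^sub>H Q = \<lparr>vecs = Q, ip = ip H\<rparr>"

definition proj :: "'a::complex_vector hspace \<Rightarrow> 'a set \<Rightarrow> 'a \<Rightarrow> 'a" where
  "proj H Q x = (THE y. y \<in> Q \<and> (\<forall>q\<in>Q. ip H (x - y) q = 0))"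

text \<open>Operators are functions on the ambient types, of which only the restriction to the carrier
  of the domain matters.\<close>

definition bounded_ops ::
    "'a::complex_vector hspace \<Rightarrow> 'b::complex_vector hspace \<Rightarrow> ('a \<Rightarrow> 'b) set" where
  "bounded_ops H K = {T.
     (\<forall>x\<in>vecs H. T x \<in> vecs K) \<and>
     (\<forall>x\<in>vecs H. \<forall>y\<in>vecs H. T (x + y) = T x + T y) \<and>
     (\<forall>c. \<forall>x\<in>vecs H. T (c *\<^sub>C x) = c *\<^sub>C T x) \<and>
     (\<exists>C. \<forall>x\<in>vecs H. hnorm K (T x) \<le> C * hnorm H x)}"

definition op_norm :: "'a hspace \<Rightarrow> 'b hspace \<Rightarrow> ('a \<Rightarrow> 'b) \<Rightarrow> real" where
  "op_norm H K T = (SUP x\<in>{x\<in>vecs H. hnorm H x \<le> 1}. hnorm K (T x))"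

definition contraction ::
    "'a::complex_vector hspace \<Rightarrow> 'b::complex_vector hspace \<Rightarrow> ('a \<Rightarrow> 'b) \<Rightarrow> bool" where
  "contraction H K T \<longleftrightarrow> T \<in> bounded_ops H K \<and> (\<forall>x\<in>vecs H. hnorm K (T x) \<le> hnorm H x)"

definition adj :: "'a hspace \<Rightarrow> 'b hspace \<Rightarrow> ('a \<Rightarrow> 'b) \<Rightarrow> 'b \<Rightarrow> 'a" where
  "adj H K T y = (THE u. u \<in> vecs H \<and> (\<forall>x\<in>vecs H. ip K (T x) y = ip H x u))"

definition positive_op :: "'a hspace \<Rightarrow> ('a \<Rightarrow> 'a) \<Rightarrow> bool" where
  "positive_op H T \<longleftrightarrow> (\<forall>x\<in>vecs H. Im (ip H (T x) x) = 0 \<and> 0 \<le> Re (ip H (T x) x))"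

definition sigma_op ::
    "'a::complex_vector hspace \<Rightarrow> ('n::finite \<Rightarrow> 'a \<Rightarrow> 'a) \<Rightarrow> ('a \<Rightarrow> 'a) \<Rightarrow> 'a \<Rightarrow> 'a" where
  "sigma_op K S Y = (\<Sum>i\<in>UNIV. S i \<circ> Y \<circ> adj K K (S i))"

section \<open>The spaces with kernel \<open>(1 - \<langle>z,w\<rangle>)\<^sup>-\<^sup>m\<close> and their multipliers\<close>

abbreviation unit_ball :: "(complex^'n) set" where
  "unit_ball \<equiv> ball 0 1"

definition cdot :: "complex^'n \<Rightarrow> complex^'n \<Rightarrow> complex" where
  "cdot z w = (\<Sum>i\<in>UNIV. z $ i * cnj (w $ i))"

text \<open>Complex Frechet differentiability on the ball, for functions with values in the
  subspace \<open>V\<close> normed by \<open>N\<close>; \<open>d i\<close> is the i-th partial derivative.\<close>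

definition holomorphic_on_ball ::
    "'v::complex_vector set \<Rightarrow> ('v \<Rightarrow> real) \<Rightarrow> (complex^'n \<Rightarrow> 'v) \<Rightarrow> bool" where
  "holomorphic_on_ball V N f \<longleftrightarrow>
     (\<forall>z\<in>unit_ball. f z \<in> V) \<and>
     (\<forall>z\<in>unit_ball. \<exists>d. (\<forall>i. d i \<in> V) \<and>
        (\<forall>e>0. \<exists>\<delta>>0. \<forall>w\<in>unit_ball. norm (w - z) < \<delta> \<longrightarrow>
           N (f w - f z - (\<Sum>i\<in>UNIV. (w $ i - z $ i) *\<^sub>C d i)) \<le> e * norm (w - z)))"

text \<open>\<open>H\<close> is a Hilbert space of holomorphic functions on the ball, with values in \<open>E\<close>
  and reproducing kernel \<open>k(z,w) I\<^sub>E\<close>. Functions on the ball are extended by 0 to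
  the ambient type.\<close>

definition is_rkhs :: "'e::complex_vector hspace \<Rightarrow> (complex^'n \<Rightarrow> complex^'n \<Rightarrow> complex) \<Rightarrow>
    (complex^'n \<Rightarrow> 'e) hspace \<Rightarrow> bool" where
  "is_rkhs E k H \<longleftrightarrow> hilbert_space H \<and>
     (\<forall>f\<in>vecs H. holomorphic_on_ball (vecs E) (hnorm E) f \<and> (\<forall>z. z \<notin> unit_ball \<longrightarrow> f z = 0)) \<and>
     (\<forall>w\<in>unit_ball. \<forall>\<eta>\<in>vecs E.
        (\<lambda>z. if z \<in> unit_ball then k z w *\<^sub>C \<eta> else 0) \<in> vecs H \<and>
        (\<forall>f\<in>vecs H. ip H f (\<lambda>z. if z \<in> unit_ball then k z w *\<^sub>C \<eta> else 0) = ip E (f w) \<eta>))"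

text \<open>The kernel determines the carrier and the inner product on it, so the choice
  only concerns the irrelevant values of the inner product off the carrier.\<close>

definition Hm :: "nat \<Rightarrow> 'e::complex_vector hspace \<Rightarrow> (complex^'n \<Rightarrow> 'e) hspace" where
  "Hm m E = (SOME H. is_rkhs E (\<lambda>z w. 1 / (1 - cdot z w) ^ m) H)"

definition mult_coord :: "'n \<Rightarrow> (complex^'n \<Rightarrow> 'e::complex_vector) \<Rightarrow> complex^'n \<Rightarrow> 'e" where
  "mult_coord i f = (\<lambda>z. (z $ i) *\<^sub>C f z)"

definition mult_op ::
    "(complex^'n \<Rightarrow> 'e \<Rightarrow> 'f::complex_vector) \<Rightarrow> (complex^'n \<Rightarrow> 'e) \<Rightarrow> complex^'n \<Rightarrow> 'f" where
  "mult_op \<Phi> f = (\<lambda>z. if z \<in> unit_ball then \<Phi> z (f z) else 0)"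

definition contractive_multipliers :: "nat \<Rightarrow> 'e::complex_vector hspace \<Rightarrow> nat \<Rightarrow>
    'f::complex_vector hspace \<Rightarrow> (complex^'n \<Rightarrow> 'e \<Rightarrow> 'f) set" where
  "contractive_multipliers m E p F = {\<Phi>.
     holomorphic_on_ball (bounded_ops E F) (op_norm E F) \<Phi> \<and>
     contraction (Hm m E) (Hm p F) (mult_op \<Phi>)}"

definition schur_agler :: "'e::complex_vector hspace \<Rightarrow> 'f::complex_vector hspace \<Rightarrow>
    (complex^'n \<Rightarrow> 'e \<Rightarrow> 'f) set" where
  "schur_agler E F = contractive_multipliers 1 E 1 F"

definition coisometric_multiplier :: "nat \<Rightarrow> 'e::complex_vector hspace \<Rightarrow> nat \<Rightarrow>
    'f::complex_vector hspace \<Rightarrow> (complex^'n \<Rightarrow> 'e \<Rightarrow> 'f) \<Rightarrow> bool" where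
  "coisometric_multiplier m E p F \<Phi> \<longleftrightarrow> \<Phi> \<in> contractive_multipliers m E p F \<and>
     (\<forall>f\<in>vecs (Hm p F). mult_op \<Phi> (adj (Hm m E) (Hm p F) (mult_op \<Phi>) f) = f)"

definition coinvariant ::
    "(complex^'n \<Rightarrow> 'e::complex_vector) hspace \<Rightarrow> (complex^'n \<Rightarrow> 'e) set \<Rightarrow> bool" where
  "coinvariant H Q \<longleftrightarrow> closed_subspace H Q \<and> (\<forall>i. \<forall>f\<in>Q. adj H H (mult_coord i) f \<in> Q)"

definition compressed_coord :: "(complex^'n \<Rightarrow> 'e::complex_vector) hspace \<Rightarrow>
    (complex^'n \<Rightarrow> 'e) set \<Rightarrow> 'n \<Rightarrow> (complex^'n \<Rightarrow> 'e) \<Rightarrow> complex^'n \<Rightarrow> 'e" where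
  "compressed_coord H Q i f = proj H Q (mult_coord i f)"

text \<open>\<open>X\<^sup>*\<close> is the restriction to \<open>Q\<^sub>2\<close> of the adjoint of multiplication by
  \<open>\<Phi>\<^sub>2 \<Phi>\<^sub>1\<close>. The intermediate Hilbert space \<open>F\<close> has a type of its own. HOL cannot
  quantify over types, so an existential statement about \<open>F\<close> has to fix one and to assert in
  addition that a solution of any other type gives one of the fixed type.\<close>

definition factors_through :: "nat \<Rightarrow> nat \<Rightarrow> 'e::complex_vector hspace \<Rightarrow>
    's::complex_vector hspace \<Rightarrow> (complex^'n \<Rightarrow> 'e) set \<Rightarrow> (complex^'n \<Rightarrow> 's) set \<Rightarrow>
    ((complex^'n \<Rightarrow> 'e) \<Rightarrow> complex^'n \<Rightarrow> 's) \<Rightarrow> 'f::complex_vector hspace \<Rightarrow> bool" where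
  "factors_through m p E Es Q1 Q2 X F \<longleftrightarrow>
     (\<exists>\<Phi>1 \<Phi>2. \<Phi>1 \<in> schur_agler E F \<and> coisometric_multiplier m F p Es \<Phi>2 \<and>
        (\<forall>f\<in>Q2. adj (Hm m E) (Hm p Es) (mult_op (\<lambda>z. \<Phi>2 z \<circ> \<Phi>1 z)) f =
                adj (Hm m E \<restriction>\<^sub>H Q1) (Hm p Es \<restriction>\<^sub>H Q2) X f))"

end

theory Submission
  imports Defs
begin

text \<open>Write \<open>T\<^sub>i\<close> for the adjoints of the coordinate multipliers and \<open>\<Delta> B(f,g) = B(f,g) - \<Sum>\<^sub>i B(T\<^sub>i f, T\<^sub>i g)\<close>
  for the action of \<open>1 - \<sigma>\<close> on sesquilinear forms; on kernel functions \<open>\<Delta>\<close> is multiplication by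
  \<open>1 - \<langle>z,w\<rangle>\<close>.

  If \<open>X\<^sup>* = M\<^sub>\<Phi>\<^sub>1\<^sup>* M\<^sub>\<Phi>\<^sub>2\<^sup>*\<close> on \<open>Q\<^sub>2\<close>, then \<open>M\<^sub>\<Phi>\<^sub>2\<^sup>*\<close> is an isometry intertwining the \<open>T\<^sub>i\<close> and turns
  \<open>\<Delta>\<^sup>m\<^sup>-\<^sup>1(I - XX\<^sup>*)\<close> into the form with kernel \<open>(I - \<Phi>\<^sub>1(z) \<Phi>\<^sub>1(w)\<^sup>*) / (1 - \<langle>z,w\<rangle>)\<close>, which is positive
  because \<open>\<Phi>\<^sub>1\<close> is a Schur-Agler function.

  Conversely take for \<open>F\<close> the space with kernel \<open>(1 - \<langle>z,w\<rangle>)\<^sup>m\<^sup>-\<^sup>p\<close> and for \<open>\<Phi>\<^sub>2(z)\<close> the evaluation at \<open>z\<close>, put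
  \<open>L = M\<^sub>\<Phi>\<^sub>2\<^sup>*\<close> and let \<open>R\<close> be a square root of \<open>\<Delta>\<^sup>m\<^sup>-\<^sup>1(I - XX\<^sup>*)\<close>. Since \<open>\<Delta>\<^sup>m\<close> of the inner product of the space
  with exponent \<open>m\<close> is evaluation at 0,
  \<open>\<parallel>R f\<parallel>\<^sup>2 + \<parallel>(X\<^sup>* f)(0)\<parallel>\<^sup>2 = \<Sum>\<^sub>i \<parallel>R T\<^sub>i f\<parallel>\<^sup>2 + \<parallel>(L f)(0)\<parallel>\<^sup>2\<close>. This lurking isometry extends to a contractive
  colligation whose transfer function is \<open>\<Phi>\<^sub>1\<close>. That \<open>X\<^sup>* = M\<^sub>\<Phi>\<^sub>1\<^sup>* L\<close> follows from purity: the sums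
  of \<open>\<parallel>T\<^sub>u f\<parallel>\<^sup>2\<close> over the words \<open>u\<close> of length \<open>N\<close> tend to 0.\<close>

section \<open>Hilbert spaces\<close>

text \<open>The power m - 1 is the one that lowers a kernel of exponent m to exponent 1, where
  positivity of the defect kernel is the Schur-Agler condition. The exponent p enters only through L
  and through p - m >= 1, which makes the space chosen for F available. Everything happens on the
  adjoint side: Q1 and Q2 are invariant under the T_i, so the compressions become plain restrictions
  there. The obstacle is that Q2 in general contains no kernel functions, so positivity of a form on
  Q2 cannot be tested at points. Forms are therefore carried by L into the space over F, where
  kernel functions span a dense subspace and are joint eigenvectors of the T_i. In the converse R
  lives on Q2 only, while the transfer function and its states live on the whole space over F. Both
  satisfy the same state equation, and purity forces them to agree along L. The lurking isometry is
  extended by zero on the orthogonal complement of its domain. A contractive colligation is enough,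
  because the defect of a contraction only adds a positive kernel.\<close>

context hilbert_space
begin

lemma zero_mem [simp]: "0 \<in> vecs H"
  using complex_vector.subspace_0 subspace_vecs by blast
lemma add_mem [simp]: "x \<in> vecs H \<Longrightarrow> y \<in> vecs H \<Longrightarrow> x + y \<in> vecs H"
  using complex_vector.subspace_add subspace_vecs by blast
lemma diff_mem [simp]: "x \<in> vecs H \<Longrightarrow> y \<in> vecs H \<Longrightarrow> x - y \<in> vecs H"
  using complex_vector.subspace_diff subspace_vecs by blast
lemma scale_mem [simp]: "x \<in> vecs H \<Longrightarrow> c *\<^sub>C x \<in> vecs H"
  using complex_vector.subspace_scale subspace_vecs by blast
lemma uminus_mem [simp]: "x \<in> vecs H \<Longrightarrow> - x \<in> vecs H"
  using complex_vector.subspace_neg subspace_vecs by blast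
lemma sum_mem [simp]: "(\<And>i. i \<in> A \<Longrightarrow> f i \<in> vecs H) \<Longrightarrow> sum f A \<in> vecs H"
  using complex_vector.subspace_sum subspace_vecs by blast
lemma sum_list_mem [simp]: "(\<And>i. i \<in> set l \<Longrightarrow> f i \<in> vecs H) \<Longrightarrow> sum_list (map f l) \<in> vecs H"
  by (induction l) auto

lemma ip_add_right: "x \<in> vecs H \<Longrightarrow> y \<in> vecs H \<Longrightarrow> z \<in> vecs H \<Longrightarrow> ip H x (y + z) = ip H x y + ip H x z"
  by (metis add_mem complex_cnj_add ip_add_left ip_commute)
lemma ip_scale_right: "x \<in> vecs H \<Longrightarrow> y \<in> vecs H \<Longrightarrow> ip H x (c *\<^sub>C y) = cnj c * ip H x y"
  by (metis scale_mem complex_cnj_mult ip_scaleC_left ip_commute)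
lemma ip_zero_left [simp]: "y \<in> vecs H \<Longrightarrow> ip H 0 y = 0"
  using ip_scaleC_left[of 0 y 0] by simp
lemma ip_zero_right [simp]: "y \<in> vecs H \<Longrightarrow> ip H y 0 = 0"
  using ip_scale_right[of y 0 0] by simp
lemma ip_uminus_left [simp]: "x \<in> vecs H \<Longrightarrow> y \<in> vecs H \<Longrightarrow> ip H (- x) y = - ip H x y"
  using ip_add_left[of x "- x" y] by (simp add: add_eq_0_iff)
lemma ip_uminus_right [simp]: "x \<in> vecs H \<Longrightarrow> y \<in> vecs H \<Longrightarrow> ip H x (- y) = - ip H x y"
  using ip_add_right[of x y "- y"] by (simp add: add_eq_0_iff)
lemma ip_diff_left: "x \<in> vecs H \<Longrightarrow> y \<in> vecs H \<Longrightarrow> z \<in> vecs H \<Longrightarrow> ip H (x - y) z = ip H x z - ip H y z"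
  using ip_add_left[of x "- y" z] by simp
lemma ip_diff_right: "x \<in> vecs H \<Longrightarrow> y \<in> vecs H \<Longrightarrow> z \<in> vecs H \<Longrightarrow> ip H x (y - z) = ip H x y - ip H x z"
  using ip_add_right[of x y "- z"] by simp
lemma ip_sum_left: "(\<And>i. i \<in> A \<Longrightarrow> f i \<in> vecs H) \<Longrightarrow> y \<in> vecs H \<Longrightarrow> ip H (sum f A) y = (\<Sum>i\<in>A. ip H (f i) y)"
  by (induction A rule: infinite_finite_induct) (auto simp: ip_add_left)
lemma ip_sum_right: "(\<And>i. i \<in> A \<Longrightarrow> f i \<in> vecs H) \<Longrightarrow> y \<in> vecs H \<Longrightarrow> ip H y (sum f A) = (\<Sum>i\<in>A. ip H y (f i))"
  by (induction A rule: infinite_finite_induct) (auto simp: ip_add_right)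
lemma ip_sum_list_left:
  "(\<And>i. i \<in> set l \<Longrightarrow> f i \<in> vecs H) \<Longrightarrow> y \<in> vecs H \<Longrightarrow> ip H (\<Sum>i\<leftarrow>l. f i) y = (\<Sum>i\<leftarrow>l. ip H (f i) y)"
  by (induction l) (auto simp: ip_add_left)
lemma ip_sum_list_right:
  "(\<And>i. i \<in> set l \<Longrightarrow> f i \<in> vecs H) \<Longrightarrow> y \<in> vecs H \<Longrightarrow> ip H y (\<Sum>i\<leftarrow>l. f i) = (\<Sum>i\<leftarrow>l. ip H y (f i))"
  by (induction l) (auto simp: ip_add_right)

lemmas ip_linear = ip_add_left ip_add_right ip_diff_left ip_diff_right ip_scaleC_left ip_scale_right

lemma Re_ip_self: "x \<in> vecs H \<Longrightarrow> 0 \<le> Re (ip H x x)"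
  using ip_pos[of x] by (cases "x = 0") (auto intro: less_imp_le)
lemma Im_ip_self: "x \<in> vecs H \<Longrightarrow> Im (ip H x x) = 0"
  using ip_commute[of x x] by (metis complex_cnj_cancel_iff complex_is_Real_iff Reals_cnj_iff)
lemma hnorm_nonneg [simp]: "x \<in> vecs H \<Longrightarrow> 0 \<le> hnorm H x"
  by (simp add: hnorm_def Re_ip_self)
lemma hnorm_sq: "x \<in> vecs H \<Longrightarrow> (hnorm H x)\<^sup>2 = Re (ip H x x)"
  by (simp add: hnorm_def Re_ip_self)
lemma ip_self: "x \<in> vecs H \<Longrightarrow> ip H x x = of_real ((hnorm H x)\<^sup>2)"
  by (simp add: complex_eq_iff Im_ip_self hnorm_sq)
lemma hnorm_zero [simp]: "hnorm H 0 = 0"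
  by (simp add: hnorm_def)
lemma hnorm_eq_0: "x \<in> vecs H \<Longrightarrow> hnorm H x = 0 \<longleftrightarrow> x = 0"
  using ip_pos[of x] by (cases "x = 0") (auto simp: hnorm_def)
lemma hnorm_scale [simp]: "x \<in> vecs H \<Longrightarrow> hnorm H (c *\<^sub>C x) = cmod c * hnorm H x"
proof -
  assume x: "x \<in> vecs H"
  have "ip H (c *\<^sub>C x) (c *\<^sub>C x) = of_real ((cmod c)\<^sup>2 * (hnorm H x)\<^sup>2)"
    using x unfolding of_real_mult ip_self[OF x, symmetric] complex_norm_square
    by (simp add: ip_linear mult_ac)
  then have "(hnorm H (c *\<^sub>C x))\<^sup>2 = (cmod c * hnorm H x)\<^sup>2"
    using x by (simp add: hnorm_sq power_mult_distrib)
  then show ?thesis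
    using x by (simp add: power2_eq_iff_nonneg)
qed
lemma hnorm_uminus [simp]: "x \<in> vecs H \<Longrightarrow> hnorm H (- x) = hnorm H x"
  by (simp add: hnorm_def)
lemma hnorm_minus_commute: "x \<in> vecs H \<Longrightarrow> y \<in> vecs H \<Longrightarrow> hnorm H (x - y) = hnorm H (y - x)"
  using hnorm_uminus[of "x - y"] by simp

lemma hnorm_add_sq: "x \<in> vecs H \<Longrightarrow> y \<in> vecs H \<Longrightarrow>
    (hnorm H (x + y))\<^sup>2 = (hnorm H x)\<^sup>2 + 2 * Re (ip H x y) + (hnorm H y)\<^sup>2"
  using ip_commute[of x y] by (simp add: hnorm_sq ip_linear)
lemma hnorm_diff_sq: "x \<in> vecs H \<Longrightarrow> y \<in> vecs H \<Longrightarrow>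
    (hnorm H (x - y))\<^sup>2 = (hnorm H x)\<^sup>2 - 2 * Re (ip H x y) + (hnorm H y)\<^sup>2"
  using ip_commute[of x y] by (simp add: hnorm_sq ip_linear)

lemma cauchy_schwarz: "x \<in> vecs H \<Longrightarrow> y \<in> vecs H \<Longrightarrow> cmod (ip H x y) \<le> hnorm H x * hnorm H y"
proof -
  assume x: "x \<in> vecs H" and y: "y \<in> vecs H"
  show ?thesis
  proof (cases "y = 0")
    case False
    define n where "n = (hnorm H y)\<^sup>2"
    have n: "n > 0" using False y hnorm_eq_0[of y] by (simp add: n_def)
    define c where "c = ip H x y / of_real n"
    have "0 \<le> (hnorm H (x - c *\<^sub>C y))\<^sup>2" by simp
    also have "\<dots> = (hnorm H x)\<^sup>2 - 2 * Re (cnj c * ip H x y) + (cmod c)\<^sup>2 * n"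
      using x y by (simp add: hnorm_diff_sq ip_linear power_mult_distrib n_def)
    also have "cnj c * ip H x y = of_real ((cmod (ip H x y))\<^sup>2 / n)"
      unfolding c_def complex_cnj_divide complex_cnj_complex_of_real of_real_divide complex_norm_square
      by (simp add: mult.commute)
    also have "(cmod c)\<^sup>2 * n = (cmod (ip H x y))\<^sup>2 / n"
      using n by (simp add: c_def norm_divide power_divide power2_eq_square)
    finally have "(cmod (ip H x y))\<^sup>2 / n \<le> (hnorm H x)\<^sup>2" by simp
    then have "(cmod (ip H x y))\<^sup>2 \<le> (hnorm H x * hnorm H y)\<^sup>2"
      using n by (simp add: field_simps n_def)
    then show ?thesis using x y power2_le_imp_le by fastforce
  qed (use x in auto)
qed

lemma hnorm_triangle: "x \<in> vecs H \<Longrightarrow> y \<in> vecs H \<Longrightarrow> hnorm H (x + y) \<le> hnorm H x + hnorm H y"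
proof -
  assume x: "x \<in> vecs H" and y: "y \<in> vecs H"
  have "Re (ip H x y) \<le> hnorm H x * hnorm H y"
    using cauchy_schwarz[OF x y] complex_Re_le_cmod order_trans by blast
  then have "(hnorm H (x + y))\<^sup>2 \<le> (hnorm H x + hnorm H y)\<^sup>2"
    using x y by (simp add: hnorm_add_sq power2_sum)
  then show ?thesis using x y by (simp add: power2_le_iff_abs_le)
qed
lemma hnorm_triangle_diff: "x \<in> vecs H \<Longrightarrow> y \<in> vecs H \<Longrightarrow> hnorm H (x - y) \<le> hnorm H x + hnorm H y"
  using hnorm_triangle[of x "- y"] by simp
lemma hnorm_triangle3: "x \<in> vecs H \<Longrightarrow> y \<in> vecs H \<Longrightarrow> z \<in> vecs H \<Longrightarrow>
    hnorm H (x - z) \<le> hnorm H (x - y) + hnorm H (y - z)"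
  using hnorm_triangle[of "x - y" "y - z"] by simp
lemma hnorm_triangle_abs: "x \<in> vecs H \<Longrightarrow> y \<in> vecs H \<Longrightarrow> \<bar>hnorm H x - hnorm H y\<bar> \<le> hnorm H (x - y)"
  using hnorm_triangle3[of x y 0] hnorm_triangle3[of y x 0] hnorm_minus_commute[of x y] by simp
lemma parallelogram: "x \<in> vecs H \<Longrightarrow> y \<in> vecs H \<Longrightarrow>
    (hnorm H (x + y))\<^sup>2 + (hnorm H (x - y))\<^sup>2 = 2 * (hnorm H x)\<^sup>2 + 2 * (hnorm H y)\<^sup>2"
  by (simp add: hnorm_add_sq hnorm_diff_sq)
lemma hnorm_add_sq_le: "x \<in> vecs H \<Longrightarrow> y \<in> vecs H \<Longrightarrow>
    (hnorm H (x + y))\<^sup>2 \<le> 2 * (hnorm H x)\<^sup>2 + 2 * (hnorm H y)\<^sup>2"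
  using parallelogram[of x y] by (smt (verit) zero_le_power2)

lemma ip_eqI: "x \<in> vecs H \<Longrightarrow> y \<in> vecs H \<Longrightarrow> (\<And>z. z \<in> vecs H \<Longrightarrow> ip H z x = ip H z y) \<Longrightarrow> x = y"
proof -
  assume *: "x \<in> vecs H" "y \<in> vecs H" "\<And>z. z \<in> vecs H \<Longrightarrow> ip H z x = ip H z y"
  then have "ip H (x - y) (x - y) = 0" by (simp add: ip_diff_right)
  then show "x = y" using *(1,2) ip_pos[of "x - y"] by force
qed
lemma ip_eqI_left: "x \<in> vecs H \<Longrightarrow> y \<in> vecs H \<Longrightarrow> (\<And>z. z \<in> vecs H \<Longrightarrow> ip H x z = ip H y z) \<Longrightarrow> x = y"
  by (metis ip_commute ip_eqI)

lemma lim_ip_right: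
  assumes "\<And>k. s k \<in> vecs H" "l \<in> vecs H" "y \<in> vecs H" "(\<lambda>k. hnorm H (s k - l)) \<longlonglongrightarrow> 0"
  shows "(\<lambda>k. ip H y (s k)) \<longlonglongrightarrow> ip H y l"
proof (rule Lim_null[THEN iffD2], rule Lim_null_comparison)
  show "\<forall>\<^sub>F k in sequentially. norm (ip H y (s k) - ip H y l) \<le> hnorm H y * hnorm H (s k - l)"
    using assms cauchy_schwarz[of y "s _ - l"] by (simp add: ip_diff_right)
  show "(\<lambda>k. hnorm H y * hnorm H (s k - l)) \<longlonglongrightarrow> 0"
    using tendsto_mult_right_zero[OF assms(4)] by simp
qed
lemma lim_ip_left:
  assumes "\<And>k. s k \<in> vecs H" "l \<in> vecs H" "y \<in> vecs H" "(\<lambda>k. hnorm H (s k - l)) \<longlonglongrightarrow> 0"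
  shows "(\<lambda>k. ip H (s k) y) \<longlonglongrightarrow> ip H l y"
  using tendsto_cnj[OF lim_ip_right[OF assms]] assms ip_commute by (metis (no_types, lifting) ext)
lemma lim_hnorm:
  assumes "\<And>k. s k \<in> vecs H" "l \<in> vecs H" "(\<lambda>k. hnorm H (s k - l)) \<longlonglongrightarrow> 0"
  shows "(\<lambda>k. hnorm H (s k)) \<longlonglongrightarrow> hnorm H l"
proof (rule Lim_null[THEN iffD2], rule Lim_null_comparison[OF _ assms(3)])
  show "\<forall>\<^sub>F k in sequentially. norm (hnorm H (s k) - hnorm H l) \<le> hnorm H (s k - l)"
    using assms hnorm_triangle_abs by simp
qed

text \<open>Riesz's theorem for a linear relation \<open>\<Gamma>\<close> instead of a functional: the minimiser of
  \<open>\<parallel>v\<parallel>\<^sup>2 - 2 Re s\<close> over \<open>(v, s) \<in> \<Gamma>\<close> exists in the closure of the domain. This gives the Riesz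
  theorem, orthogonal projections and density arguments at once.\<close>

lemma riesz_relation:
  assumes dom: "\<And>v s. (v, s) \<in> \<Gamma> \<Longrightarrow> v \<in> vecs H" and zero: "(0, 0) \<in> \<Gamma>"
    and add: "\<And>v s w t. (v, s) \<in> \<Gamma> \<Longrightarrow> (w, t) \<in> \<Gamma> \<Longrightarrow> (v + w, s + t) \<in> \<Gamma>"
    and scale: "\<And>c v s. (v, s) \<in> \<Gamma> \<Longrightarrow> (c *\<^sub>C v, c * s) \<in> \<Gamma>"
    and bound: "\<And>v s. (v, s) \<in> \<Gamma> \<Longrightarrow> cmod s \<le> C * hnorm H v"
  obtains u where "u \<in> vecs H" "\<And>v s. (v, s) \<in> \<Gamma> \<Longrightarrow> s = ip H v u" "C \<ge> 0 \<Longrightarrow> hnorm H u \<le> C"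
    "\<And>e. e > 0 \<Longrightarrow> \<exists>v s. (v, s) \<in> \<Gamma> \<and> hnorm H (u - v) < e"
proof -
  define J where "J = (\<lambda>(v, s). (hnorm H v)\<^sup>2 - 2 * Re s)"
  \<comment> \<open>From |s| <= C |v| and 0 <= (|v| - C)^2; the bound on s is what makes the infimum
    of \<open>J\<close> finite.\<close>
  have J_ge: "- (C\<^sup>2) \<le> J x" if "x \<in> \<Gamma>" for x
  proof -
    obtain v s where x: "x = (v, s)" by (cases x)
    have "Re s \<le> C * hnorm H v"
      using bound[of v s] that x complex_Re_le_cmod order_trans by blast
    moreover have "0 \<le> (hnorm H v - C)\<^sup>2" by simp
    ultimately show ?thesis by (simp add: J_def x power2_diff algebra_simps)
  qed
  define \<alpha> where "\<alpha> = Inf (J ` \<Gamma>)"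
  have bdd: "bdd_below (J ` \<Gamma>)" unfolding bdd_below_def using J_ge by blast
  have \<alpha>_le: "\<alpha> \<le> J x" if "x \<in> \<Gamma>" for x
    unfolding \<alpha>_def using that bdd by (rule cINF_lower[rotated])
  have "\<exists>x\<in>\<Gamma>. J x < \<alpha> + 1 / real (Suc k)" for k
  proof -
    have "Inf (J ` \<Gamma>) < \<alpha> + 1 / real (Suc k)" by (simp add: \<alpha>_def)
    moreover have "J ` \<Gamma> \<noteq> {}" using zero by auto
    ultimately obtain y where "y \<in> J ` \<Gamma>" "y < \<alpha> + 1 / real (Suc k)"
      using cInf_lessD by metis
    then show ?thesis by auto
  qed
  then obtain x where x: "\<And>k. x k \<in> \<Gamma>" "\<And>k. J (x k) < \<alpha> + 1 / real (Suc k)" by metis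
  define v s where "v = fst \<circ> x" and "s = snd \<circ> x"
  have vs: "(v k, s k) \<in> \<Gamma>" for k using x(1) by (simp add: v_def s_def)
  have v: "v k \<in> vecs H" for k using vs dom by blast
  have J: "J (x k) = (hnorm H (v k))\<^sup>2 - 2 * Re (s k)" for k
    by (simp add: J_def v_def s_def case_prod_beta)
  \<comment> \<open>The midpoint of two near-minimisers is again in the relation, so
    \<open>J\<close> there is at least \<alpha>; the parallelogram identity then bounds the distance
    between the two.\<close>
  have close: "(hnorm H (v j - v k))\<^sup>2 \<le> 2 / real (Suc j) + 2 / real (Suc k)" for j k
  proof -
    have "((1/2) *\<^sub>C (v j + v k), (1/2) * (s j + s k)) \<in> \<Gamma>" using vs add scale by blast
    then have "\<alpha> \<le> (hnorm H ((1/2) *\<^sub>C (v j + v k)))\<^sup>2 - 2 * Re ((1/2) * (s j + s k))"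
      using \<alpha>_le[of "((1/2) *\<^sub>C (v j + v k), (1/2) * (s j + s k))"] by (simp add: J_def)
    moreover have "(hnorm H ((1/2) *\<^sub>C (v j + v k)))\<^sup>2 = (hnorm H (v j + v k))\<^sup>2 / 4"
      using v by (simp add: norm_divide power_divide)
    moreover have "Re ((1/2) * (s j + s k)) = Re (s j) / 2 + Re (s k) / 2"
      by (simp add: add_divide_distrib)
    ultimately have "4 * \<alpha> \<le> (hnorm H (v j + v k))\<^sup>2 - 4 * Re (s j) - 4 * Re (s k)"
      by linarith
    moreover have "J (x j) + J (x k) \<le> 2 * \<alpha> + 1 / real (Suc j) + 1 / real (Suc k)"
      using x(2)[of j] x(2)[of k] by simp
    ultimately show ?thesis
      using parallelogram[OF v v, of j k] by (simp add: J)
  qed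
  have "\<exists>N. \<forall>j\<ge>N. \<forall>k\<ge>N. hnorm H (v j - v k) < e" if "e > 0" for e
  proof -
    obtain N where N: "4 / e\<^sup>2 < real N" using reals_Archimedean2 by blast
    have Npos: "real N > 0" using N that by (smt (verit) divide_pos_pos zero_less_power)
    have "hnorm H (v j - v k) < e" if jk: "j \<ge> N" "k \<ge> N" for j k
    proof -
      have "2 / real (Suc j) \<le> 2 / real N" "2 / real (Suc k) \<le> 2 / real N"
        using jk Npos by (auto intro!: divide_left_mono)
      then have "(hnorm H (v j - v k))\<^sup>2 \<le> 4 / real N" using close[of j k] by simp
      also have "\<dots> < e\<^sup>2" using N Npos \<open>e > 0\<close> by (simp add: field_simps)
      finally show ?thesis using \<open>e > 0\<close> power_less_imp_less_base by fastforce
    qed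
    then show ?thesis by blast
  qed
  then obtain u where u: "u \<in> vecs H" "(\<lambda>k. hnorm H (v k - u)) \<longlonglongrightarrow> 0"
    using complete_vecs[of v] v by blast
  have eq: "t = ip H w u" if wt: "(w, t) \<in> \<Gamma>" for w t
  proof -
    have w: "w \<in> vecs H" using wt dom by blast
    define b where "b = ip H w u - t"
    define n where "n = (hnorm H w)\<^sup>2"
    \<comment> \<open>Moving \<open>v k\<close> by c w cannot bring \<open>J\<close> below \<alpha>.
      In the limit this is the first-order condition at \<open>u\<close>, with \<open>b\<close> as
      its residual.\<close>
    have *: "0 \<le> (cmod c)\<^sup>2 * n + 2 * Re (c * b)" for c
    proof -
      have "- (1 / real (Suc k)) \<le> (cmod c)\<^sup>2 * n + 2 * Re (c * (ip H w (v k) - t))" for k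
      proof -
        have "\<alpha> \<le> J (v k + c *\<^sub>C w, s k + c * t)"
          using \<alpha>_le vs wt add scale by blast
        also have "\<dots> = J (x k) + (cmod c)\<^sup>2 * n + 2 * Re (ip H (v k) (c *\<^sub>C w)) - 2 * Re (c * t)"
          unfolding J using v w by (simp add: J_def hnorm_add_sq n_def power_mult_distrib)
        also have "Re (ip H (v k) (c *\<^sub>C w)) = Re (c * ip H w (v k))"
          using ip_commute[of "c *\<^sub>C w" "v k"] v w by (simp add: ip_scaleC_left)
        finally show ?thesis using x(2)[of k] by (simp add: algebra_simps)
      qed
      moreover have "(\<lambda>k. (cmod c)\<^sup>2 * n + 2 * Re (c * (ip H w (v k) - t)))
          \<longlonglongrightarrow> (cmod c)\<^sup>2 * n + 2 * Re (c * (ip H w u - t))"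
        by (intro tendsto_intros lim_ip_right v u w)
      moreover have "(\<lambda>k. - (1 / real (Suc k))) \<longlonglongrightarrow> - 0"
        by (intro tendsto_minus LIMSEQ_Suc[OF lim_1_over_n])
      ultimately have "- 0 \<le> (cmod c)\<^sup>2 * n + 2 * Re (c * (ip H w u - t))"
        by (intro LIMSEQ_le[where X = "\<lambda>k. - (1 / real (Suc k))"]) auto
      then show ?thesis by (simp add: b_def)
    qed
    \<comment> \<open>The step c = - r cnj(b) turns the linear term into - 2 r |b|^2; the 1 in the
      denominator gives r n <= 1 and covers n = 0.\<close>
    define r where "r = 1 / (n + 1)"
    have n: "n \<ge> 0" by (simp add: n_def)
    have "0 \<le> (cmod (- of_real r * cnj b))\<^sup>2 * n + 2 * Re ((- of_real r * cnj b) * b)"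
      by (rule *)
    also have "(- of_real r * cnj b) * b = - of_real (r * (cmod b)\<^sup>2)"
      by (simp add: complex_norm_square[symmetric] mult.assoc mult.commute[of "cnj b"] del: of_real_power)
    also have "(cmod (- of_real r * cnj b))\<^sup>2 = r\<^sup>2 * (cmod b)\<^sup>2"
      by (simp add: norm_mult power_mult_distrib)
    finally have pos: "0 \<le> r * (cmod b)\<^sup>2 * (r * n - 2)" by (simp add: power2_eq_square algebra_simps)
    have "r > 0" "r * n \<le> 1" using n by (auto simp: r_def field_simps)
    have "cmod b = 0"
    proof (rule ccontr)
      assume "cmod b \<noteq> 0"
      then have "r * (cmod b)\<^sup>2 > 0" using \<open>r > 0\<close> by simp
      then have "r * (cmod b)\<^sup>2 * (r * n - 2) < 0" using \<open>r * n \<le> 1\<close> by (intro mult_pos_neg) auto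
      with pos show False by simp
    qed
    then show ?thesis by (simp add: b_def)
  qed
  show ?thesis
  proof (rule that[OF u(1)])
    show "t = ip H w u" if "(w, t) \<in> \<Gamma>" for w t using eq that by blast
    show "\<exists>w t. (w, t) \<in> \<Gamma> \<and> hnorm H (u - w) < e" if e: "e > 0" for e
    proof -
      obtain k where "hnorm H (v k - u) < e"
        using order_tendstoD(2)[OF u(2) e] eventually_sequentially by auto
      then show ?thesis using vs[of k] hnorm_minus_commute[OF v u(1), of k] by auto
    qed
    show "hnorm H u \<le> C" if "C \<ge> 0"
    proof -
      have "(\<lambda>k. Re (ip H (v k) u)) \<longlonglongrightarrow> Re (ip H u u)"
        by (intro tendsto_intros lim_ip_left v u)
      moreover have "(\<lambda>k. C * hnorm H (v k)) \<longlonglongrightarrow> C * hnorm H u"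
        by (intro tendsto_intros lim_hnorm v u)
      moreover have "Re (ip H (v k) u) \<le> C * hnorm H (v k)" for k
        using bound[OF vs, of k] eq[OF vs, of k] complex_Re_le_cmod[of "ip H (v k) u"] by simp
      ultimately have "Re (ip H u u) \<le> C * hnorm H u"
        by (intro LIMSEQ_le[where X = "\<lambda>k. Re (ip H (v k) u)"]) auto
      then have "hnorm H u * hnorm H u \<le> C * hnorm H u"
        using u(1) by (simp add: hnorm_sq[symmetric] power2_eq_square)
      then show ?thesis using that hnorm_nonneg[OF u(1)]
        by (cases "hnorm H u = 0") auto
    qed
  qed
qed

end

section \<open>Bounded operators, adjoints and extension of contractions\<close>

lemma bounded_opsI:
  assumes "\<And>x. x \<in> vecs H \<Longrightarrow> T x \<in> vecs K"
    and "\<And>x y. x \<in> vecs H \<Longrightarrow> y \<in> vecs H \<Longrightarrow> T (x + y) = T x + T y"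
    and "\<And>c x. x \<in> vecs H \<Longrightarrow> T (c *\<^sub>C x) = c *\<^sub>C T x"
    and "\<And>x. x \<in> vecs H \<Longrightarrow> hnorm K (T x) \<le> C * hnorm H x"
  shows "T \<in> bounded_ops H K"
  using assms unfolding bounded_ops_def by blast

lemma bounded_opsD:
  assumes "T \<in> bounded_ops H K"
  shows "\<And>x. x \<in> vecs H \<Longrightarrow> T x \<in> vecs K"
    and "\<And>x y. x \<in> vecs H \<Longrightarrow> y \<in> vecs H \<Longrightarrow> T (x + y) = T x + T y"
    and "\<And>c x. x \<in> vecs H \<Longrightarrow> T (c *\<^sub>C x) = c *\<^sub>C T x"
  using assms unfolding bounded_ops_def by blast+

lemma bounded_ops_bound:
  assumes "T \<in> bounded_ops H K" "hilbert_space H"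
  obtains C where "C > 0" "\<And>x. x \<in> vecs H \<Longrightarrow> hnorm K (T x) \<le> C * hnorm H x"
proof -
  interpret H: hilbert_space H by fact
  obtain C where C: "\<And>x. x \<in> vecs H \<Longrightarrow> hnorm K (T x) \<le> C * hnorm H x"
    using assms unfolding bounded_ops_def by blast
  have "hnorm K (T x) \<le> (max C 1) * hnorm H x" if "x \<in> vecs H" for x
    using C[OF that] H.hnorm_nonneg[OF that] by (smt (verit) mult_right_mono)
  then show ?thesis using that[of "max C 1"] by auto
qed

lemma bounded_ops_zero: 
  assumes "T \<in> bounded_ops H K" "hilbert_space H"
  shows "T 0 = 0"
  using bounded_opsD(3)[OF assms(1), of 0 0] hilbert_space.zero_mem[OF assms(2)] by simp

lemma bounded_ops_diff: 
  assumes "T \<in> bounded_ops H K" "hilbert_space H" "x \<in> vecs H" "y \<in> vecs H"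
  shows "T (x - y) = T x - T y"
  using bounded_opsD(2)[OF assms(1), of "x - y" y] hilbert_space.diff_mem[OF assms(2)] assms by simp

lemma bounded_ops_sum_list: 
  assumes "T \<in> bounded_ops H K" "hilbert_space H" "\<And>x. x \<in> set l \<Longrightarrow> f x \<in> vecs H"
  shows "T (\<Sum>x\<leftarrow>l. f x) = (\<Sum>x\<leftarrow>l. T (f x))"
  using assms(3)
proof (induction l)
  case Nil
  then show ?case using bounded_ops_zero[OF assms(1,2)] by simp
next
  case (Cons a l)
  then have "T (f a + (\<Sum>x\<leftarrow>l. f x)) = T (f a) + T (\<Sum>x\<leftarrow>l. f x)"
    using assms(2) by (intro bounded_opsD(2)[OF assms(1)] hilbert_space.sum_list_mem) auto
  then show ?case using Cons by simp
qed

lemma bounded_ops_comp: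
  assumes "T \<in> bounded_ops H K" "S \<in> bounded_ops K L" "hilbert_space H" "hilbert_space K"
  shows "(\<lambda>x. S (T x)) \<in> bounded_ops H L"
proof -
  obtain C where C: "C > 0" "\<And>x. x \<in> vecs H \<Longrightarrow> hnorm K (T x) \<le> C * hnorm H x"
    using bounded_ops_bound[OF assms(1,3)] by blast
  obtain D where D: "D > 0" "\<And>x. x \<in> vecs K \<Longrightarrow> hnorm L (S x) \<le> D * hnorm K x"
    using bounded_ops_bound[OF assms(2,4)] by blast
  show ?thesis
  proof (rule bounded_opsI[where C = "D * C"])
    fix x assume x: "x \<in> vecs H"
    show "hnorm L (S (T x)) \<le> D * C * hnorm H x"
      using D(2)[of "T x"] C(2)[OF x] bounded_opsD(1)[OF assms(1) x] D(1)
      by (smt (verit) mult.assoc mult_left_mono)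
  qed (simp_all add: bounded_opsD[OF assms(1)] bounded_opsD[OF assms(2)])
qed

lemma bounded_ops_minus:
  assumes "T \<in> bounded_ops H K" "S \<in> bounded_ops H K" "hilbert_space H" "hilbert_space K"
  shows "(\<lambda>x. T x - S x) \<in> bounded_ops H K"
proof -
  interpret K: hilbert_space K by fact
  obtain C where C: "C > 0" "\<And>x. x \<in> vecs H \<Longrightarrow> hnorm K (T x) \<le> C * hnorm H x"
    using bounded_ops_bound[OF assms(1,3)] by blast
  obtain D where D: "D > 0" "\<And>x. x \<in> vecs H \<Longrightarrow> hnorm K (S x) \<le> D * hnorm H x"
    using bounded_ops_bound[OF assms(2,3)] by blast
  note mem = bounded_opsD(1)[OF assms(1)] bounded_opsD(1)[OF assms(2)]
  show ?thesis
  proof (rule bounded_opsI[where C = "C + D"])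
    fix x assume x: "x \<in> vecs H"
    show "hnorm K (T x - S x) \<le> (C + D) * hnorm H x"
      using D(2)[OF x] C(2)[OF x] K.hnorm_triangle_diff[of "T x" "S x"] mem x by (simp add: algebra_simps)
  qed (auto simp: mem bounded_opsD(2,3)[OF assms(1)] bounded_opsD(2,3)[OF assms(2)]
      complex_vector.scale_right_diff_distrib)
qed

lemma contractionD:
  assumes "contraction H K T"
  shows "T \<in> bounded_ops H K" "\<And>x. x \<in> vecs H \<Longrightarrow> hnorm K (T x) \<le> hnorm H x"
  using assms unfolding contraction_def by blast+

locale bounded_op = H: hilbert_space H + K: hilbert_space K
  for H :: "'a::complex_vector hspace" and K :: "'b::complex_vector hspace" +
  fixes T :: "'a \<Rightarrow> 'b"
  assumes T: "T \<in> bounded_ops H K"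
begin

text \<open>\<open>adj\<close> is a definite description, so nothing is known about it before
  existence and uniqueness; \<open>riesz_relation\<close> is applied to the graph of the functional
  x -> <T x, y>.\<close>

lemma adj_ex1: 
  assumes y: "y \<in> vecs K"
  shows "\<exists>!u. u \<in> vecs H \<and> (\<forall>x\<in>vecs H. ip K (T x) y = ip H x u)"
proof -
  obtain C where C: "C > 0" "\<And>x. x \<in> vecs H \<Longrightarrow> hnorm K (T x) \<le> C * hnorm H x"
    using bounded_ops_bound[OF T H.hilbert_space_axioms] by blast
  define \<Gamma> where "\<Gamma> = {(x, ip K (T x) y) | x. x \<in> vecs H}"
  have "\<exists>u. u \<in> vecs H \<and> (\<forall>x\<in>vecs H. ip K (T x) y = ip H x u)"
  proof (rule H.riesz_relation[of \<Gamma> "C * hnorm K y"])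
    show "(0, 0) \<in> \<Gamma>" 
      using y bounded_ops_zero[OF T H.hilbert_space_axioms] H.zero_mem K.ip_zero_left unfolding \<Gamma>_def by force
    show "(v + w, s + t) \<in> \<Gamma>" if "(v, s) \<in> \<Gamma>" "(w, t) \<in> \<Gamma>" for v s w t
      using that y bounded_opsD[OF T] by (auto simp: \<Gamma>_def K.ip_linear)
    show "(c *\<^sub>C v, c * s) \<in> \<Gamma>" if "(v, s) \<in> \<Gamma>" for c v s
      using that y bounded_opsD[OF T] by (auto simp: \<Gamma>_def K.ip_linear)
    show "cmod s \<le> C * hnorm K y * hnorm H v" if "(v, s) \<in> \<Gamma>" for v s
    proof -
      have v: "v \<in> vecs H" "s = ip K (T v) y" using that by (auto simp: \<Gamma>_def)
      have "cmod s \<le> hnorm K (T v) * hnorm K y"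
        using v y bounded_opsD(1)[OF T] by (simp add: K.cauchy_schwarz)
      also have "\<dots> \<le> (C * hnorm H v) * hnorm K y"
        using C(2) v y by (intro mult_right_mono) auto
      finally show ?thesis by (simp add: mult_ac)
    qed
  qed (auto simp: \<Gamma>_def)
  then show ?thesis using H.ip_eqI by metis
qed

lemma adj_mem [simp]: "y \<in> vecs K \<Longrightarrow> adj H K T y \<in> vecs H"
  and ip_adj: "y \<in> vecs K \<Longrightarrow> x \<in> vecs H \<Longrightarrow> ip H x (adj H K T y) = ip K (T x) y"
proof -
  assume y: "y \<in> vecs K"
  have *: "adj H K T y \<in> vecs H \<and> (\<forall>x\<in>vecs H. ip K (T x) y = ip H x (adj H K T y))"
    using theI'[OF adj_ex1[OF y]] unfolding adj_def .
  show "adj H K T y \<in> vecs H" using * by blast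
  show "x \<in> vecs H \<Longrightarrow> ip H x (adj H K T y) = ip K (T x) y" using * by simp
qed

lemma ip_adj_left: "y \<in> vecs K \<Longrightarrow> x \<in> vecs H \<Longrightarrow> ip H (adj H K T y) x = ip K y (T x)"
  by (metis H.ip_commute K.ip_commute T adj_mem bounded_opsD(1) ip_adj)

lemma adj_eqI: "y \<in> vecs K \<Longrightarrow> u \<in> vecs H \<Longrightarrow> (\<And>x. x \<in> vecs H \<Longrightarrow> ip K (T x) y = ip H x u) \<Longrightarrow> adj H K T y = u"
  by (metis H.ip_eqI adj_mem ip_adj)

lemma hnorm_adj_le:
  assumes C: "C \<ge> 0" "\<And>x. x \<in> vecs H \<Longrightarrow> hnorm K (T x) \<le> C * hnorm H x" and y: "y \<in> vecs K"
  shows "hnorm H (adj H K T y) \<le> C * hnorm K y"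
proof -
  let ?u = "adj H K T y"
  have u: "?u \<in> vecs H" using y by simp
  have "(hnorm H ?u)\<^sup>2 = Re (ip K (T ?u) y)"
    using ip_adj[OF y u] u by (simp add: H.hnorm_sq)
  also have "\<dots> \<le> hnorm K (T ?u) * hnorm K y"
    using K.cauchy_schwarz[of "T ?u" y] y u bounded_opsD(1)[OF T] complex_Re_le_cmod order_trans by blast
  also have "\<dots> \<le> (C * hnorm H ?u) * hnorm K y"
    using C u y by (intro mult_right_mono) auto
  finally have "hnorm H ?u * hnorm H ?u \<le> (C * hnorm K y) * hnorm H ?u"
    by (simp add: power2_eq_square mult_ac)
  moreover have "0 \<le> C * hnorm K y" using C y by simp
  ultimately show ?thesis
    using H.hnorm_nonneg[OF u] by (cases "hnorm H ?u = 0") auto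
qed

lemma adj_bounded: "adj H K T \<in> bounded_ops K H"
proof -
  obtain C where C: "C > 0" "\<And>x. x \<in> vecs H \<Longrightarrow> hnorm K (T x) \<le> C * hnorm H x"
    using bounded_ops_bound[OF T H.hilbert_space_axioms] by blast
  show ?thesis
  proof (rule bounded_opsI[where C = C])
    show "hnorm H (adj H K T x) \<le> C * hnorm K x" if "x \<in> vecs K" for x
      using hnorm_adj_le C that by auto
    show "adj H K T (x + y) = adj H K T x + adj H K T y" if "x \<in> vecs K" "y \<in> vecs K" for x y
      using that by (intro adj_eqI) (auto simp: H.ip_linear K.ip_linear ip_adj bounded_opsD(1)[OF T])
    show "adj H K T (c *\<^sub>C x) = c *\<^sub>C adj H K T x" if "x \<in> vecs K" for x c
      using that by (intro adj_eqI) (auto simp: H.ip_linear K.ip_linear ip_adj bounded_opsD(1)[OF T])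
  qed simp
qed

lemma contraction_adj: "contraction H K T \<Longrightarrow> contraction K H (adj H K T)"
  using adj_bounded hnorm_adj_le[of 1] by (auto simp: contraction_def)

lemma adj_adj: "x \<in> vecs H \<Longrightarrow> adj K H (adj H K T) x = T x"
proof -
  interpret a: bounded_op K H "adj H K T"
    using adj_bounded by unfold_locales
  show "x \<in> vecs H \<Longrightarrow> adj K H (adj H K T) x = T x"
    by (intro a.adj_eqI) (auto simp: ip_adj_left bounded_opsD(1)[OF T])
qed

end

lemma bounded_opI: "hilbert_space H \<Longrightarrow> hilbert_space K \<Longrightarrow> T \<in> bounded_ops H K \<Longrightarrow> bounded_op H K T"
  by (simp add: bounded_op_def bounded_op_axioms_def)

text \<open>The extension is obtained as an adjoint. For \<open>y'\<close> in \<open>K\<close> the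
  relation x -> <y, y'> over the pairs of \<open>\<Gamma>\<close> is bounded by |y'|, and
  \<open>riesz_relation\<close> represents it by a vector \<open>W y'\<close> in the closure of the
  domain. \<open>W\<close> is a linear contraction, and its adjoint extends \<open>\<Gamma>\<close>
  and kills the orthogonal complement of the domain. That \<open>\<Gamma>\<close> is single-valued
  is a consequence of the bound.\<close>

lemma contraction_extension:
  fixes H :: "'a::complex_vector hspace" and K :: "'b::complex_vector hspace"
  assumes "hilbert_space H" "hilbert_space K"
    and dom: "\<And>x y. (x, y) \<in> \<Gamma> \<Longrightarrow> x \<in> vecs H \<and> y \<in> vecs K" and zero: "(0, 0) \<in> \<Gamma>"
    and add: "\<And>v s w t. (v, s) \<in> \<Gamma> \<Longrightarrow> (w, t) \<in> \<Gamma> \<Longrightarrow> (v + w, s + t) \<in> \<Gamma>"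
    and scale: "\<And>c v s. (v, s) \<in> \<Gamma> \<Longrightarrow> (c *\<^sub>C v, c *\<^sub>C s) \<in> \<Gamma>"
    and bound: "\<And>x y. (x, y) \<in> \<Gamma> \<Longrightarrow> hnorm K y \<le> hnorm H x"
  obtains T where "contraction H K T" "\<And>x y. (x, y) \<in> \<Gamma> \<Longrightarrow> T x = y"
proof -
  interpret H: hilbert_space H by fact
  interpret K: hilbert_space K by fact
  \<comment> \<open>Closeness to the domain singles out one of the representing vectors; linearity
    of \<open>W\<close> rests on this uniqueness.\<close>
  define P where "P y' u \<longleftrightarrow> u \<in> vecs H \<and> (\<forall>x y. (x, y) \<in> \<Gamma> \<longrightarrow> ip K y y' = ip H x u) \<and>
      (\<forall>e>0. \<exists>x y. (x, y) \<in> \<Gamma> \<and> hnorm H (u - x) < e)" for y' u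
  have P_ip: "ip K y y' = ip H x u" if "P y' u" "(x, y) \<in> \<Gamma>" for x y y' u
    using that unfolding P_def by blast
  have P_close: "\<exists>x y. (x, y) \<in> \<Gamma> \<and> hnorm H (u - x) < e" if "P y' u" "e > 0" for y' u e
    using that unfolding P_def by blast
  have ex: "\<exists>u. P y' u \<and> hnorm H u \<le> hnorm K y'" if y': "y' \<in> vecs K" for y'
  proof (rule H.riesz_relation[of "{(x, ip K y y') | x y. (x, y) \<in> \<Gamma>}" "hnorm K y'"])
    show "(0, 0) \<in> {(x, ip K y y') | x y. (x, y) \<in> \<Gamma>}"
      using zero y' K.ip_zero_left by force
    show "v \<in> vecs H" if "(v, s) \<in> {(x, ip K y y') | x y. (x, y) \<in> \<Gamma>}" for v s
      using that dom by blast
    show "(v + w, s + t) \<in> {(x, ip K y y') | x y. (x, y) \<in> \<Gamma>}"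
      if hyp: "(v, s) \<in> {(x, ip K y y') | x y. (x, y) \<in> \<Gamma>}" "(w, t) \<in> {(x, ip K y y') | x y. (x, y) \<in> \<Gamma>}" for v s w t
    proof -
      obtain y1 y2 where "s = ip K y1 y'" "(v, y1) \<in> \<Gamma>" "t = ip K y2 y'" "(w, y2) \<in> \<Gamma>"
        using hyp by blast
      moreover from this have "ip K (y1 + y2) y' = s + t" using dom y' K.ip_add_left by metis
      ultimately show ?thesis using add by (metis (mono_tags, lifting) mem_Collect_eq)
    qed
    show "(c *\<^sub>C v, c * s) \<in> {(x, ip K y y') | x y. (x, y) \<in> \<Gamma>}"
      if hyp: "(v, s) \<in> {(x, ip K y y') | x y. (x, y) \<in> \<Gamma>}" for c v s
    proof -
      obtain y1 where "s = ip K y1 y'" "(v, y1) \<in> \<Gamma>"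
        using hyp by blast
      moreover from this have "ip K (c *\<^sub>C y1) y' = c * s" using dom y' K.ip_scaleC_left by metis
      ultimately show ?thesis using scale by (metis (mono_tags, lifting) mem_Collect_eq)
    qed
    show "cmod s \<le> hnorm K y' * hnorm H v" if hyp: "(v, s) \<in> {(x, ip K y y') | x y. (x, y) \<in> \<Gamma>}" for v s
    proof -
      obtain y where y: "s = ip K y y'" "(v, y) \<in> \<Gamma>" using hyp by blast
      have "cmod s \<le> hnorm K y * hnorm K y'" using y dom y' by (simp add: K.cauchy_schwarz)
      also have "\<dots> \<le> hnorm H v * hnorm K y'" using bound[OF y(2)] y' by (intro mult_right_mono) auto
      finally show ?thesis by (simp add: mult_ac)
    qed
  next
    fix u assume u: "u \<in> vecs H" "\<And>v s. (v, s) \<in> {(x, ip K y y') | x y. (x, y) \<in> \<Gamma>} \<Longrightarrow> s = ip H v u"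
      "0 \<le> hnorm K y' \<Longrightarrow> hnorm H u \<le> hnorm K y'"
      "\<And>e. 0 < e \<Longrightarrow> \<exists>v s. (v, s) \<in> {(x, ip K y y') | x y. (x, y) \<in> \<Gamma>} \<and> hnorm H (u - v) < e"
    have "ip K y y' = ip H x u" if "(x, y) \<in> \<Gamma>" for x y using u(2) that by blast
    moreover have "\<exists>x y. (x, y) \<in> \<Gamma> \<and> hnorm H (u - x) < e" if "e > 0" for e using u(4)[OF that] by blast
    moreover have "hnorm H u \<le> hnorm K y'" using u(3) y' by simp
    ultimately show ?thesis using u(1) unfolding P_def by blast
  qed
  have uniq: "u = u'" if hP: "P y u" "P y u'" for y u u'
  proof (rule ccontr)
    assume ne: "u \<noteq> u'"
    have uu: "u \<in> vecs H" "u' \<in> vecs H" using hP by (auto simp: P_def)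
    define n where "n = hnorm H (u - u')"
    have n: "n > 0" using ne uu H.hnorm_eq_0[of "u - u'"] H.hnorm_nonneg[of "u - u'"] H.diff_mem[of u u']
      unfolding n_def by (simp add: order_le_less)
    obtain x y1 where x: "(x, y1) \<in> \<Gamma>" "hnorm H (u - x) < n / 2"
      using P_close[OF hP(1), of "n / 2"] n by auto
    obtain x' y1' where x': "(x', y1') \<in> \<Gamma>" "hnorm H (u' - x') < n / 2"
      using P_close[OF hP(2), of "n / 2"] n by auto
    have xx: "x \<in> vecs H" "x' \<in> vecs H" using dom x x' by blast+
    \<comment> \<open>Both vectors represent the same functional, so u - u' is orthogonal to x and
      x', which in turn approximate u and u'.\<close>
    have orth: "ip H x u = ip H x u'" "ip H x' u = ip H x' u'"
      using P_ip[OF hP(1) x(1)] P_ip[OF hP(2) x(1)] P_ip[OF hP(1) x'(1)] P_ip[OF hP(2) x'(1)]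
      by simp_all
    have "n\<^sup>2 = Re (ip H ((u - x) - (u' - x')) (u - u'))"
      using uu xx orth by (simp add: n_def H.hnorm_sq H.ip_linear algebra_simps)
    also have "\<dots> \<le> hnorm H ((u - x) - (u' - x')) * n"
      using H.cauchy_schwarz[of "(u - x) - (u' - x')" "u - u'"] uu xx
        complex_Re_le_cmod[of "ip H ((u - x) - (u' - x')) (u - u')"]
      unfolding n_def by simp
    also have "\<dots> \<le> (hnorm H (u - x) + hnorm H (u' - x')) * n"
      using n uu xx by (intro mult_right_mono H.hnorm_triangle_diff) auto
    also have "\<dots> < n * n" using x x' n by (intro mult_strict_right_mono) auto
    finally show False by (simp add: power2_eq_square)
  qed
  define W where "W y = (SOME u. P y u \<and> hnorm H u \<le> hnorm K y)" for y
  have W: "P y (W y)" "hnorm H (W y) \<le> hnorm K y" if "y \<in> vecs K" for y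
    using someI_ex[OF ex[OF that]] unfolding W_def by blast+
  have W_mem: "W y \<in> vecs H" if "y \<in> vecs K" for y using W that by (simp add: P_def)
  have Wb: "W \<in> bounded_ops K H"
  proof (rule bounded_opsI[where C = 1])
    fix y z assume yz: "y \<in> vecs K" "z \<in> vecs K"
    have "P (y + z) (W y + W z)"
      unfolding P_def
    proof (intro conjI allI impI)
      show "W y + W z \<in> vecs H" using yz W_mem by simp
      show "ip K s (y + z) = ip H x (W y + W z)" if "(x, s) \<in> \<Gamma>" for x s
        using P_ip[OF W(1)[OF yz(1)] that] P_ip[OF W(1)[OF yz(2)] that] yz dom[OF that] W_mem
        by (simp add: K.ip_linear H.ip_linear)
      fix e :: real assume e: "e > 0"
      obtain x1 s1 where 1: "(x1, s1) \<in> \<Gamma>" "hnorm H (W y - x1) < e / 2"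
        using P_close[OF W(1)[OF yz(1)], of "e / 2"] e by auto
      obtain x2 s2 where 2: "(x2, s2) \<in> \<Gamma>" "hnorm H (W z - x2) < e / 2"
        using P_close[OF W(1)[OF yz(2)], of "e / 2"] e by auto
      have "hnorm H (W y + W z - (x1 + x2)) \<le> hnorm H (W y - x1) + hnorm H (W z - x2)"
        using H.hnorm_triangle[of "W y - x1" "W z - x2"] yz W_mem dom[OF 1(1)] dom[OF 2(1)]
        by (simp add: algebra_simps)
      then show "\<exists>x s. (x, s) \<in> \<Gamma> \<and> hnorm H (W y + W z - x) < e"
        using 1 2 add[OF 1(1) 2(1)] by (intro exI[of _ "x1 + x2"] exI[of _ "s1 + s2"]) auto
    qed
    then show "W (y + z) = W y + W z" using uniq[OF W(1)[of "y + z"]] yz by simp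
  next
    fix c y assume y: "y \<in> vecs K"
    have "P (c *\<^sub>C y) (c *\<^sub>C W y)"
      unfolding P_def
    proof (intro conjI allI impI)
      show "c *\<^sub>C W y \<in> vecs H" using y W_mem by simp
      show "ip K s (c *\<^sub>C y) = ip H x (c *\<^sub>C W y)" if "(x, s) \<in> \<Gamma>" for x s
        using P_ip[OF W(1)[OF y] that] y dom[OF that] W_mem
        by (simp add: K.ip_linear H.ip_linear)
      fix e :: real assume e: "e > 0"
      obtain x1 s1 where 1: "(x1, s1) \<in> \<Gamma>" "hnorm H (W y - x1) < e / (cmod c + 1)"
        using P_close[OF W(1)[OF y], of "e / (cmod c + 1)"] e by (auto simp: add_nonneg_pos)
      have "hnorm H (c *\<^sub>C W y - c *\<^sub>C x1) = cmod c * hnorm H (W y - x1)"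
        using y W_mem dom[OF 1(1)] by (simp flip: complex_vector.scale_right_diff_distrib)
      also have "\<dots> \<le> (cmod c + 1) * hnorm H (W y - x1)"
        using y W_mem dom[OF 1(1)] by (intro mult_right_mono) auto
      also have "\<dots> < e" using 1(2) add_nonneg_pos[of "cmod c" 1] by (simp add: pos_less_divide_eq mult.commute)
      finally show "\<exists>x s. (x, s) \<in> \<Gamma> \<and> hnorm H (c *\<^sub>C W y - x) < e"
        using scale[OF 1(1), of c] by blast
    qed
    then show "W (c *\<^sub>C y) = c *\<^sub>C W y" using uniq[OF W(1)[of "c *\<^sub>C y"]] y by simp
  qed (use W W_mem in auto)
  interpret W: bounded_op K H W using Wb by unfold_locales
  show ?thesis
  proof (rule that[of "adj K H W"])
    show "contraction H K (adj K H W)"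
      using W.contraction_adj Wb W(2) by (auto simp: contraction_def)
    fix x y assume xy: "(x, y) \<in> \<Gamma>"
    show "adj K H W x = y"
    proof (rule W.adj_eqI)
      fix z assume z: "z \<in> vecs K"
      have "ip K y z = ip H x (W z)" using P_ip[OF W(1)[OF z] xy] .
      then show "ip H (W z) x = ip K z y"
        using dom[OF xy] z W_mem[OF z] H.ip_commute[of x "W z"] K.ip_commute[of y z] by simp
    qed (use dom xy in auto)
  qed
qed

text \<open>No Neumann series is needed: the vector representing the functional
  \<open>y - N\<^sup>*y \<mapsto> \<langle>y, b\<rangle>\<close> is a solution.\<close>

lemma strict_contraction_fixpoint:
  assumes "hilbert_space H" and N: "N \<in> bounded_ops H H" and b: "b \<in> vecs H"
    and r: "0 \<le> r" "r < 1" "\<And>x. x \<in> vecs H \<Longrightarrow> hnorm H (N x) \<le> r * hnorm H x"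
  shows "\<exists>!x. x \<in> vecs H \<and> x = N x + b"
proof (rule ex_ex1I)
  interpret H: hilbert_space H by fact
  interpret N: bounded_op H H N using N by unfold_locales
  note N_mem = bounded_opsD(1)[OF N]
  let ?A = "adj H H N"
  note A = bounded_opsD[OF N.adj_bounded]
  \<comment> \<open>Strict contractivity bounds I - N^* from below, so the functional on its range
    is single-valued and bounded by |b| / (1 - r).\<close>
  have lower: "(1 - r) * hnorm H y \<le> hnorm H (y - ?A y)" if "y \<in> vecs H" for y
    using H.hnorm_triangle_abs[of y "?A y"] N.hnorm_adj_le[OF r(1,3) that] that by (simp add: algebra_simps)
  show "\<exists>x. x \<in> vecs H \<and> x = N x + b"
  proof (rule H.riesz_relation[of "{(y - ?A y, ip H y b) | y. y \<in> vecs H}" "hnorm H b / (1 - r)"])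
    show "(0, 0) \<in> {(y - ?A y, ip H y b) | y. y \<in> vecs H}"
      using bounded_ops_zero[OF N.adj_bounded H.hilbert_space_axioms] b by (auto intro!: exI[of _ 0])
    show "(v + w, s + t) \<in> {(y - ?A y, ip H y b) | y. y \<in> vecs H}"
      if hyp: "(v, s) \<in> {(y - ?A y, ip H y b) | y. y \<in> vecs H}" "(w, t) \<in> {(y - ?A y, ip H y b) | y. y \<in> vecs H}" for v s w t
    proof -
      obtain y z where y: "y \<in> vecs H" "v = y - ?A y" "s = ip H y b" "z \<in> vecs H" "w = z - ?A z" "t = ip H z b"
        using hyp by blast
      then have "v + w = (y + z) - ?A (y + z)" "s + t = ip H (y + z) b" "y + z \<in> vecs H"
        using b by (simp_all add: A H.ip_linear)
      then show ?thesis by blast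
    qed
    show "(c *\<^sub>C v, c * s) \<in> {(y - ?A y, ip H y b) | y. y \<in> vecs H}"
      if hyp: "(v, s) \<in> {(y - ?A y, ip H y b) | y. y \<in> vecs H}" for c v s
    proof -
      obtain y where y: "y \<in> vecs H" "v = y - ?A y" "s = ip H y b"
        using hyp by blast
      then have "c *\<^sub>C v = (c *\<^sub>C y) - ?A (c *\<^sub>C y)" "c * s = ip H (c *\<^sub>C y) b" "c *\<^sub>C y \<in> vecs H"
        using b by (simp_all add: A H.ip_linear complex_vector.scale_right_diff_distrib)
      then show ?thesis by blast
    qed
    show "cmod s \<le> hnorm H b / (1 - r) * hnorm H v" if hyp: "(v, s) \<in> {(y - ?A y, ip H y b) | y. y \<in> vecs H}" for v s
    proof -
      obtain y where y: "y \<in> vecs H" "v = y - ?A y" "s = ip H y b" using hyp by blast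
      have "cmod s \<le> hnorm H y * hnorm H b" using y b by (simp add: H.cauchy_schwarz)
      also have "\<dots> \<le> (hnorm H v / (1 - r)) * hnorm H b"
        using lower[OF y(1), folded y(2)] r(1,2) b by (intro mult_right_mono) (auto simp: pos_le_divide_eq mult.commute)
      finally show ?thesis by (simp add: mult_ac)
    qed
  next
    fix u assume u: "u \<in> vecs H" "\<And>v s. (v, s) \<in> {(y - ?A y, ip H y b) | y. y \<in> vecs H} \<Longrightarrow> s = ip H v u"
    have "u - N u = b"
    proof (rule H.ip_eqI)
      fix y assume y: "y \<in> vecs H"
      then have "ip H y b = ip H (y - ?A y) u" using u(2) by blast
      then show "ip H y (u - N u) = ip H y b"
        using y u(1) N_mem by (simp add: H.ip_linear N.ip_adj_left)
    qed (use u(1) b N_mem in auto)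
    then show "\<exists>x. x \<in> vecs H \<and> x = N x + b" using u(1) by (auto simp: algebra_simps)
  qed auto
  fix x y assume xy: "x \<in> vecs H \<and> x = N x + b" "y \<in> vecs H \<and> y = N y + b"
  have mem: "x - y \<in> vecs H" using xy by (intro H.diff_mem) auto
  have "x - y = N (x - y)"
    using xy bounded_ops_diff[OF N H.hilbert_space_axioms, of x y] by (metis add_diff_cancel_right)
  then have "hnorm H (x - y) \<le> r * hnorm H (x - y)"
    using r(3)[OF mem] by simp
  then have "hnorm H (x - y) = 0"
    using r(2) H.hnorm_nonneg[OF mem] by (cases "hnorm H (x - y) = 0") (auto simp: mult_le_cancel_right1)
  then show "x = y" using mem H.hnorm_eq_0[of "x - y"] by simp
qed

context hilbert_space
begin

lemma limit_unique:
  assumes "\<And>k. s k \<in> vecs H" "l \<in> vecs H" "l' \<in> vecs H"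
    "(\<lambda>k::nat. hnorm H (s k - l)) \<longlonglongrightarrow> 0" "(\<lambda>k. hnorm H (s k - l')) \<longlonglongrightarrow> 0"
  shows "l = l'"
proof (rule ip_eqI)
  fix z assume z: "z \<in> vecs H"
  show "ip H z l = ip H z l'"
    using LIMSEQ_unique[OF lim_ip_right[OF assms(1,2) z assms(4)] lim_ip_right[OF assms(1,3) z assms(5)]] .
qed (use assms in auto)

lemma limit_add:
  assumes "\<And>k. s k \<in> vecs H" "l \<in> vecs H" "\<And>k. t k \<in> vecs H" "r \<in> vecs H"
    "(\<lambda>k::nat. hnorm H (s k - l)) \<longlonglongrightarrow> 0" "(\<lambda>k. hnorm H (t k - r)) \<longlonglongrightarrow> 0"
  shows "(\<lambda>k. hnorm H (s k + t k - (l + r))) \<longlonglongrightarrow> 0"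
proof (rule Lim_null_comparison)
  show "\<forall>\<^sub>F k in sequentially. norm (hnorm H (s k + t k - (l + r))) \<le> hnorm H (s k - l) + hnorm H (t k - r)"
  proof (intro always_eventually allI)
    fix k
    have "hnorm H ((s k - l) + (t k - r)) \<le> hnorm H (s k - l) + hnorm H (t k - r)"
      using assms by (intro hnorm_triangle) auto
    then show "norm (hnorm H (s k + t k - (l + r))) \<le> hnorm H (s k - l) + hnorm H (t k - r)"
      using assms by (simp add: algebra_simps)
  qed
  show "(\<lambda>k. hnorm H (s k - l) + hnorm H (t k - r)) \<longlonglongrightarrow> 0"
    using tendsto_add[OF assms(5,6)] by simp
qed

lemma limit_scale:
  assumes "\<And>k. s k \<in> vecs H" "l \<in> vecs H" "(\<lambda>k::nat. hnorm H (s k - l)) \<longlonglongrightarrow> 0"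
  shows "(\<lambda>k. hnorm H (c *\<^sub>C s k - c *\<^sub>C l)) \<longlonglongrightarrow> 0"
  using tendsto_mult_right_zero[OF assms(3), of "cmod c"] assms
  by (simp flip: complex_vector.scale_right_diff_distrib)

end

section \<open>Direct sums and square-summable families\<close>

instantiation prod :: (complex_vector, complex_vector) complex_vector
begin
definition scaleC_prod_def: "a *\<^sub>C p = (a *\<^sub>C fst p, a *\<^sub>C snd p)"
instance
  by standard (simp_all add: scaleC_prod_def plus_prod_def scaleC_add_right scaleC_add_left
      scaleC_scaleC scaleC_one)
end

lemma fst_scaleC [simp]: "fst (c *\<^sub>C p) = c *\<^sub>C fst p"
  and snd_scaleC [simp]: "snd (c *\<^sub>C p) = c *\<^sub>C snd p"
  by (simp_all add: scaleC_prod_def)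

definition prod_hspace :: "'a hspace \<Rightarrow> 'b hspace \<Rightarrow> ('a \<times> 'b) hspace" (infixr "\<times>\<^sub>H" 80) where
  "H \<times>\<^sub>H K = \<lparr>vecs = vecs H \<times> vecs K, ip = (\<lambda>p q. ip H (fst p) (fst q) + ip K (snd p) (snd q))\<rparr>"

lemma vecs_prod [simp]: "vecs (H \<times>\<^sub>H K) = vecs H \<times> vecs K"
  and ip_prod: "ip (H \<times>\<^sub>H K) p q = ip H (fst p) (fst q) + ip K (snd p) (snd q)"
  by (simp_all add: prod_hspace_def)

lemma hnorm_prod_sq:
  assumes "hilbert_space H" "hilbert_space K" "p \<in> vecs (H \<times>\<^sub>H K)"
  shows "(hnorm (H \<times>\<^sub>H K) p)\<^sup>2 = (hnorm H (fst p))\<^sup>2 + (hnorm K (snd p))\<^sup>2"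
proof -
  interpret H: hilbert_space H by fact
  interpret K: hilbert_space K by fact
  show ?thesis using assms(3) H.Re_ip_self K.Re_ip_self
    by (auto simp: H.hnorm_sq K.hnorm_sq ip_prod hnorm_def mem_Times_iff)
qed

lemma prod_hilbert:
  assumes "hilbert_space H" "hilbert_space K"
  shows "hilbert_space (H \<times>\<^sub>H K)"
proof -
  interpret H: hilbert_space H by fact
  interpret K: hilbert_space K by fact
  show ?thesis
  proof
    show "complex_vector.subspace (vecs (H \<times>\<^sub>H K))"
      by (auto simp: complex_vector.subspace_def zero_prod_def scaleC_prod_def)
    show "ip (H \<times>\<^sub>H K) y x = cnj (ip (H \<times>\<^sub>H K) x y)" if "x \<in> vecs (H \<times>\<^sub>H K)" "y \<in> vecs (H \<times>\<^sub>H K)" for x y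
      using that H.ip_commute[of "fst x" "fst y"] K.ip_commute[of "snd x" "snd y"]
      by (simp add: ip_prod mem_Times_iff)
    show "0 < Re (ip (H \<times>\<^sub>H K) x x)" if "x \<in> vecs (H \<times>\<^sub>H K)" "x \<noteq> 0" for x
    proof -
      have "fst x \<noteq> 0 \<or> snd x \<noteq> 0" using that(2) by (simp add: prod_eq_iff)
      then show ?thesis using that(1) H.ip_pos[of "fst x"] K.ip_pos[of "snd x"]
          H.Re_ip_self[of "fst x"] K.Re_ip_self[of "snd x"]
        by (auto simp: ip_prod mem_Times_iff)
    qed
    fix s :: "nat \<Rightarrow> _"
    assume s: "\<And>k. s k \<in> vecs (H \<times>\<^sub>H K)"
      and C: "\<And>e. e > 0 \<Longrightarrow> \<exists>N. \<forall>j\<ge>N. \<forall>k\<ge>N. hnorm (H \<times>\<^sub>H K) (s j - s k) < e"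
    have mem: "fst (s k) \<in> vecs H" "snd (s k) \<in> vecs K" for k using s[of k] by (auto simp: mem_Times_iff)
    have le: "hnorm H (fst p) \<le> hnorm (H \<times>\<^sub>H K) p" "hnorm K (snd p) \<le> hnorm (H \<times>\<^sub>H K) p"
      if "p \<in> vecs (H \<times>\<^sub>H K)" for p
      using that H.Re_ip_self[of "fst p"] K.Re_ip_self[of "snd p"]
      by (auto simp: hnorm_def ip_prod mem_Times_iff)
    have d: "s j - s k \<in> vecs (H \<times>\<^sub>H K)" for j k using mem by (auto simp: mem_Times_iff)
    have "\<exists>l\<in>vecs H. (\<lambda>k. hnorm H (fst (s k) - l)) \<longlonglongrightarrow> 0"
      using mem le(1)[OF d] C by (intro H.complete_vecs) (auto, metis le_less_trans)
    then obtain l where l: "l \<in> vecs H" "(\<lambda>k. hnorm H (fst (s k) - l)) \<longlonglongrightarrow> 0" by blast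
    have "\<exists>l\<in>vecs K. (\<lambda>k. hnorm K (snd (s k) - l)) \<longlonglongrightarrow> 0"
      using mem le(2)[OF d] C by (intro K.complete_vecs) (auto, metis le_less_trans)
    then obtain r where r: "r \<in> vecs K" "(\<lambda>k. hnorm K (snd (s k) - r)) \<longlonglongrightarrow> 0" by blast
    have "(\<lambda>k. hnorm (H \<times>\<^sub>H K) (s k - (l, r))) = (\<lambda>k. sqrt ((hnorm H (fst (s k) - l))\<^sup>2 + (hnorm K (snd (s k) - r))\<^sup>2))"
      using l r mem by (simp add: hnorm_def ip_prod H.Re_ip_self K.Re_ip_self)
    moreover have "\<dots> \<longlonglongrightarrow> sqrt (0\<^sup>2 + 0\<^sup>2)" by (intro tendsto_intros l r)
    ultimately show "\<exists>l\<in>vecs (H \<times>\<^sub>H K). (\<lambda>k. hnorm (H \<times>\<^sub>H K) (s k - l)) \<longlonglongrightarrow> 0"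
      using l(1) r(1) by (intro bexI[of _ "(l, r)"]) auto
  qed (auto simp: ip_prod H.ip_linear K.ip_linear mem_Times_iff algebra_simps)
qed

text \<open>The index type is arbitrary: a finite type gives the n-fold direct sum in which row
  operators take their values, the type of words gives the Fock space with coefficients in
  \<open>E\<close>.\<close>

definition l2_hspace :: "'a::complex_vector hspace \<Rightarrow> ('i \<Rightarrow> 'a) hspace" where
  "l2_hspace E = \<lparr>vecs = {f. (\<forall>i. f i \<in> vecs E) \<and> (\<lambda>i. (hnorm E (f i))\<^sup>2) summable_on UNIV},
     ip = (\<lambda>f g. \<Sum>\<^sub>\<infinity>i. ip E (f i) (g i))\<rparr>"

lemma vecs_l2: "f \<in> vecs (l2_hspace E) \<longleftrightarrow> (\<forall>i. f i \<in> vecs E) \<and> (\<lambda>i. (hnorm E (f i))\<^sup>2) summable_on UNIV"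
  and ip_l2: "ip (l2_hspace E) f g = (\<Sum>\<^sub>\<infinity>i. ip E (f i) (g i))"
  by (simp_all add: l2_hspace_def)

lemma scaleC_fun_apply [simp]: "(c *\<^sub>C f) x = c *\<^sub>C f x"
  by (simp add: scaleC_fun_def)

context hilbert_space
begin

lemma l2_ip_summable:
  assumes f: "f \<in> vecs (l2_hspace H)" and g: "g \<in> vecs (l2_hspace H)"
  shows "(\<lambda>i. ip H (f i) (g i)) summable_on UNIV"
proof (rule Infinite_Sum.abs_summable_summable, rule Infinite_Sum.abs_summable_on_comparison_test')
  show "(\<lambda>i. (hnorm H (f i))\<^sup>2 + (hnorm H (g i))\<^sup>2) summable_on UNIV"
    using f g by (intro summable_on_add) (auto simp: vecs_l2)
  fix i
  have "cmod (ip H (f i) (g i)) \<le> hnorm H (f i) * hnorm H (g i)"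
    using f g by (intro cauchy_schwarz) (auto simp: vecs_l2)
  also have "\<dots> \<le> (hnorm H (f i))\<^sup>2 + (hnorm H (g i))\<^sup>2"
  proof -
    have "0 \<le> hnorm H (f i) * hnorm H (g i)" using f g by (simp add: vecs_l2)
    then show ?thesis using sum_squares_bound[of "hnorm H (f i)" "hnorm H (g i)"] by linarith
  qed
  finally show "norm (ip H (f i) (g i)) \<le> (hnorm H (f i))\<^sup>2 + (hnorm H (g i))\<^sup>2" .
qed

lemma l2_sq: "f \<in> vecs (l2_hspace H) \<Longrightarrow> Re (ip (l2_hspace H) f f) = (\<Sum>\<^sub>\<infinity>i. (hnorm H (f i))\<^sup>2)"
proof -
  assume f: "f \<in> vecs (l2_hspace H)"
  have "Re (ip (l2_hspace H) f f) = (\<Sum>\<^sub>\<infinity>i. Re (ip H (f i) (f i)))"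
    unfolding ip_l2 by (rule infsum_Re[OF l2_ip_summable[OF f f], symmetric])
  then show ?thesis using f by (simp add: hnorm_sq vecs_l2)
qed

lemma hnorm_l2_sq: "f \<in> vecs (l2_hspace H) \<Longrightarrow> (hnorm (l2_hspace H) f)\<^sup>2 = (\<Sum>\<^sub>\<infinity>i. (hnorm H (f i))\<^sup>2)"
  unfolding hnorm_def[of "l2_hspace H"] l2_sq by (simp add: infsum_nonneg)

lemma l2_add_mem:
  assumes f: "f \<in> vecs (l2_hspace H)" and g: "g \<in> vecs (l2_hspace H)"
  shows "f + g \<in> vecs (l2_hspace H)"
proof -
  have "(\<lambda>i. (hnorm H (f i + g i))\<^sup>2) summable_on UNIV"
  proof (rule summable_on_comparison_test)
    show "(\<lambda>i. 2 * (hnorm H (f i))\<^sup>2 + 2 * (hnorm H (g i))\<^sup>2) summable_on UNIV"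
      using f g by (intro summable_on_add summable_on_cmult_right) (auto simp: vecs_l2)
  qed (use f g in \<open>auto simp: vecs_l2 hnorm_add_sq_le\<close>)
  then show ?thesis using f g by (auto simp: vecs_l2)
qed

lemma l2_scale_mem:
  assumes f: "f \<in> vecs (l2_hspace H)"
  shows "c *\<^sub>C f \<in> vecs (l2_hspace H)"
  using f by (auto simp: vecs_l2 power_mult_distrib intro!: summable_on_cmult_right)

lemma l2_zero_mem: "0 \<in> vecs (l2_hspace H)"
  by (simp add: vecs_l2)

lemma l2_diff_mem:
  assumes f: "f \<in> vecs (l2_hspace H)" and g: "g \<in> vecs (l2_hspace H)"
  shows "f - g \<in> vecs (l2_hspace H)"
  using l2_add_mem[OF f l2_scale_mem[OF g, of "-1"]]
  by (simp add: complex_vector.scale_minus_left)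

lemma l2_sum_le: "f \<in> vecs (l2_hspace H) \<Longrightarrow> finite F \<Longrightarrow> (\<Sum>i\<in>F. (hnorm H (f i))\<^sup>2) \<le> (hnorm (l2_hspace H) f)\<^sup>2"
  unfolding hnorm_l2_sq by (rule finite_sum_le_infsum) (auto simp: vecs_l2)

lemma l2_coord_le: "f \<in> vecs (l2_hspace H) \<Longrightarrow> hnorm H (f i) \<le> hnorm (l2_hspace H) f"
proof -
  assume f: "f \<in> vecs (l2_hspace H)"
  have "(hnorm H (f i))\<^sup>2 \<le> (hnorm (l2_hspace H) f)\<^sup>2" using l2_sum_le[OF f, of "{i}"] by simp
  moreover have "hnorm (l2_hspace H) f \<ge> 0"
    using l2_sq[OF f] by (simp add: hnorm_def infsum_nonneg)
  ultimately show ?thesis using power2_le_imp_le by blast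
qed

lemma l2_hilbert: "hilbert_space (l2_hspace H :: ('i \<Rightarrow> 'a) hspace)"
proof
  let ?L = "l2_hspace H :: ('i \<Rightarrow> 'a) hspace"
  show "complex_vector.subspace (vecs ?L)"
    unfolding complex_vector.subspace_def using l2_zero_mem l2_add_mem l2_scale_mem by blast
  show "ip ?L (x + y) z = ip ?L x z + ip ?L y z" if "x \<in> vecs ?L" "y \<in> vecs ?L" "z \<in> vecs ?L" for x y z
  proof -
    have "ip ?L (x + y) z = (\<Sum>\<^sub>\<infinity>i. ip H (x i) (z i) + ip H (y i) (z i))"
      using that by (auto simp: ip_l2 ip_linear vecs_l2 intro!: infsum_cong)
    then show ?thesis using that by (simp add: infsum_add l2_ip_summable ip_l2)
  qed
  show "ip ?L (c *\<^sub>C x) y = c * ip ?L x y" if "x \<in> vecs ?L" "y \<in> vecs ?L" for x y c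
  proof -
    have "ip ?L (c *\<^sub>C x) y = (\<Sum>\<^sub>\<infinity>i. c * ip H (x i) (y i))"
      using that by (auto simp: ip_l2 ip_linear vecs_l2 intro!: infsum_cong)
    then show ?thesis using that by (simp add: infsum_cmult_right l2_ip_summable ip_l2)
  qed
  show "ip ?L y x = cnj (ip ?L x y)" if "x \<in> vecs ?L" "y \<in> vecs ?L" for x y
  proof -
    have "(\<Sum>\<^sub>\<infinity>i. ip H (y i) (x i)) = (\<Sum>\<^sub>\<infinity>i. cnj (ip H (x i) (y i)))"
      using that by (intro infsum_cong ip_commute) (auto simp: vecs_l2)
    then show ?thesis by (simp add: ip_l2)
  qed
  show "0 < Re (ip ?L x x)" if x: "x \<in> vecs ?L" "x \<noteq> 0" for x
  proof -
    obtain i where i: "x i \<noteq> 0" using x(2) by (auto simp: fun_eq_iff)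
    then have "0 < (hnorm H (x i))\<^sup>2" using x(1) hnorm_eq_0[of "x i"] by (auto simp: vecs_l2)
    also have "\<dots> \<le> (hnorm ?L x)\<^sup>2" using l2_sum_le[OF x(1), of "{i}"] by simp
    also have "\<dots> = Re (ip ?L x x)" using x by (simp add: hnorm_l2_sq l2_sq)
    finally show ?thesis .
  qed
  fix s :: "nat \<Rightarrow> ('i \<Rightarrow> 'a)"
  assume s: "\<And>k. s k \<in> vecs ?L"
    and C: "\<And>e. e > 0 \<Longrightarrow> \<exists>N. \<forall>j\<ge>N. \<forall>k\<ge>N. hnorm ?L (s j - s k) < e"
  have mem: "s k i \<in> vecs H" for k i using s[of k] by (simp add: vecs_l2)
  have d: "s j - s k \<in> vecs ?L" for j k using s l2_diff_mem by blast
  have "\<exists>l\<in>vecs H. (\<lambda>k. hnorm H (s k i - l)) \<longlonglongrightarrow> 0" for i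
  proof (rule complete_vecs)
    fix e :: real assume "e > 0"
    obtain N where "\<forall>j\<ge>N. \<forall>k\<ge>N. hnorm ?L (s j - s k) < e" using C[OF \<open>e > 0\<close>] by blast
    moreover have "hnorm H (s j i - s k i) \<le> hnorm ?L (s j - s k)" for j k
      using l2_coord_le[OF d, of j k i] by simp
    ultimately show "\<exists>N. \<forall>j\<ge>N. \<forall>k\<ge>N. hnorm H (s j i - s k i) < e"
      by (meson le_less_trans)
  qed (rule mem)
  then obtain l where l: "\<And>i. l i \<in> vecs H" "\<And>i. (\<lambda>k. hnorm H (s k i - l i)) \<longlonglongrightarrow> 0" by metis
  \<comment> \<open>The Cauchy estimate is passed to the coordinatewise limit on finite index sets,
    with a bound that does not depend on the set; summability of the limit follows.\<close>
  have fatou: "(\<Sum>i\<in>F. (hnorm H (s j i - l i))\<^sup>2) \<le> e\<^sup>2"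
    if "finite F" and j: "j \<ge> N" and N: "\<forall>j\<ge>N. \<forall>k\<ge>N. hnorm ?L (s j - s k) < e" for F j N e
  proof (rule LIMSEQ_le)
    show "(\<lambda>k. \<Sum>i\<in>F. (hnorm H (s j i - s k i))\<^sup>2) \<longlonglongrightarrow> (\<Sum>i\<in>F. (hnorm H (s j i - l i))\<^sup>2)"
    proof (intro tendsto_sum tendsto_power lim_hnorm)
      fix i
      have "s j i - s k i - (s j i - l i) = - (s k i - l i)" for k by simp
      then have "hnorm H (s j i - s k i - (s j i - l i)) = hnorm H (s k i - l i)" for k
        using mem l by (simp only: hnorm_uminus diff_mem)
      then show "(\<lambda>k. hnorm H (s j i - s k i - (s j i - l i))) \<longlonglongrightarrow> 0" using l(2) by simp
    qed (use mem l in auto)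
    show "(\<lambda>k. e\<^sup>2) \<longlonglongrightarrow> e\<^sup>2" by simp
    have "(\<Sum>i\<in>F. (hnorm H (s j i - s k i))\<^sup>2) \<le> e\<^sup>2" if "k \<ge> N" for k
    proof -
      have "(\<Sum>i\<in>F. (hnorm H (s j i - s k i))\<^sup>2) \<le> (hnorm ?L (s j - s k))\<^sup>2"
        using l2_sum_le[OF d \<open>finite F\<close>, of j k] by simp
      also have "\<dots> \<le> e\<^sup>2"
      proof (rule power_mono)
        show "hnorm ?L (s j - s k) \<le> e" using N j that by (simp add: less_imp_le)
        show "0 \<le> hnorm ?L (s j - s k)" using l2_sq[OF d, of j k] by (simp add: hnorm_def infsum_nonneg)
      qed
      finally show ?thesis .
    qed
    then show "\<exists>N. \<forall>k\<ge>N. (\<Sum>i\<in>F. (hnorm H (s j i - s k i))\<^sup>2) \<le> e\<^sup>2" by blast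
  qed
  have tail: "s j - l \<in> vecs ?L \<and> (hnorm ?L (s j - l))\<^sup>2 \<le> e\<^sup>2"
    if j: "j \<ge> N" and N: "\<forall>j\<ge>N. \<forall>k\<ge>N. hnorm ?L (s j - s k) < e" for j N e
  proof -
    have sm: "(\<lambda>i. (hnorm H (s j i - l i))\<^sup>2) summable_on UNIV"
      using fatou[OF _ j N] by (intro nonneg_bounded_partial_sums_imp_summable_on[where C = "e\<^sup>2"])
        (auto intro: always_eventually simp: eventually_finite_subsets_at_top_weakI)
    then have m: "s j - l \<in> vecs ?L" using mem l by (simp add: vecs_l2)
    have "(hnorm ?L (s j - l))\<^sup>2 \<le> e\<^sup>2"
      unfolding hnorm_l2_sq[OF m] using sm fatou[OF _ j N] by (intro infsum_le_finite_sums) auto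
    with m show ?thesis by blast
  qed
  obtain N where N: "\<forall>j\<ge>N. \<forall>k\<ge>N. hnorm ?L (s j - s k) < 1" using C[of 1] by auto
  have "s N - (s N - l) \<in> vecs ?L" using tail[OF order_refl N] s l2_diff_mem by blast
  then have lmem: "l \<in> vecs ?L" by simp
  have "(\<lambda>k. hnorm ?L (s k - l)) \<longlonglongrightarrow> 0"
  proof (rule LIMSEQ_I)
    fix r :: real assume r: "r > 0"
    then obtain N where N: "\<forall>j\<ge>N. \<forall>k\<ge>N. hnorm ?L (s j - s k) < r / 2" using C[of "r / 2"] by auto
    have "norm (hnorm ?L (s k - l) - 0) < r" if "k \<ge> N" for k
    proof -
      have "(hnorm ?L (s k - l))\<^sup>2 \<le> (r / 2)\<^sup>2" and m: "s k - l \<in> vecs ?L" using tail[OF that N] by auto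
      then have "\<bar>hnorm ?L (s k - l)\<bar> \<le> \<bar>r / 2\<bar>" using abs_le_square_iff by blast
      then show ?thesis using r by simp
    qed
    then show "\<exists>N. \<forall>k\<ge>N. norm (hnorm ?L (s k - l) - 0) < r" by blast
  qed
  with lmem show "\<exists>l\<in>vecs ?L. (\<lambda>k. hnorm ?L (s k - l)) \<longlonglongrightarrow> 0" by blast
qed

end

lemma vecs_l2_finite: "f \<in> vecs (l2_hspace E :: ('i::finite \<Rightarrow> _) hspace) \<longleftrightarrow> (\<forall>i. f i \<in> vecs E)"
  by (simp add: vecs_l2)

lemma ip_l2_finite: "ip (l2_hspace E :: ('i::finite \<Rightarrow> _) hspace) f g = (\<Sum>i\<in>UNIV. ip E (f i) (g i))"
  by (simp add: ip_l2)

lemma (in hilbert_space) hnorm_l2_finite_sq: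
  "\<forall>i. f i \<in> vecs H \<Longrightarrow> (hnorm (l2_hspace H :: ('i::finite \<Rightarrow> _) hspace) f)\<^sup>2 = (\<Sum>i\<in>UNIV. (hnorm H (f i))\<^sup>2)"
  by (simp add: hnorm_l2_sq vecs_l2)

text \<open>Polynomials in \<open>B\<close> with nonnegative coefficients, paired with their value at 1,
  which bounds the operator norm when \<open>B\<close> is a contraction.\<close>

inductive nn_poly :: "('a::complex_vector \<Rightarrow> 'a) \<Rightarrow> ('a \<Rightarrow> 'a) \<Rightarrow> real \<Rightarrow> bool" for B where
  zero: "nn_poly B (\<lambda>x. 0) 0"
| base: "nn_poly B B 1"
| add: "nn_poly B T s \<Longrightarrow> nn_poly B S t \<Longrightarrow> nn_poly B (\<lambda>x. T x + S x) (s + t)"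
| mult: "nn_poly B T s \<Longrightarrow> nn_poly B S t \<Longrightarrow> nn_poly B (\<lambda>x. T (S x)) (s * t)"
| half: "nn_poly B T s \<Longrightarrow> nn_poly B (\<lambda>x. (1/2) *\<^sub>C T x) (s / 2)"

section \<open>Square roots of positive operators\<close>

context hilbert_space
begin

lemma nn_poly_bounded:
  assumes B: "contraction H H B" and T: "nn_poly B T t"
  shows "T \<in> bounded_ops H H \<and> 0 \<le> t \<and> (\<forall>x\<in>vecs H. hnorm H (T x) \<le> t * hnorm H x)"
  using T
proof induction
  case zero
  show ?case by (auto intro!: bounded_opsI[where C = 0])
next
  case base
  show ?case using contractionD[OF B] by auto
next
  case (add T s S t)
  then have m: "T x \<in> vecs H" "S x \<in> vecs H" if "x \<in> vecs H" for x
    using bounded_opsD(1) that by blast+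
  have le: "hnorm H (T x + S x) \<le> (s + t) * hnorm H x" if "x \<in> vecs H" for x
  proof -
    have "hnorm H (T x) \<le> s * hnorm H x" "hnorm H (S x) \<le> t * hnorm H x" using add.IH that by auto
    then show ?thesis using hnorm_triangle[OF m[OF that]] by (simp add: algebra_simps)
  qed
  have "(\<lambda>x. T x + S x) \<in> bounded_ops H H"
  proof (rule bounded_opsI[OF _ _ _ le])
    show "T (x + y) + S (x + y) = T x + S x + (T y + S y)" if "x \<in> vecs H" "y \<in> vecs H" for x y
      using add.IH that bounded_opsD(2)[of T H H x y] bounded_opsD(2)[of S H H x y] by simp
    show "T (c *\<^sub>C x) + S (c *\<^sub>C x) = c *\<^sub>C (T x + S x)" if "x \<in> vecs H" for x c
      using add.IH that bounded_opsD(3)[of T H H x c] bounded_opsD(3)[of S H H x c] by (simp add: scaleC_add_right)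
  qed (use m in auto)
  then show ?case using add.IH le by auto
next
  case (mult T s S t)
  then have m: "S x \<in> vecs H" if "x \<in> vecs H" for x
    using bounded_opsD(1) that by blast
  have "hnorm H (T (S x)) \<le> s * t * hnorm H x" if "x \<in> vecs H" for x
  proof -
    have "hnorm H (T (S x)) \<le> s * hnorm H (S x)" using mult.IH m that by blast
    also have "\<dots> \<le> s * (t * hnorm H x)" using mult.IH that by (intro mult_left_mono) auto
    finally show ?thesis by simp
  qed
  then show ?case using mult.IH bounded_ops_comp[of S H H T H] hilbert_space_axioms by auto
next
  case (half T s)
  then have m: "T x \<in> vecs H" if "x \<in> vecs H" for x
    using bounded_opsD(1) that by blast
  have le: "hnorm H ((1/2) *\<^sub>C T x) \<le> s / 2 * hnorm H x" if "x \<in> vecs H" for x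
    using m[OF that] half.IH that by (auto simp: norm_divide)
  have "(\<lambda>x. (1/2) *\<^sub>C T x) \<in> bounded_ops H H"
  proof (rule bounded_opsI[OF _ _ _ le])
    show "(1/2) *\<^sub>C T (x + y) = (1/2) *\<^sub>C T x + (1/2) *\<^sub>C T y" if "x \<in> vecs H" "y \<in> vecs H" for x y
      using half.IH that bounded_opsD(2)[of T H H x y] by (simp add: scaleC_add_right)
    show "(1/2) *\<^sub>C T (c *\<^sub>C x) = c *\<^sub>C ((1/2) *\<^sub>C T x)" if "x \<in> vecs H" for x c
      using half.IH that bounded_opsD(3)[of T H H x c] by (simp add: scaleC_scaleC mult.commute)
  qed (use m in auto)
  then show ?case using half.IH le by auto
qed

text \<open>Commutation with \<open>B\<close> alone goes by induction on one polynomial, commutation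
  of two polynomials by induction on the other. It is what allows the difference of squares of
  consecutive iterates to be factored.\<close>

lemma nn_poly_commute:
  assumes B: "contraction H H B" and T: "nn_poly B T t" and S: "nn_poly B S s"
    and x: "x \<in> vecs H"
  shows "T (S x) = S (T x)"
proof -
  note Bl = bounded_opsD[OF contractionD(1)[OF B]]
  have TB: "T (B x) = B (T x)" if "nn_poly B T t" "x \<in> vecs H" for T t x
    using that
  proof (induction arbitrary: x)
    case zero
    show ?case using bounded_ops_zero[OF contractionD(1)[OF B] hilbert_space_axioms] by simp
  next
    case (add T s S t)
    then show ?case using Bl(2) nn_poly_bounded[OF B add.hyps(1)] nn_poly_bounded[OF B add.hyps(2)]
      by (simp add: bounded_opsD(1)[of _ H H])
  next
    case (mult T s S t)
    then show ?case using nn_poly_bounded[OF B mult.hyps(2)] by (simp add: bounded_opsD(1)[of _ H H])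
  next
    case (half T s)
    then show ?case using Bl(3) nn_poly_bounded[OF B half.hyps(1)] by (simp add: bounded_opsD(1)[of _ H H])
  qed simp
  have mem: "S x \<in> vecs H" if "nn_poly B S s" "x \<in> vecs H" for S s x
    using nn_poly_bounded[OF B that(1)] that(2) by (simp add: bounded_opsD(1)[of _ H H])
  note Sl = nn_poly_bounded[OF B S, THEN conjunct1]
  show ?thesis using T x
  proof (induction arbitrary: x)
    case zero
    show ?case using bounded_ops_zero[OF Sl hilbert_space_axioms] by simp
  next
    case base
    then show ?case using TB[OF S] by simp
  next
    case (add T s S' t)
    then show ?case using bounded_opsD(2)[OF Sl] mem by simp
  next
    case (mult T s S' t)
    then show ?case using mem by simp
  next
    case (half T s)
    then show ?case using bounded_opsD(3)[OF Sl] mem by simp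
  qed
qed

text \<open>A product of commuting symmetric operators is symmetric; the remaining rules are linear
  with real coefficients.\<close>

lemma nn_poly_selfadjoint:
  assumes B: "contraction H H B" and T: "nn_poly B T t"
    and sym: "\<And>x y. x \<in> vecs H \<Longrightarrow> y \<in> vecs H \<Longrightarrow> ip H (B x) y = ip H x (B y)"
    and "x \<in> vecs H" "y \<in> vecs H"
  shows "ip H (T x) y = ip H x (T y)"
proof -
  have mem: "S x \<in> vecs H" if "nn_poly B S s" "x \<in> vecs H" for S s x
    using nn_poly_bounded[OF B that(1)] that(2) by (simp add: bounded_opsD(1)[of _ H H])
  show ?thesis
    using T assms(4,5)
  proof (induction arbitrary: x y)
    case base
    then show ?case by (rule sym)
  next
    case (mult T s S t)
    then show ?case using mem nn_poly_commute[OF B mult.hyps(2,1)] by simp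
  qed (simp_all add: ip_linear mem)
qed

text \<open>The iteration \<open>Y\<^sub>k\<^sub>+\<^sub>1 = (B + Y\<^sub>k\<^sup>2) / 2\<close> converges to \<open>1 - sqrt (1 - B)\<close>; its increments are
  polynomials in \<open>B\<close> with nonnegative coefficients.\<close>

lemma positive_sqrt_contraction:
  assumes B: "contraction H H B"
    and sym: "\<And>x y. x \<in> vecs H \<Longrightarrow> y \<in> vecs H \<Longrightarrow> ip H (B x) y = ip H x (B y)"
  obtains R where "R \<in> bounded_ops H H" "\<And>x. x \<in> vecs H \<Longrightarrow> (hnorm H (R x))\<^sup>2 = Re (ip H (x - B x) x)"
proof -
  define Y where "Y = rec_nat (\<lambda>x::'a. 0) (\<lambda>k T x. (1/2) *\<^sub>C (B x + T (T x)))"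
  \<comment> \<open>The same recursion for B = 1. It increases, stays below 1, and its increments
    dominate those of \<open>Y\<close> in norm.\<close>
  define y where "y = rec_nat 0 (\<lambda>k t::real. (1 + t * t) / 2)"
  have Y0: "Y 0 = (\<lambda>x. 0)" and YS: "Y (Suc k) = (\<lambda>x. (1/2) *\<^sub>C (B x + Y k (Y k x)))" for k
    by (simp_all add: Y_def)
  have y0: "y 0 = 0" and yS: "y (Suc k) = (1 + y k * y k) / 2" for k
    by (simp_all add: y_def)
  have nn: "nn_poly B (Y k) (y k)" for k
  proof (induction k)
    case 0
    show ?case unfolding Y0 y0 by (rule nn_poly.zero)
  next
    case (Suc k)
    show ?case unfolding YS yS by (intro nn_poly.intros Suc)
  qed
  note nnb = nn_poly_bounded[OF B]
  have lin: "Y k \<in> bounded_ops H H" for k using nnb[OF nn] by blast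
  have mem: "Y k x \<in> vecs H" if "x \<in> vecs H" for k x using bounded_opsD(1)[OF lin that] .
  have Bm: "B x \<in> vecs H" if "x \<in> vecs H" for x using bounded_opsD(1)[OF contractionD(1)[OF B] that] .
  \<comment> \<open>Difference of squares: Y_(k+2) - Y_(k+1) = (Y_(k+1) + Y_k) (Y_(k+1) - Y_k) / 2,
    so nonnegative coefficients are inherited.\<close>
  have diff: "\<exists>D. nn_poly B D (y (Suc k) - y k) \<and> (\<forall>x\<in>vecs H. Y (Suc k) x - Y k x = D x)" for k
  proof (induction k)
    case 0
    have "nn_poly B (\<lambda>x. (1/2) *\<^sub>C B x) (1/2)" using nn_poly.half[OF nn_poly.base, of B] .
    then show ?case by (intro exI[of _ "\<lambda>x. (1/2) *\<^sub>C B x"]) (simp add: YS Y0 y0 yS)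
  next
    case (Suc k)
    then obtain D where D: "nn_poly B D (y (Suc k) - y k)" "\<And>x. x \<in> vecs H \<Longrightarrow> Y (Suc k) x - Y k x = D x" by blast
    define D' where "D' = (\<lambda>x. (1/2) *\<^sub>C ((\<lambda>x. Y (Suc k) x + Y k x) (D x)))"
    have "nn_poly B D' ((y (Suc k) + y k) * (y (Suc k) - y k) / 2)"
      unfolding D'_def by (intro nn_poly.half nn_poly.mult[of B "\<lambda>x. Y (Suc k) x + Y k x"] nn_poly.add nn D(1))
    also have "(y (Suc k) + y k) * (y (Suc k) - y k) / 2 = y (Suc (Suc k)) - y (Suc k)"
      unfolding yS[of "Suc k"] by (subst (5) yS) (simp add: field_simps)
    finally have 1: "nn_poly B D' (y (Suc (Suc k)) - y (Suc k))" .
    have "Y (Suc (Suc k)) x - Y (Suc k) x = D' x" if x: "x \<in> vecs H" for x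
    proof -
      have "Y (Suc (Suc k)) x - Y (Suc k) x = (1/2) *\<^sub>C (Y (Suc k) (Y (Suc k) x) - Y k (Y k x))"
        by (simp add: YS[of "Suc k"]) (subst (3) YS, simp add: complex_vector.scale_right_diff_distrib scaleC_add_right)
      also have "Y (Suc k) (Y (Suc k) x) - Y k (Y k x)
          = Y (Suc k) (Y (Suc k) x - Y k x) + Y k (Y (Suc k) x - Y k x)"
        using bounded_ops_diff[OF lin hilbert_space_axioms] mem x nn_poly_commute[OF B nn nn x, of k "Suc k"] by simp
      finally show ?thesis using D(2)[OF x] by (simp add: D'_def)
    qed
    with 1 show ?case by blast
  qed
  have step: "hnorm H (Y (Suc k) x - Y k x) \<le> (y (Suc k) - y k) * hnorm H x" and mono: "y k \<le> y (Suc k)"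
    if x: "x \<in> vecs H" for k x
    using diff[of k] nnb x by force+
  have mono: "y k \<le> y (Suc k)" for k using mono[OF zero_mem] .
  have y_bd: "0 \<le> y k \<and> y k \<le> 1" for k
  proof (induction k)
    case (Suc k)
    then show ?case using mult_mono[of "y k" 1 "y k" 1] by (simp add: yS)
  qed (simp add: y0)
  have tele: "hnorm H (Y (j + k) x - Y j x) \<le> (y (j + k) - y j) * hnorm H x" if x: "x \<in> vecs H" for j k x
  proof (induction k)
    case (Suc k)
    have "hnorm H (Y (j + Suc k) x - Y j x) \<le> hnorm H (Y (j + Suc k) x - Y (j + k) x) + hnorm H (Y (j + k) x - Y j x)"
      using x mem by (intro hnorm_triangle3) auto
    then show ?case using Suc step[OF x, of "j + k"] by (simp add: algebra_simps)
  qed simp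
  have inc: "incseq y" using mono by (simp add: incseq_SucI)
  have "\<exists>l\<in>vecs H. (\<lambda>k. hnorm H (Y k x - l)) \<longlonglongrightarrow> 0" if x: "x \<in> vecs H" for x
  proof (rule complete_vecs)
    fix e :: real assume e: "e > 0"
    have "convergent y" using inc y_bd by (intro Bseq_mono_convergent BseqI'[of _ 1]) (auto simp: incseq_def)
    then have "Cauchy y" by (rule convergent_Cauchy)
    moreover have n1: "0 < hnorm H x + 1" using hnorm_nonneg[OF x] by linarith
    ultimately obtain N where N: "\<And>m n. m \<ge> N \<Longrightarrow> n \<ge> N \<Longrightarrow> \<bar>y m - y n\<bar> < e / (hnorm H x + 1)"
      using e unfolding Cauchy_def dist_real_def by (metis divide_pos_pos)
    have main: "hnorm H (Y k x - Y j x) < e" if "N \<le> j" "j \<le> k" for j k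
    proof -
      have "hnorm H (Y k x - Y j x) \<le> (y k - y j) * hnorm H x"
        using tele[OF x, of j "k - j"] that by simp
      also have "\<dots> \<le> (y k - y j) * (hnorm H x + 1)"
        using inc that(2) by (intro mult_left_mono) (auto simp: incseq_def)
      also have "\<dots> < e" using N[of k j] that n1 by (simp add: pos_less_divide_eq abs_less_iff)
      finally show ?thesis .
    qed
    have "hnorm H (Y j x - Y k x) < e" if "N \<le> j" "N \<le> k" for j k
      using main[of j k] main[of k j] that hnorm_minus_commute[OF mem[OF x] mem[OF x], of j k]
      by (cases "j \<le> k") auto
    then show "\<exists>N. \<forall>j\<ge>N. \<forall>k\<ge>N. hnorm H (Y j x - Y k x) < e" by blast
  qed (rule mem[OF x])
  then have "\<forall>x. \<exists>l. x \<in> vecs H \<longrightarrow> l \<in> vecs H \<and> (\<lambda>k. hnorm H (Y k x - l)) \<longlonglongrightarrow> 0" by blast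
  then obtain Z where Z: "\<And>x. x \<in> vecs H \<Longrightarrow> Z x \<in> vecs H" "\<And>x. x \<in> vecs H \<Longrightarrow> (\<lambda>k. hnorm H (Y k x - Z x)) \<longlonglongrightarrow> 0"
    by metis
  have Zb: "Z \<in> bounded_ops H H"
  proof (rule bounded_opsI[where C = 1])
    show "Z (x + z) = Z x + Z z" if x: "x \<in> vecs H" and z: "z \<in> vecs H" for x z
    proof (rule limit_unique[of "\<lambda>k. Y k (x + z)"])
      show "(\<lambda>k. hnorm H (Y k (x + z) - (Z x + Z z))) \<longlonglongrightarrow> 0"
        using limit_add[OF mem[OF x] Z(1)[OF x] mem[OF z] Z(1)[OF z] Z(2)[OF x] Z(2)[OF z]]
        by (simp add: bounded_opsD(2)[OF lin x z])
    qed (use x z Z mem in auto)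
    show "Z (c *\<^sub>C x) = c *\<^sub>C Z x" if x: "x \<in> vecs H" for x c
    proof (rule limit_unique[of "\<lambda>k. Y k (c *\<^sub>C x)"])
      show "(\<lambda>k. hnorm H (Y k (c *\<^sub>C x) - c *\<^sub>C Z x)) \<longlonglongrightarrow> 0"
        using limit_scale[OF mem[OF x] Z(1)[OF x] Z(2)[OF x]]
        by (simp add: bounded_opsD(3)[OF lin x])
    qed (use x Z mem in auto)
    show "hnorm H (Z x) \<le> 1 * hnorm H x" if x: "x \<in> vecs H" for x
    proof (rule LIMSEQ_le[OF lim_hnorm[OF mem[OF x] Z(1)[OF x] Z(2)[OF x]]])
      have "hnorm H (Y k x) \<le> 1 * hnorm H x" for k
        using nnb[OF nn, of k] x y_bd[of k] hnorm_nonneg[OF x]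
        by (meson mult_right_mono order_trans)
      then show "\<exists>N. \<forall>n\<ge>N. hnorm H (Y n x) \<le> 1 * hnorm H x" by blast
    qed simp
  qed (use Z in auto)
  have id_b: "(\<lambda>x. x) \<in> bounded_ops H H" by (rule bounded_opsI[where C = 1]) auto
  have sq: "(hnorm H (x - Z x))\<^sup>2 = Re (ip H (x - B x) x)" if x: "x \<in> vecs H" for x
  proof (rule LIMSEQ_unique)
    have "(\<lambda>k. hnorm H (x - Y k x)) \<longlonglongrightarrow> hnorm H (x - Z x)"
    proof (rule lim_hnorm)
      have "hnorm H (x - Y k x - (x - Z x)) = hnorm H (Y k x - Z x)" for k
        using hnorm_minus_commute[OF Z(1)[OF x] mem[OF x], of k] by simp
      then show "(\<lambda>k. hnorm H (x - Y k x - (x - Z x))) \<longlonglongrightarrow> 0" using Z(2)[OF x] by simp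
    qed (use x mem Z in auto)
    then show "(\<lambda>k. (hnorm H (x - Y k x))\<^sup>2) \<longlonglongrightarrow> (hnorm H (x - Z x))\<^sup>2" by (intro tendsto_intros)
    \<comment> \<open>By symmetry |Y_k x|^2 = <Y_k^2 x, x>, and the recursion replaces Y_k^2 by 2
      Y_(k+1) - B. Only pairings of iterates with x remain, and in the limit they cancel.\<close>
    have eq: "(hnorm H (x - Y k x))\<^sup>2 = Re (ip H x x - 2 * ip H (Y k x) x + 2 * ip H (Y (Suc k) x) x - ip H (B x) x)" for k
    proof -
      have "ip H (Y k x) (Y k x) = ip H (Y k (Y k x)) x"
        using nn_poly_selfadjoint[OF B nn sym mem[OF x] x] by simp
      also have "Y k (Y k x) = 2 *\<^sub>C Y (Suc k) x - B x" by (simp add: YS scaleC_scaleC scaleC_one)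
      finally have "ip H (Y k x) (Y k x) = 2 * ip H (Y (Suc k) x) x - ip H (B x) x"
        using x mem Bm by (simp add: ip_linear)
      moreover have "Re (ip H x (Y k x)) = Re (ip H (Y k x) x)"
        using ip_commute[OF mem[OF x] x, of k] by simp
      ultimately show ?thesis using x mem by (simp add: hnorm_sq ip_linear)
    qed
    have lim: "(\<lambda>k. ip H (Y k x) x) \<longlonglongrightarrow> ip H (Z x) x"
      by (rule lim_ip_left[OF mem[OF x] Z(1)[OF x] x Z(2)[OF x]])
    have "(\<lambda>k. Re (ip H x x - 2 * ip H (Y k x) x + 2 * ip H (Y (Suc k) x) x - ip H (B x) x))
        \<longlonglongrightarrow> Re (ip H x x - 2 * ip H (Z x) x + 2 * ip H (Z x) x - ip H (B x) x)"
      by (intro tendsto_intros lim LIMSEQ_Suc[OF lim])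
    also have "ip H x x - 2 * ip H (Z x) x + 2 * ip H (Z x) x - ip H (B x) x = ip H (x - B x) x"
      using x Bm by (simp add: ip_linear)
    finally show "(\<lambda>k. (hnorm H (x - Y k x))\<^sup>2) \<longlonglongrightarrow> Re (ip H (x - B x) x)" unfolding eq .
  qed
  show ?thesis
    using that[OF bounded_ops_minus[OF id_b Zb hilbert_space_axioms hilbert_space_axioms]] sq by blast
qed

text \<open>If C bounds the norm of A, then B = I - A / C is a symmetric contraction and A = C (I -
  B), so sqrt(C) times the root of I - B serves. The identity |R x|^2 = <A x, x> is the property of
  the root that the energy balance of the colligation uses.\<close>

lemma positive_sqrt:
  assumes A: "A \<in> bounded_ops H H"
    and sym: "\<And>x y. x \<in> vecs H \<Longrightarrow> y \<in> vecs H \<Longrightarrow> ip H (A x) y = ip H x (A y)"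
    and pos: "\<And>x. x \<in> vecs H \<Longrightarrow> 0 \<le> Re (ip H (A x) x)"
  obtains R where "R \<in> bounded_ops H H" "\<And>x. x \<in> vecs H \<Longrightarrow> (hnorm H (R x))\<^sup>2 = Re (ip H (A x) x)"
proof -
  obtain C where C: "C > 0" "\<And>x. x \<in> vecs H \<Longrightarrow> hnorm H (A x) \<le> C * hnorm H x"
    using bounded_ops_bound[OF A hilbert_space_axioms] by blast
  note Al = bounded_opsD[OF A]
  define B where "B = (\<lambda>x. x - complex_of_real (1 / C) *\<^sub>C A x)"
  have Bm: "B x \<in> vecs H" if "x \<in> vecs H" for x using Al(1) that by (simp add: B_def)
  have nb: "hnorm H (B x) \<le> 1 * hnorm H x" if x: "x \<in> vecs H" for x
  proof -
    have "Re (ip H (A (A x)) (A x)) \<le> hnorm H (A (A x)) * hnorm H (A x)"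
      using cauchy_schwarz[of "A (A x)" "A x"] x Al(1) complex_Re_le_cmod[of "ip H (A (A x)) (A x)"]
      by (meson order_trans)
    also have "\<dots> \<le> C * hnorm H (A x) * hnorm H (A x)"
      using C(2) x Al(1) by (intro mult_right_mono) auto
    finally have AAA: "Re (ip H (A (A x)) (A x)) \<le> C * (hnorm H (A x))\<^sup>2" by (simp add: power2_eq_square)
    \<comment> \<open>Positivity of A at the vector B x gives |A x|^2 <= C <A x, x>, from which |B
      x| <= |x|.\<close>
    have "0 \<le> Re (ip H (A (B x)) (B x))" using pos Bm x by blast
    also have "A (B x) = A x - complex_of_real (1 / C) *\<^sub>C A (A x)"
      using x Al bounded_ops_diff[OF A hilbert_space_axioms, of x "complex_of_real (1 / C) *\<^sub>C A x"]
      by (simp add: B_def)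
    also have "Re (ip H (A x - complex_of_real (1 / C) *\<^sub>C A (A x)) (B x)) =
        Re (ip H (A x) x) - 2 / C * (hnorm H (A x))\<^sup>2 + 1 / C\<^sup>2 * Re (ip H (A (A x)) (A x))"
      using x Al(1) sym[of "A x" x] by (simp add: B_def ip_linear hnorm_sq) (simp add: power2_eq_square diff_divide_distrib)
    also have "\<dots> \<le> Re (ip H (A x) x) - 2 / C * (hnorm H (A x))\<^sup>2 + 1 / C\<^sup>2 * (C * (hnorm H (A x))\<^sup>2)"
      using AAA by (intro add_left_mono mult_left_mono) auto
    also have "\<dots> = Re (ip H (A x) x) - (hnorm H (A x))\<^sup>2 / C"
      using C(1) by (simp add: power2_eq_square field_simps)
    finally have key: "(hnorm H (A x))\<^sup>2 / C \<le> Re (ip H (A x) x)" by simp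
    have "(hnorm H (B x))\<^sup>2 = (hnorm H x)\<^sup>2 - 2 / C * Re (ip H (A x) x) + (hnorm H (A x))\<^sup>2 / C / C"
      using x Al(1) C(1) sym[of x x] by (simp add: B_def hnorm_diff_sq ip_linear norm_divide power_divide) (simp add: power2_eq_square)
    also have "\<dots> \<le> (hnorm H x)\<^sup>2 - 2 / C * Re (ip H (A x) x) + Re (ip H (A x) x) / C"
      using key C(1) by (intro add_left_mono divide_right_mono) auto
    also have "\<dots> \<le> (hnorm H x)\<^sup>2" using pos[OF x] C(1) by (simp add: field_simps)
    finally show ?thesis using x Bm by (simp add: power2_le_iff_abs_le)
  qed
  have "B \<in> bounded_ops H H"
  proof (rule bounded_opsI[OF Bm _ _ nb])
    show "B (x + y) = B x + B y" if "x \<in> vecs H" "y \<in> vecs H" for x y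
      using that by (simp add: B_def Al scaleC_add_right)
    show "B (c *\<^sub>C x) = c *\<^sub>C B x" if "x \<in> vecs H" for x c
      using that by (simp add: B_def Al complex_vector.scale_right_diff_distrib scaleC_scaleC mult.commute)
  qed
  then have Bc: "contraction H H B" using nb by (simp add: contraction_def)
  have Bsym: "ip H (B x) y = ip H x (B y)" if "x \<in> vecs H" "y \<in> vecs H" for x y
    using that sym Al(1) by (simp add: B_def ip_linear)
  obtain R where R: "R \<in> bounded_ops H H" "\<And>x. x \<in> vecs H \<Longrightarrow> (hnorm H (R x))\<^sup>2 = Re (ip H (x - B x) x)"
    using positive_sqrt_contraction[OF Bc Bsym] by metis
  note Rm = bounded_opsD(1)[OF R(1)]
  obtain D where D: "\<And>x. x \<in> vecs H \<Longrightarrow> hnorm H (R x) \<le> D * hnorm H x"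
    using bounded_ops_bound[OF R(1) hilbert_space_axioms] by metis
  show ?thesis
  proof (rule that[of "\<lambda>x. complex_of_real (sqrt C) *\<^sub>C R x"])
    show "(\<lambda>x. complex_of_real (sqrt C) *\<^sub>C R x) \<in> bounded_ops H H"
    proof (rule bounded_opsI[where C = "sqrt C * D"])
      show "hnorm H (complex_of_real (sqrt C) *\<^sub>C R x) \<le> sqrt C * D * hnorm H x" if "x \<in> vecs H" for x
        using D[OF that] Rm[OF that] C(1) by (simp add: mult.assoc)
    qed (use Rm bounded_opsD[OF R(1)] in \<open>auto simp: scaleC_add_right scaleC_scaleC mult.commute\<close>)
    fix x assume x: "x \<in> vecs H"
    have "(hnorm H (complex_of_real (sqrt C) *\<^sub>C R x))\<^sup>2 = C * Re (ip H (x - B x) x)"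
      using x Rm C(1) R(2)[OF x] by (simp add: power_mult_distrib)
    also have "x - B x = complex_of_real (1 / C) *\<^sub>C A x" by (simp add: B_def)
    finally show "(hnorm H (complex_of_real (sqrt C) *\<^sub>C R x))\<^sup>2 = Re (ip H (A x) x)"
      using x Al(1) C(1) by (simp add: ip_linear)
  qed
qed

end

section \<open>Positive semidefinite kernels\<close>

lemma sum_sum_list_swap:
  fixes f :: "'i \<Rightarrow> 'p \<Rightarrow> 'b::comm_monoid_add"
  shows "(\<Sum>i\<in>I. \<Sum>p\<leftarrow>l. f i p) = (\<Sum>p\<leftarrow>l. \<Sum>i\<in>I. f i p)"
  by (induction l) (auto simp: sum.distrib)

lemma tendsto_sum_list:
  fixes f :: "'p \<Rightarrow> 'x \<Rightarrow> 'b::topological_monoid_add"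
  assumes "\<And>p. p \<in> set l \<Longrightarrow> (f p \<longlongrightarrow> g p) F"
  shows "((\<lambda>x. \<Sum>p\<leftarrow>l. f p x) \<longlongrightarrow> (\<Sum>p\<leftarrow>l. g p)) F"
  using assms by (induction l) (auto intro!: tendsto_add)

lemma sum_list_cong_set: "(\<And>p. p \<in> set l \<Longrightarrow> f p = g p) \<Longrightarrow> (\<Sum>p\<leftarrow>l. f p) = (\<Sum>p\<leftarrow>l. g p)"
  by (metis map_cong)

text \<open>Coefficients are absent because points will be pairs of a ball point and a vector, and a
  scalar is absorbed into the vector. Lists allow repeated points, so images under maps that are not
  injective are covered.\<close>

definition psd :: "'p set \<Rightarrow> ('p \<Rightarrow> 'p \<Rightarrow> complex) \<Rightarrow> bool" where
  "psd A K \<longleftrightarrow> (\<forall>l. set l \<subseteq> A \<longrightarrow> 0 \<le> Re (\<Sum>p\<leftarrow>l. \<Sum>q\<leftarrow>l. K p q))"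

lemma psd_cong:
  assumes "\<And>p q. p \<in> A \<Longrightarrow> q \<in> A \<Longrightarrow> K p q = K' p q" "psd A K'"
  shows "psd A K"
  unfolding psd_def
proof (intro allI impI)
  fix l assume l: "set l \<subseteq> A"
  have "(\<Sum>p\<leftarrow>l. \<Sum>q\<leftarrow>l. K p q) = (\<Sum>p\<leftarrow>l. \<Sum>q\<leftarrow>l. K' p q)"
    using l assms(1) by (intro sum_list_cong_set) (meson subsetD)
  then show "0 \<le> Re (\<Sum>p\<leftarrow>l. \<Sum>q\<leftarrow>l. K p q)" using assms(2) l by (simp add: psd_def)
qed

lemma psd_add:
  assumes "psd A K" "psd A K'"
  shows "psd A (\<lambda>p q. K p q + K' p q)"
  using assms by (simp add: psd_def sum_list_addf)

lemma psd_sum: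
  assumes "finite I" "\<And>i. i \<in> I \<Longrightarrow> psd A (K i)"
  shows "psd A (\<lambda>p q. \<Sum>i\<in>I. K i p q)"
  using assms
proof (induction I)
  case empty
  show ?case by (simp add: psd_def)
next
  case (insert i I)
  then show ?case using psd_add[of A "K i" "\<lambda>p q. \<Sum>i\<in>I. K i p q"] by simp
qed

lemma psd_map:
  assumes "psd A K" "\<And>p. p \<in> B \<Longrightarrow> g p \<in> A"
  shows "psd B (\<lambda>p q. K (g p) (g q))"
  unfolding psd_def
proof (intro allI impI)
  fix l assume "set l \<subseteq> B"
  then have "set (map g l) \<subseteq> A" using assms(2) by auto
  then have "0 \<le> Re (\<Sum>p\<leftarrow>map g l. \<Sum>q\<leftarrow>map g l. K p q)" using assms(1) unfolding psd_def by blast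
  then show "0 \<le> Re (\<Sum>p\<leftarrow>l. \<Sum>q\<leftarrow>l. K (g p) (g q))" by (simp add: o_def)
qed

lemma (in hilbert_space) ip_sum_list_sum_list:
  assumes "\<And>p. p \<in> set l \<Longrightarrow> b p \<in> vecs H"
  shows "ip H (\<Sum>p\<leftarrow>l. b p) (\<Sum>p\<leftarrow>l. b p) = (\<Sum>p\<leftarrow>l. \<Sum>q\<leftarrow>l. ip H (b p) (b q))"
proof -
  have "ip H (\<Sum>p\<leftarrow>l. b p) (\<Sum>p\<leftarrow>l. b p) = (\<Sum>p\<leftarrow>l. ip H (b p) (\<Sum>q\<leftarrow>l. b q))"
    using assms by (intro ip_sum_list_left) auto
  also have "\<dots> = (\<Sum>p\<leftarrow>l. \<Sum>q\<leftarrow>l. ip H (b p) (b q))"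
    using assms by (intro sum_list_cong_set ip_sum_list_right) auto
  finally show ?thesis .
qed

lemma (in hilbert_space) psd_gram:
  assumes "\<And>p. p \<in> A \<Longrightarrow> b p \<in> vecs H"
  shows "psd A (\<lambda>p q. ip H (b p) (b q))"
  unfolding psd_def
proof (intro allI impI)
  fix l assume l: "set l \<subseteq> A"
  then have m: "b p \<in> vecs H" if "p \<in> set l" for p using assms that by blast
  show "0 \<le> Re (\<Sum>p\<leftarrow>l. \<Sum>q\<leftarrow>l. ip H (b p) (b q))"
    using ip_sum_list_sum_list[of l b, OF m] Re_ip_self[of "\<Sum>p\<leftarrow>l. b p"] m by simp
qed

section \<open>Kernels on pairs of a ball point and a vector\<close>

lemma cdot_norm_le: "cmod (cdot z w) \<le> norm z * norm w"
proof -
  have "cmod (cdot z w) \<le> (\<Sum>i\<in>UNIV. \<bar>cmod (z $ i)\<bar> * \<bar>cmod (w $ i)\<bar>)"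
    unfolding cdot_def abs_norm_cancel using norm_sum[of "\<lambda>i. z $ i * cnj (w $ i)" UNIV]
    by (simp add: norm_mult)
  also have "\<dots> \<le> norm z * norm w" unfolding norm_vec_def by (rule L2_set_mult_ineq)
  finally show ?thesis .
qed

lemma cdot_less_1: "z \<in> unit_ball \<Longrightarrow> w \<in> unit_ball \<Longrightarrow> cmod (cdot z w) < 1"
proof -
  assume "z \<in> unit_ball" "w \<in> unit_ball"
  then have *: "norm z < 1" "norm w < 1" by auto
  have "norm z * norm w \<le> norm z * 1" using * by (intro mult_left_mono) auto
  then show ?thesis using * cdot_norm_le[of z w] by linarith
qed

lemma cdot_ne_1: "z \<in> unit_ball \<Longrightarrow> w \<in> unit_ball \<Longrightarrow> 1 - cdot z w \<noteq> 0"
  using cdot_less_1[of z w] by auto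

abbreviation pts :: "'e hspace \<Rightarrow> ((complex^'n) \<times> 'e) set" where
  "pts E \<equiv> unit_ball \<times> vecs E"

definition sc :: "complex \<Rightarrow> (complex^'n) \<times> 'e::complex_vector \<Rightarrow> (complex^'n) \<times> 'e" where
  "sc c p = (fst p, c *\<^sub>C snd p)"

lemma fst_sc [simp]: "fst (sc c p) = fst p" and snd_sc [simp]: "snd (sc c p) = c *\<^sub>C snd p"
  by (simp_all add: sc_def)

lemma (in hilbert_space) sc_pts [simp]: "p \<in> pts H \<Longrightarrow> sc c p \<in> pts H"
  by (auto simp: sc_def)

lemma (in hilbert_space) sc_list:
  assumes "set l \<subseteq> pts H"
  shows "set (map (sc c) l) \<subseteq> pts H"
proof
  fix q assume "q \<in> set (map (sc c) l)"
  then obtain p where "p \<in> set l" "q = sc c p" by auto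
  then show "q \<in> pts H" using assms sc_pts by blast
qed

definition homogeneous :: "'e::complex_vector hspace \<Rightarrow> ((complex^'n) \<times> 'e \<Rightarrow> (complex^'n) \<times> 'e \<Rightarrow> complex) \<Rightarrow> bool" where
  "homogeneous E K \<longleftrightarrow> (\<forall>p\<in>pts E. \<forall>q\<in>pts E. \<forall>c d. K (sc c p) (sc d q) = c * cnj d * K p q)"

lemma homogeneous_diff: "homogeneous E K \<Longrightarrow> homogeneous E K' \<Longrightarrow> homogeneous E (\<lambda>p q. K p q - K' p q)"
  and homogeneous_scale: "homogeneous E K \<Longrightarrow> homogeneous E (\<lambda>p q. s (fst p) (fst q) * K p q)"
  by (simp_all add: homogeneous_def algebra_simps)

lemma (in hilbert_space) homogeneous_gram:
  assumes "\<And>p. p \<in> pts E \<Longrightarrow> b p \<in> vecs H" "\<And>p c. p \<in> pts E \<Longrightarrow> b (sc c p) = c *\<^sub>C b p"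
  shows "homogeneous E (\<lambda>p q. ip H (b p) (b q))"
  using assms by (auto simp: homogeneous_def ip_linear)

context hilbert_space
begin

text \<open><z,w> is the sum of the rank-one kernels z_i cnj(w_i), and by homogeneity each of them
  is absorbed into the points as the scalar cnj(w_i). The arguments are swapped because the entry at
  (p, q) is modelled on <k_p, k_q> = k(q, p).\<close>

lemma psd_cdot:
  fixes K :: "(complex^'n) \<times> 'a \<Rightarrow> (complex^'n) \<times> 'a \<Rightarrow> complex"
  assumes K: "psd (pts H) K" and hom: "homogeneous H K"
  shows "psd (pts H) (\<lambda>p q. cdot (fst q) (fst p) * K p q)"
proof (rule psd_cong)
  show "psd (pts H) (\<lambda>p q. \<Sum>i\<in>UNIV. K (sc (cnj (fst p $ i)) p) (sc (cnj (fst q $ i)) q))"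
    by (intro psd_sum psd_map[OF K]) simp_all
  show "cdot (fst q) (fst p) * K p q = (\<Sum>i\<in>UNIV. K (sc (cnj (fst p $ i)) p) (sc (cnj (fst q $ i)) q))"
    if "p \<in> pts H" "q \<in> pts H" for p q
  proof -
    have "K (sc c p) (sc d q) = c * cnj d * K p q" for c d
      using hom that unfolding homogeneous_def by blast
    then show ?thesis by (simp add: cdot_def sum_distrib_left sum_distrib_right mult.commute)
  qed
qed

lemma psd_cdot_power:
  fixes K :: "(complex^'n) \<times> 'a \<Rightarrow> (complex^'n) \<times> 'a \<Rightarrow> complex"
  assumes K: "psd (pts H) K" and hom: "homogeneous H K"
  shows "psd (pts H) (\<lambda>p q. cdot (fst q) (fst p) ^ k * K p q)"
proof (induction k)
  case (Suc k)
  have "homogeneous H (\<lambda>p q. cdot (fst q) (fst p) ^ k * K p q)"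
    using homogeneous_scale[OF hom, of "\<lambda>w z. cdot z w ^ k"] by simp
  from psd_cdot[OF Suc this] show ?case by (simp add: mult.assoc)
qed (use K in simp)

text \<open>The geometric series in <z,w> converges because |<z,w>| < 1 on the ball. Its partial
  sums are positive by \<open>psd_cdot_power\<close>, and for a fixed list the limit can be taken
  entry by entry.\<close>

lemma psd_geometric:
  fixes K :: "(complex^'n) \<times> 'a \<Rightarrow> (complex^'n) \<times> 'a \<Rightarrow> complex"
  assumes K: "psd (pts H) K" and hom: "homogeneous H K"
  shows "psd (pts H) (\<lambda>p q. 1 / (1 - cdot (fst q) (fst p)) * K p q)"
  unfolding psd_def
proof (intro allI impI)
  fix l :: "((complex^'n) \<times> 'a) list" assume l: "set l \<subseteq> pts H"
  have "psd (pts H) (\<lambda>p q. \<Sum>k<N. cdot (fst q) (fst p) ^ k * K p q)" for N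
    by (intro psd_sum psd_cdot_power assms) simp
  then have "0 \<le> Re (\<Sum>p\<leftarrow>l. \<Sum>q\<leftarrow>l. \<Sum>k<N. cdot (fst q) (fst p) ^ k * K p q)" for N
    using l unfolding psd_def by blast
  moreover have "(\<lambda>N. Re (\<Sum>p\<leftarrow>l. \<Sum>q\<leftarrow>l. \<Sum>k<N. cdot (fst q) (fst p) ^ k * K p q))
      \<longlonglongrightarrow> Re (\<Sum>p\<leftarrow>l. \<Sum>q\<leftarrow>l. 1 / (1 - cdot (fst q) (fst p)) * K p q)"
  proof (intro tendsto_Re tendsto_sum_list)
    fix p q assume "p \<in> set l" "q \<in> set l"
    then have "cmod (cdot (fst q) (fst p)) < 1" using l by (intro cdot_less_1) auto
    then have "(\<lambda>k. cdot (fst q) (fst p) ^ k) sums (1 / (1 - cdot (fst q) (fst p)))"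
      by (rule geometric_sums)
    then have "(\<lambda>k. cdot (fst q) (fst p) ^ k * K p q) sums (1 / (1 - cdot (fst q) (fst p)) * K p q)"
      by (rule sums_mult2)
    then show "(\<lambda>N. \<Sum>k<N. cdot (fst q) (fst p) ^ k * K p q) \<longlonglongrightarrow> 1 / (1 - cdot (fst q) (fst p)) * K p q"
      by (simp add: sums_def)
  qed
  ultimately show "0 \<le> Re (\<Sum>p\<leftarrow>l. \<Sum>q\<leftarrow>l. 1 / (1 - cdot (fst q) (fst p)) * K p q)"
    by (intro LIMSEQ_le_const) auto
qed

lemma psd_geometric_power:
  fixes K :: "(complex^'n) \<times> 'a \<Rightarrow> (complex^'n) \<times> 'a \<Rightarrow> complex"
  assumes K: "psd (pts H) K" and hom: "homogeneous H K"
  shows "psd (pts H) (\<lambda>p q. 1 / (1 - cdot (fst q) (fst p)) ^ k * K p q)"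
proof (induction k)
  case (Suc k)
  have "homogeneous H (\<lambda>p q. 1 / (1 - cdot (fst q) (fst p)) ^ k * K p q)"
    using homogeneous_scale[OF hom, of "\<lambda>w z. 1 / (1 - cdot z w) ^ k"] by simp
  from psd_geometric[OF Suc this] show ?case by simp
qed (use K in simp)

end

section \<open>Reproducing kernel Hilbert spaces\<close>

definition kerf :: "(complex^'n \<Rightarrow> complex^'n \<Rightarrow> complex) \<Rightarrow> (complex^'n) \<times> 'e::complex_vector \<Rightarrow> complex^'n \<Rightarrow> 'e" where
  "kerf k p = (\<lambda>z. if z \<in> unit_ball then k z (fst p) *\<^sub>C snd p else 0)"

locale rkhs = E: hilbert_space E
  for E :: "'e::complex_vector hspace" and k :: "complex^'n \<Rightarrow> complex^'n \<Rightarrow> complex" and H :: "(complex^'n \<Rightarrow> 'e) hspace" +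
  assumes is_rkhs: "is_rkhs E k H"

sublocale rkhs \<subseteq> H: hilbert_space H
  using is_rkhs by (simp add: is_rkhs_def)

context rkhs
begin

lemma eval_mem [simp]: "f \<in> vecs H \<Longrightarrow> f w \<in> vecs E"
proof (cases "w \<in> unit_ball")
  assume "f \<in> vecs H" "w \<in> unit_ball"
  then show "f w \<in> vecs E" using is_rkhs unfolding is_rkhs_def holomorphic_on_ball_def by blast
next
  assume "f \<in> vecs H" "w \<notin> unit_ball"
  then have "f w = 0" using is_rkhs unfolding is_rkhs_def by blast
  then show "f w \<in> vecs E" by simp
qed

lemma outside: "f \<in> vecs H \<Longrightarrow> w \<notin> unit_ball \<Longrightarrow> f w = 0"
  using is_rkhs unfolding is_rkhs_def by blast

lemma kerf_mem [simp]: "p \<in> pts E \<Longrightarrow> kerf k p \<in> vecs H"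
  and ip_kerf: "p \<in> pts E \<Longrightarrow> f \<in> vecs H \<Longrightarrow> ip H f (kerf k p) = ip E (f (fst p)) (snd p)"
  using is_rkhs unfolding is_rkhs_def kerf_def by auto

lemma ip_kerf_kerf: "p \<in> pts E \<Longrightarrow> q \<in> pts E \<Longrightarrow> ip H (kerf k p) (kerf k q) = k (fst q) (fst p) * ip E (snd p) (snd q)"
  by (auto simp: ip_kerf E.ip_linear) (auto simp: kerf_def E.ip_linear)

lemma kerf_sc: "kerf k (sc c p) = c *\<^sub>C kerf k p"
  by (auto simp: kerf_def fun_eq_iff scaleC_scaleC mult.commute)

lemma eqI:
  assumes "f \<in> vecs H" "g \<in> vecs H" "\<And>p. p \<in> pts E \<Longrightarrow> ip H f (kerf k p) = ip H g (kerf k p)"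
  shows "f = g"
proof
  fix w show "f w = g w"
  proof (cases "w \<in> unit_ball")
    case True
    show ?thesis
    proof (rule E.ip_eqI_left)
      fix z assume "z \<in> vecs E"
      then have p: "(w, z) \<in> pts E" using True by blast
      show "ip E (f w) z = ip E (g w) z" using assms(3)[OF p] ip_kerf[OF p] assms(1,2) by simp
    qed (use assms in auto)
  next
    case False
    then show ?thesis using outside[OF assms(1)] outside[OF assms(2)] by simp
  qed
qed

text \<open>Scalars are absorbed into the points, so these sums form the whole linear span of the
  kernel functions.\<close>

definition comb :: "((complex^'n) \<times> 'e) list \<Rightarrow> complex^'n \<Rightarrow> 'e" where
  "comb l = (\<Sum>p\<leftarrow>l. kerf k p)"

lemma comb_mem [simp]: "set l \<subseteq> pts E \<Longrightarrow> comb l \<in> vecs H"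
  unfolding comb_def by (rule H.sum_list_mem) (use kerf_mem in blast)

lemma comb_append: "comb (l @ l') = comb l + comb l'"
  by (simp add: comb_def)

lemma comb_sc: "comb (map (sc c) l) = c *\<^sub>C comb l"
  by (induction l) (simp_all add: comb_def kerf_sc scaleC_add_right)

lemma comb_norm_sq:
  "set l \<subseteq> pts E \<Longrightarrow> (hnorm H (comb l))\<^sup>2 = Re (\<Sum>p\<leftarrow>l. \<Sum>q\<leftarrow>l. k (fst q) (fst p) * ip E (snd p) (snd q))"
proof -
  assume l: "set l \<subseteq> pts E"
  have "ip H (comb l) (comb l) = (\<Sum>p\<leftarrow>l. \<Sum>q\<leftarrow>l. ip H (kerf k p) (kerf k q))"
    unfolding comb_def by (rule H.ip_sum_list_sum_list) (use l kerf_mem in blast)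
  also have "\<dots> = (\<Sum>p\<leftarrow>l. \<Sum>q\<leftarrow>l. k (fst q) (fst p) * ip E (snd p) (snd q))"
    using l by (intro sum_list_cong_set ip_kerf_kerf) auto
  finally show ?thesis using l by (simp add: H.hnorm_sq)
qed

text \<open>\<open>riesz_relation\<close> for the functional <., f> on the span returns a vector in
  the closure of the span. It has the same pairing with every kernel function as \<open>f\<close>,
  hence it is \<open>f\<close>.\<close>

lemma comb_dense:
  assumes f: "f \<in> vecs H" and e: "e > 0"
  obtains l where "set l \<subseteq> pts E" "hnorm H (f - comb l) < e"
proof -
  define \<Gamma> where "\<Gamma> = {(comb l, ip H (comb l) f) | l. set l \<subseteq> pts E}"
  have "\<exists>l. set l \<subseteq> pts E \<and> hnorm H (f - comb l) < e"
  proof (rule H.riesz_relation[of \<Gamma> "hnorm H f"])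
    show "v \<in> vecs H" if "(v, s) \<in> \<Gamma>" for v s using that by (auto simp: \<Gamma>_def)
    have "(comb [], ip H (comb []) f) \<in> \<Gamma>" unfolding \<Gamma>_def by (metis (mono_tags, lifting) empty_subsetI mem_Collect_eq set_empty)
    then show "(0, 0) \<in> \<Gamma>" using f by (simp add: comb_def)
    show "(v + w, s + t) \<in> \<Gamma>" if hyp: "(v, s) \<in> \<Gamma>" "(w, t) \<in> \<Gamma>" for v s w t
    proof -
      obtain l l' where l: "v = comb l" "s = ip H (comb l) f" "set l \<subseteq> pts E" "w = comb l'" "t = ip H (comb l') f" "set l' \<subseteq> pts E"
        using hyp unfolding \<Gamma>_def by blast
      then have "v + w = comb (l @ l')" "s + t = ip H (comb (l @ l')) f" "set (l @ l') \<subseteq> pts E"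
        using f by (simp_all add: comb_append H.ip_linear)
      then show ?thesis unfolding \<Gamma>_def by blast
    qed
    show "(c *\<^sub>C v, c * s) \<in> \<Gamma>" if hyp: "(v, s) \<in> \<Gamma>" for c v s
    proof -
      obtain l where l: "v = comb l" "s = ip H (comb l) f" "set l \<subseteq> pts E"
        using hyp unfolding \<Gamma>_def by blast
      have "set (map (sc c) l) \<subseteq> pts E" using l(3) by (rule E.sc_list)
      moreover have "c *\<^sub>C v = comb (map (sc c) l)" "c * s = ip H (comb (map (sc c) l)) f"
        using l f by (simp_all add: comb_sc H.ip_linear)
      ultimately show ?thesis unfolding \<Gamma>_def by blast
    qed
    show "cmod s \<le> hnorm H f * hnorm H v" if "(v, s) \<in> \<Gamma>" for v s
      using that f by (auto simp: \<Gamma>_def mult.commute intro: order_trans[OF H.cauchy_schwarz])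
  next
    fix u assume u: "u \<in> vecs H" "\<And>v s. (v, s) \<in> \<Gamma> \<Longrightarrow> s = ip H v u"
      "\<And>e. 0 < e \<Longrightarrow> \<exists>v s. (v, s) \<in> \<Gamma> \<and> hnorm H (u - v) < e"
    have "u = f"
    proof (rule eqI)
      fix p :: "(complex^'n) \<times> 'e" assume p: "p \<in> pts E"
      then have "(comb [p], ip H (comb [p]) f) \<in> \<Gamma>" unfolding \<Gamma>_def by force
      then have "ip H (kerf k p) f = ip H (kerf k p) u" using u(2) by (simp add: comb_def)
      then show "ip H u (kerf k p) = ip H f (kerf k p)"
        using H.ip_commute[OF kerf_mem[OF p] f] H.ip_commute[OF kerf_mem[OF p] u(1)] by simp
    qed (use u f in auto)
    then show ?thesis using u(3)[OF e] unfolding \<Gamma>_def by blast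
  qed
  then show ?thesis using that by blast
qed

text \<open>The kernel inequality says that |sum of b p| <= |sum of k_p| for every finite family.
  This makes k_p -> b p single-valued on the span as well as contractive, and
  \<open>contraction_extension\<close> does the rest.\<close>

lemma contraction_from_kernels:
  assumes "hilbert_space K"
    and mem: "\<And>p. p \<in> pts E \<Longrightarrow> b p \<in> vecs K"
    and scale: "\<And>p c. p \<in> pts E \<Longrightarrow> b (sc c p) = c *\<^sub>C b p"
    and psd: "psd (pts E) (\<lambda>p q. k (fst q) (fst p) * ip E (snd p) (snd q) - ip K (b p) (b q))"
  obtains T where "contraction H K T" "\<And>p. p \<in> pts E \<Longrightarrow> T (kerf k p) = b p"
proof -
  interpret K: hilbert_space K by fact
  define \<Gamma> where "\<Gamma> = {(comb l, \<Sum>p\<leftarrow>l. b p) | l. set l \<subseteq> pts E}"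
  have \<Gamma>I: "(comb l, \<Sum>p\<leftarrow>l. b p) \<in> \<Gamma>" if "set l \<subseteq> pts E" for l using that unfolding \<Gamma>_def by blast
  have bsc: "(\<Sum>p\<leftarrow>map (sc c) l. b p) = c *\<^sub>C (\<Sum>p\<leftarrow>l. b p)" if "set l \<subseteq> pts E" for c l
    using that by (induction l) (auto simp: scale scaleC_add_right)
  obtain T where T: "contraction H K T" "\<And>x y. (x, y) \<in> \<Gamma> \<Longrightarrow> T x = y"
  proof (rule contraction_extension[of H K \<Gamma>])
    show "hilbert_space H" "hilbert_space K" by unfold_locales
    show "x \<in> vecs H \<and> y \<in> vecs K" if hyp: "(x, y) \<in> \<Gamma>" for x y
    proof -
      obtain l where l: "x = comb l" "y = (\<Sum>p\<leftarrow>l. b p)" "set l \<subseteq> pts E" using hyp unfolding \<Gamma>_def by blast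
      then show ?thesis using mem by (auto intro!: K.sum_list_mem)
    qed
    show "(0, 0) \<in> \<Gamma>" using \<Gamma>I[of "[]"] by (simp add: comb_def)
    show "(v + w, s + t) \<in> \<Gamma>" if hyp: "(v, s) \<in> \<Gamma>" "(w, t) \<in> \<Gamma>" for v s w t
    proof -
      obtain l l' where l: "v = comb l" "s = (\<Sum>p\<leftarrow>l. b p)" "set l \<subseteq> pts E" "w = comb l'" "t = (\<Sum>p\<leftarrow>l'. b p)" "set l' \<subseteq> pts E"
        using hyp unfolding \<Gamma>_def by blast
      show ?thesis using \<Gamma>I[of "l @ l'"] l by (simp add: comb_append)
    qed
    show "(c *\<^sub>C v, c *\<^sub>C s) \<in> \<Gamma>" if hyp: "(v, s) \<in> \<Gamma>" for c v s
    proof -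
      obtain l where l: "v = comb l" "s = (\<Sum>p\<leftarrow>l. b p)" "set l \<subseteq> pts E"
        using hyp unfolding \<Gamma>_def by blast
      have "set (map (sc c) l) \<subseteq> pts E" using l(3) by (rule E.sc_list)
      from \<Gamma>I[OF this] show ?thesis unfolding l comb_sc bsc[OF l(3)] .
    qed
    show "hnorm K y \<le> hnorm H x" if hyp: "(x, y) \<in> \<Gamma>" for x y
    proof -
      obtain l where l: "x = comb l" "y = (\<Sum>p\<leftarrow>l. b p)" "set l \<subseteq> pts E" using hyp unfolding \<Gamma>_def by blast
      have m: "b p \<in> vecs K" if "p \<in> set l" for p using mem l(3) that by blast
      have "0 \<le> Re (\<Sum>p\<leftarrow>l. \<Sum>q\<leftarrow>l. k (fst q) (fst p) * ip E (snd p) (snd q) - ip K (b p) (b q))"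
        using psd l(3) unfolding psd_def by blast
      also have "\<dots> = (hnorm H x)\<^sup>2 - Re (\<Sum>p\<leftarrow>l. \<Sum>q\<leftarrow>l. ip K (b p) (b q))"
        using comb_norm_sq[OF l(3)] l(1) by (simp add: sum_list_subtractf)
      also have "Re (\<Sum>p\<leftarrow>l. \<Sum>q\<leftarrow>l. ip K (b p) (b q)) = (hnorm K y)\<^sup>2"
        using K.ip_sum_list_sum_list[of l b, OF m] m by (simp add: l(2) K.hnorm_sq)
      finally have "(hnorm K y)\<^sup>2 \<le> (hnorm H x)\<^sup>2" by simp
      then show ?thesis using l m by (simp add: power2_le_iff_abs_le)
    qed
  qed blast
  show ?thesis
  proof (rule that[OF T(1)])
    fix p :: "(complex^'n) \<times> 'e" assume p: "p \<in> pts E"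
    then show "T (kerf k p) = b p" using T(2)[OF \<Gamma>I[of "[p]"]] by (simp add: comb_def)
  qed
qed

text \<open>The adjoint of A - B takes values orthogonal to all kernel functions, hence is
  0.\<close>

lemma bounded_ops_eqI:
  assumes A: "A \<in> bounded_ops H K" and B: "B \<in> bounded_ops H K" and K: "hilbert_space K"
    and eq: "\<And>p. p \<in> pts E \<Longrightarrow> A (kerf k p) = B (kerf k p)" and f: "f \<in> vecs H"
  shows "A f = B f"
proof -
  interpret K: hilbert_space K by fact
  have D: "(\<lambda>x. A x - B x) \<in> bounded_ops H K"
    by (rule bounded_ops_minus[OF A B H.hilbert_space_axioms K])
  interpret D: bounded_op H K "\<lambda>x. A x - B x" using D by unfold_locales
  have "A f - B f = 0"
  proof (rule K.ip_eqI_left)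
    fix y assume y: "y \<in> vecs K"
    have "adj H K (\<lambda>x. A x - B x) y = 0"
    proof (rule eqI)
      fix p :: "(complex^'n) \<times> 'e" assume p: "p \<in> pts E"
      show "ip H (adj H K (\<lambda>x. A x - B x) y) (kerf k p) = ip H 0 (kerf k p)"
        using p y eq[OF p] by (simp add: D.ip_adj_left)
    qed (use y in auto)
    then show "ip K (A f - B f) y = ip K 0 y" using D.ip_adj[OF y f] f y by simp
  qed (use f A B in \<open>auto simp: bounded_opsD(1)\<close>)
  then show ?thesis by simp
qed

end

section \<open>Multipliers between two reproducing kernel spaces\<close>

locale two_rkhs = H1: rkhs E k1 H1 + H2: rkhs F k2 H2
  for E :: "'e::complex_vector hspace" and k1 :: "complex^'n \<Rightarrow> complex^'n \<Rightarrow> complex" and H1 :: "(complex^'n \<Rightarrow> 'e) hspace"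
    and F :: "'f::complex_vector hspace" and k2 :: "complex^'n \<Rightarrow> complex^'n \<Rightarrow> complex" and H2 :: "(complex^'n \<Rightarrow> 'f) hspace" +
  fixes \<Phi> :: "complex^'n \<Rightarrow> 'e \<Rightarrow> 'f"
  assumes \<Phi>: "\<And>z. z \<in> unit_ball \<Longrightarrow> \<Phi> z \<in> bounded_ops E F"
begin

lemma bounded_op_\<Phi>: "z \<in> unit_ball \<Longrightarrow> bounded_op E F (\<Phi> z)"
  by (intro bounded_opI \<Phi>) unfold_locales

abbreviation "adjker p \<equiv> (fst p, adj E F (\<Phi> (fst p)) (snd p))"

lemma adjker_mem [simp]: "p \<in> pts F \<Longrightarrow> adjker p \<in> pts E"
  using bounded_op.adj_mem[OF bounded_op_\<Phi>] by auto

text \<open>The reproducing property moves the symbol onto the vector: the pairing of \<Phi> f with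
  the kernel function at (w, \<eta>) is <\<Phi>(w) f(w), \<eta>>, and the adjoint of \<Phi>(w)
  passes to \<eta>.\<close>

lemma adj_mult_kerf:
  assumes M: "mult_op \<Phi> \<in> bounded_ops H1 H2" and p: "p \<in> pts F"
  shows "adj H1 H2 (mult_op \<Phi>) (kerf k2 p) = kerf k1 (adjker p)"
proof -
  interpret M: bounded_op H1 H2 "mult_op \<Phi>" using M by unfold_locales
  show ?thesis
  proof (rule M.adj_eqI)
    fix f assume f: "f \<in> vecs H1"
    interpret P: bounded_op E F "\<Phi> (fst p)" using p by (intro bounded_op_\<Phi>) auto
    have "ip H2 (mult_op \<Phi> f) (kerf k2 p) = ip F (\<Phi> (fst p) (f (fst p))) (snd p)"
      using p f by (simp add: H2.ip_kerf bounded_opsD(1)[OF M]) (auto simp: mult_op_def)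
    also have "\<dots> = ip E (f (fst p)) (adj E F (\<Phi> (fst p)) (snd p))"
      using p f by (intro P.ip_adj[symmetric]) auto
    also have "\<dots> = ip H1 f (kerf k1 (adjker p))"
      using H1.ip_kerf[OF adjker_mem[OF p] f] by simp
    finally show "ip H2 (mult_op \<Phi> f) (kerf k2 p) = ip H1 f (kerf k1 (adjker p))" .
  qed (use H2.kerf_mem[OF p] H1.kerf_mem[OF adjker_mem[OF p]] in auto)
qed

text \<open>Boundedness of \<open>mult_op \<Phi>\<close> is not known beforehand, so the future
  adjoint \<open>T\<close> is constructed from its values on kernel functions. The adjoint of
  \<open>T\<close> is then recognised as multiplication by \<Phi> by evaluating at each point of the
  ball.\<close>

lemma multiplier_contraction:
  assumes psd: "psd (pts F) (\<lambda>p q. k2 (fst q) (fst p) * ip F (snd p) (snd q)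
      - k1 (fst q) (fst p) * ip E (snd (adjker p)) (snd (adjker q)))"
  shows "contraction H1 H2 (mult_op \<Phi>)"
proof -
  obtain T where T: "contraction H2 H1 T" "\<And>p. p \<in> pts F \<Longrightarrow> T (kerf k2 p) = kerf k1 (adjker p)"
  proof (rule H2.contraction_from_kernels[of H1 "\<lambda>p. kerf k1 (adjker p)"])
    show "hilbert_space H1" by unfold_locales
    show "kerf k1 (adjker p) \<in> vecs H1" if "p \<in> pts F" for p using adjker_mem[OF that] by (rule H1.kerf_mem)
    show "kerf k1 (adjker (sc c p)) = c *\<^sub>C kerf k1 (adjker p)" if "p \<in> pts F" for p c
    proof -
      have "adj E F (\<Phi> (fst p)) (c *\<^sub>C snd p) = c *\<^sub>C adj E F (\<Phi> (fst p)) (snd p)"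
        using that bounded_opsD(3)[OF bounded_op.adj_bounded[OF bounded_op_\<Phi>]] by auto
      then have "adjker (sc c p) = sc c (adjker p)" by (simp add: sc_def)
      then show ?thesis by (simp only: H1.kerf_sc)
    qed
    show "psd (pts F) (\<lambda>p q. k2 (fst q) (fst p) * ip F (snd p) (snd q) - ip H1 (kerf k1 (adjker p)) (kerf k1 (adjker q)))"
      by (rule psd_cong[OF _ psd]) (simp only: H1.ip_kerf_kerf[OF adjker_mem adjker_mem] fst_conv)
  qed blast
  interpret T: bounded_op H2 H1 T using contractionD(1)[OF T(1)] by unfold_locales
  have eq: "mult_op \<Phi> f = adj H2 H1 T f" if f: "f \<in> vecs H1" for f
  proof
    fix w show "mult_op \<Phi> f w = adj H2 H1 T f w"
    proof (cases "w \<in> unit_ball")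
      case True
      interpret P: bounded_op E F "\<Phi> w" using True by (rule bounded_op_\<Phi>)
      have "adj H2 H1 T f w = \<Phi> w (f w)"
      proof (rule H2.E.ip_eqI_left)
        fix y assume y: "y \<in> vecs F"
        have p: "(w, y) \<in> pts F" using y True by blast
        have "ip F (adj H2 H1 T f w) y = ip H2 (adj H2 H1 T f) (kerf k2 (w, y))"
          using H2.ip_kerf[OF p T.adj_mem[OF f]] by simp
        also have "\<dots> = ip H1 f (kerf k1 (adjker (w, y)))"
          using T.ip_adj_left[OF f H2.kerf_mem[OF p]] T(2)[OF p] by simp
        also have "\<dots> = ip E (f w) (adj E F (\<Phi> w) y)"
          using H1.ip_kerf[OF adjker_mem[OF p] f] by simp
        also have "\<dots> = ip F (\<Phi> w (f w)) y" using P.ip_adj[OF y] f by simp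
        finally show "ip F (adj H2 H1 T f w) y = ip F (\<Phi> w (f w)) y" .
      qed (use f T.adj_mem bounded_opsD(1)[OF \<Phi>[OF True]] in auto)
      then show ?thesis using True by (simp add: mult_op_def)
    qed (use H2.outside[OF T.adj_mem[OF f]] in \<open>auto simp: mult_op_def\<close>)
  qed
  have c: "contraction H1 H2 (adj H2 H1 T)" by (rule T.contraction_adj[OF T(1)])
  have "mult_op \<Phi> \<in> bounded_ops H1 H2"
    using contractionD[OF c] bounded_opsD[OF contractionD(1)[OF c]]
    by (intro bounded_opsI[where C = 1]) (simp_all add: eq)
  then show ?thesis using contractionD(2)[OF c] eq by (simp add: contraction_def)
qed

end

lemma (in hilbert_space) adj_id: "x \<in> vecs H \<Longrightarrow> adj H H (\<lambda>x. x) x = x"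
proof -
  assume x: "x \<in> vecs H"
  interpret I: bounded_op H H "\<lambda>x. x"
    by unfold_locales (auto intro: bounded_opsI[where C = 1])
  show ?thesis using x by (intro I.adj_eqI) auto
qed

text \<open>Between two spaces with the same kernel the constant symbol I has defect kernel 0, so
  multiplication by it, which is the inclusion, is a contraction. Used in both directions it shows
  that the kernel determines carrier and norm.\<close>

lemma rkhs_inclusion:
  assumes "rkhs E k H1" "rkhs E k H2" and f: "f \<in> vecs H1"
  shows "f \<in> vecs H2 \<and> hnorm H2 f \<le> hnorm H1 f"
proof -
  interpret H1: rkhs E k H1 by fact
  interpret H2: rkhs E k H2 by fact
  interpret two_rkhs E k H1 E k H2 "\<lambda>z x. x"
    by unfold_locales (auto intro: bounded_opsI[where C = 1])
  have "contraction H1 H2 (mult_op (\<lambda>z x. x))"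
    by (rule multiplier_contraction, rule psd_cong[where K' = "\<lambda>p q. 0"]) (auto simp: H1.E.adj_id psd_def)
  moreover have "mult_op (\<lambda>z x. x) f = f" using H1.outside[OF f] by (auto simp: mult_op_def)
  ultimately show ?thesis using contractionD(2)[of H1 H2] bounded_opsD(1)[OF contractionD(1)[of H1 H2]] f by metis
qed

section \<open>Existence of the spaces and holomorphy in the operator norm\<close>

lemma restrict_simps [simp]: "vecs (H \<restriction>\<^sub>H Q) = Q" "ip (H \<restriction>\<^sub>H Q) = ip H"
  by (simp_all add: restrict_hspace_def)

lemma hnorm_restrict [simp]: "hnorm (H \<restriction>\<^sub>H Q) = hnorm H"
  by (simp add: hnorm_def fun_eq_iff)

lemma restrict_hilbert:
  assumes "hilbert_space H" "closed_subspace H Q"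
  shows "hilbert_space (H \<restriction>\<^sub>H Q)"
proof -
  interpret H: hilbert_space H by fact
  have Q: "x \<in> vecs H" if "x \<in> Q" for x using assms(2) that by (auto simp: closed_subspace_def)
  show ?thesis
  proof
    show "complex_vector.subspace (vecs (H \<restriction>\<^sub>H Q))" using assms(2) by (simp add: closed_subspace_def)
    show "ip (H \<restriction>\<^sub>H Q) y x = cnj (ip (H \<restriction>\<^sub>H Q) x y)" if "x \<in> vecs (H \<restriction>\<^sub>H Q)" "y \<in> vecs (H \<restriction>\<^sub>H Q)" for x y
      using that Q by (auto intro: H.ip_commute)
    show "0 < Re (ip (H \<restriction>\<^sub>H Q) x x)" if "x \<in> vecs (H \<restriction>\<^sub>H Q)" "x \<noteq> 0" for x
      using that Q H.ip_pos by simp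
    fix s :: "nat \<Rightarrow> _"
    assume s: "\<And>k. s k \<in> vecs (H \<restriction>\<^sub>H Q)"
      and C: "\<And>e. e > 0 \<Longrightarrow> \<exists>N. \<forall>j\<ge>N. \<forall>k\<ge>N. hnorm (H \<restriction>\<^sub>H Q) (s j - s k) < e"
    then obtain l where l: "l \<in> vecs H" "(\<lambda>k. hnorm H (s k - l)) \<longlonglongrightarrow> 0"
      using H.complete_vecs[of s] Q by auto
    moreover have "\<forall>k. s k \<in> Q" using s by simp
    then have "l \<in> Q" using assms(2) l unfolding closed_subspace_def by blast
    ultimately show "\<exists>l\<in>vecs (H \<restriction>\<^sub>H Q). (\<lambda>k. hnorm (H \<restriction>\<^sub>H Q) (s k - l)) \<longlonglongrightarrow> 0"
      by auto
  qed (use Q in \<open>auto simp: H.ip_linear\<close>)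
qed

lemma transport_hilbert:
  assumes "hilbert_space G" and inj: "inj_on J (vecs G)"
    and add: "\<And>x y. x \<in> vecs G \<Longrightarrow> y \<in> vecs G \<Longrightarrow> J (x + y) = J x + J y"
    and scale: "\<And>c x. x \<in> vecs G \<Longrightarrow> J (c *\<^sub>C x) = c *\<^sub>C J x"
  defines "H \<equiv> \<lparr>vecs = J ` vecs G, ip = (\<lambda>x y. ip G (inv_into (vecs G) J x) (inv_into (vecs G) J y))\<rparr>"
  shows "hilbert_space H"
    and "\<And>x y. x \<in> vecs G \<Longrightarrow> y \<in> vecs G \<Longrightarrow> ip H (J x) (J y) = ip G x y"
    and "\<And>x. x \<in> vecs G \<Longrightarrow> hnorm H (J x) = hnorm G x"
proof -
  interpret G: hilbert_space G by fact
  have V: "vecs H = J ` vecs G" by (simp add: H_def)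
  show ip: "ip H (J x) (J y) = ip G x y" if "x \<in> vecs G" "y \<in> vecs G" for x y
    using that inj by (simp add: H_def)
  show nrm: "hnorm H (J x) = hnorm G x" if "x \<in> vecs G" for x
    using that ip by (simp add: hnorm_def)
  have J0: "J 0 = 0" using scale[of 0 0] by simp
  have diff: "J (x - y) = J x - J y" if "x \<in> vecs G" "y \<in> vecs G" for x y
    using add[of "x - y" y] that by simp
  show "hilbert_space H"
  proof
    show "complex_vector.subspace (vecs H)"
      unfolding V complex_vector.subspace_def
    proof (intro conjI ballI allI)
      show "0 \<in> J ` vecs G" using J0 by force
      show "x + y \<in> J ` vecs G" if "x \<in> J ` vecs G" "y \<in> J ` vecs G" for x y
        using that by (auto simp flip: add)
      show "c *\<^sub>C x \<in> J ` vecs G" if "x \<in> J ` vecs G" for c x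
        using that by (auto simp flip: scale)
    qed
    show "ip H (x + y) z = ip H x z + ip H y z" if "x \<in> vecs H" "y \<in> vecs H" "z \<in> vecs H" for x y z
      using that unfolding V by (auto simp: ip G.ip_linear simp flip: add)
    show "ip H (c *\<^sub>C x) y = c * ip H x y" if "x \<in> vecs H" "y \<in> vecs H" for x y c
      using that unfolding V by (auto simp: ip G.ip_linear simp flip: scale)
    show "ip H y x = cnj (ip H x y)" if "x \<in> vecs H" "y \<in> vecs H" for x y
      using that unfolding V by (auto simp: ip intro: G.ip_commute)
    show "0 < Re (ip H x x)" if "x \<in> vecs H" "x \<noteq> 0" for x
      using that J0 unfolding V by (auto simp: ip intro: G.ip_pos)
    fix s :: "nat \<Rightarrow> _"
    assume s: "\<And>k. s k \<in> vecs H"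
      and C: "\<And>e. e > 0 \<Longrightarrow> \<exists>N. \<forall>j\<ge>N. \<forall>k\<ge>N. hnorm H (s j - s k) < e"
    have "\<forall>k. \<exists>x. x \<in> vecs G \<and> s k = J x" using s unfolding V by blast
    then obtain t where t: "\<And>k. t k \<in> vecs G" "\<And>k. s k = J (t k)" by metis
    have "hnorm H (s j - s k) = hnorm G (t j - t k)" for j k
      using t nrm[of "t j - t k"] by (simp add: diff)
    then obtain l where l: "l \<in> vecs G" "(\<lambda>k. hnorm G (t k - l)) \<longlonglongrightarrow> 0"
      using G.complete_vecs[of t] t C by auto
    have "hnorm H (s k - J l) = hnorm G (t k - l)" for k
      using t l nrm[of "t k - l"] by (simp add: diff)
    then show "\<exists>l\<in>vecs H. (\<lambda>k. hnorm H (s k - l)) \<longlonglongrightarrow> 0"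
      using l unfolding V by (intro bexI[of _ "J l"]) auto
  qed
qed

text \<open>Complex differentiability of the evaluation z -> (f -> f z) in operator norm. The error
  is uniform over the unit ball of \<open>H\<close>, and holomorphy of symbols in operator norm is
  drawn from this.\<close>

definition uniformly_holomorphic :: "'e::complex_vector hspace \<Rightarrow> (complex^'n \<Rightarrow> 'e) hspace \<Rightarrow> bool" where
  "uniformly_holomorphic E H \<longleftrightarrow> (\<forall>z\<in>unit_ball. \<exists>d. (\<forall>i. d i \<in> bounded_ops H E) \<and>
     (\<forall>e>0. \<exists>\<delta>>0. \<forall>w\<in>unit_ball. norm (w - z) < \<delta> \<longrightarrow> (\<forall>f\<in>vecs H.
        hnorm E (f w - f z - (\<Sum>i\<in>UNIV. (w $ i - z $ i) *\<^sub>C d i f)) \<le> e * norm (w - z) * hnorm H f)))"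

text \<open>If the adjoint of \<kappa>(z) composed with \<kappa>(w) is k(z,w) I, the functions
  sending w to the adjoint of \<kappa>(w) at g form the space with kernel k. Features depend
  antiholomorphically on w, as kernel functions do, which is why the derivative hypothesis carries
  conjugated increments.\<close>

lemma rkhs_from_feature:
  fixes E :: "'e::complex_vector hspace" and G :: "'g::complex_vector hspace"
    and \<kappa> :: "complex^'n \<Rightarrow> 'e \<Rightarrow> 'g"
  assumes "hilbert_space E" "hilbert_space G"
    and \<kappa>: "\<And>w. w \<in> unit_ball \<Longrightarrow> \<kappa> w \<in> bounded_ops E G"
    and ker: "\<And>w z \<eta> \<zeta>. w \<in> unit_ball \<Longrightarrow> z \<in> unit_ball \<Longrightarrow> \<eta> \<in> vecs E \<Longrightarrow> \<zeta> \<in> vecs E \<Longrightarrow>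
        ip G (\<kappa> w \<eta>) (\<kappa> z \<zeta>) = k z w * ip E \<eta> \<zeta>"
    and deriv: "\<And>z. z \<in> unit_ball \<Longrightarrow> \<exists>\<kappa>'. (\<forall>i. \<kappa>' i \<in> bounded_ops E G) \<and>
        (\<forall>e>0. \<exists>\<delta>>0. \<forall>w\<in>unit_ball. norm (w - z) < \<delta> \<longrightarrow> (\<forall>\<eta>\<in>vecs E.
          hnorm G (\<kappa> w \<eta> - \<kappa> z \<eta> - (\<Sum>i\<in>UNIV. cnj (w $ i - z $ i) *\<^sub>C \<kappa>' i \<eta>)) \<le> e * norm (w - z) * hnorm E \<eta>))"
  shows "\<exists>H. is_rkhs E k H \<and> uniformly_holomorphic E H"
proof -
  interpret E: hilbert_space E by fact
  interpret G: hilbert_space G by fact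
  \<comment> \<open>The double annihilator, that is, the closed span of all \<kappa> w \<eta>, in a
    form whose closedness is immediate. On it \<open>J\<close> is injective, because a vector
    annihilating all \<kappa> w \<eta> and lying in \<open>M\<close> is orthogonal to
    itself.\<close>
  define M where "M = {g \<in> vecs G. \<forall>h\<in>vecs G. (\<forall>w\<in>unit_ball. \<forall>\<eta>\<in>vecs E. ip G h (\<kappa> w \<eta>) = 0) \<longrightarrow> ip G g h = 0}"
  have MG: "g \<in> vecs G" if "g \<in> M" for g using that by (simp add: M_def)
  have Mc: "closed_subspace G M"
    unfolding closed_subspace_def
  proof (intro conjI allI impI)
    show "complex_vector.subspace M"
      by (auto simp: complex_vector.subspace_def M_def G.ip_linear)
    fix s l assume sl: "(\<forall>k::nat. s k \<in> M) \<and> l \<in> vecs G \<and> (\<lambda>k. hnorm G (s k - l)) \<longlonglongrightarrow> 0"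
    have "ip G l h = 0" if h: "h \<in> vecs G" "\<forall>w\<in>unit_ball. \<forall>\<eta>\<in>vecs E. ip G h (\<kappa> w \<eta>) = 0" for h
    proof -
      have "(\<lambda>k. ip G (s k) h) \<longlonglongrightarrow> ip G l h" using sl h MG by (intro G.lim_ip_left) auto
      moreover have "ip G (s k) h = 0" for k using sl h unfolding M_def by blast
      ultimately show ?thesis by (simp add: LIMSEQ_const_iff)
    qed
    then show "l \<in> M" using sl by (simp add: M_def)
  qed (auto simp: M_def)
  interpret M: hilbert_space "G \<restriction>\<^sub>H M" by (rule restrict_hilbert[OF assms(2) Mc])
  have b\<kappa>: "bounded_op E G (\<kappa> w)" if "w \<in> unit_ball" for w
    using \<kappa>[OF that] by (intro bounded_opI) unfold_locales
  define J where "J g = (\<lambda>w. if w \<in> unit_ball then adj E G (\<kappa> w) g else 0)" for g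
  note A = bounded_opsD[OF bounded_op.adj_bounded[OF b\<kappa>]]
  have \<kappa>M: "\<kappa> w \<eta> \<in> M" if "w \<in> unit_ball" "\<eta> \<in> vecs E" for w \<eta>
  proof -
    have m: "\<kappa> w \<eta> \<in> vecs G" using that bounded_opsD(1)[OF \<kappa>] by blast
    have "ip G (\<kappa> w \<eta>) h = 0" if "h \<in> vecs G" "ip G h (\<kappa> w \<eta>) = 0" for h
      using G.ip_commute[OF that(1) m] that(2) by simp
    then show ?thesis using that m unfolding M_def by blast
  qed
  have Jadd: "J (x + y) = J x + J y" if "x \<in> vecs G" "y \<in> vecs G" for x y
    using A(2) that by (auto simp: J_def fun_eq_iff)
  have Jscale: "J (c *\<^sub>C x) = c *\<^sub>C J x" if "x \<in> vecs G" for x c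
    using A(3) that by (auto simp: J_def fun_eq_iff)
  have J_ip: "ip E (J g w) \<eta> = ip G g (\<kappa> w \<eta>)" if "g \<in> vecs G" "w \<in> unit_ball" "\<eta> \<in> vecs E" for g w \<eta>
    using bounded_op.ip_adj_left[OF b\<kappa>[OF that(2)] that(1,3)] that by (simp add: J_def)
  have inj: "inj_on J (vecs (G \<restriction>\<^sub>H M))"
  proof (rule inj_onI)
    fix x y assume x: "x \<in> vecs (G \<restriction>\<^sub>H M)" and y: "y \<in> vecs (G \<restriction>\<^sub>H M)" and eq: "J x = J y"
    have xG: "x \<in> vecs G" "y \<in> vecs G" using x y MG by auto
    have "x - y \<in> M" using M.diff_mem[OF x y] by simp
    moreover have "ip G (x - y) (\<kappa> w \<eta>) = 0" if "w \<in> unit_ball" "\<eta> \<in> vecs E" for w \<eta>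
      using J_ip[of x w \<eta>] J_ip[of y w \<eta>] eq that xG bounded_opsD(1)[OF \<kappa>] by (simp add: G.ip_linear)
    ultimately have "ip G (x - y) (x - y) = 0" using xG unfolding M_def by (simp add: MG)
    then show "x = y" using G.ip_pos[of "x - y"] xG by force
  qed
  define H where "H = \<lparr>vecs = J ` vecs (G \<restriction>\<^sub>H M),
     ip = (\<lambda>x y. ip (G \<restriction>\<^sub>H M) (inv_into (vecs (G \<restriction>\<^sub>H M)) J x) (inv_into (vecs (G \<restriction>\<^sub>H M)) J y))\<rparr>"
  have tr: "hilbert_space H" "\<And>x y. x \<in> M \<Longrightarrow> y \<in> M \<Longrightarrow> ip H (J x) (J y) = ip G x y"
      "\<And>x. x \<in> M \<Longrightarrow> hnorm H (J x) = hnorm G x"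
    using transport_hilbert[OF M.hilbert_space_axioms inj] Jadd Jscale MG unfolding H_def by auto
  interpret H: hilbert_space H by (rule tr(1))
  have V: "vecs H = J ` M" by (simp add: H_def)
  have Jmem: "J g w \<in> vecs E" if "g \<in> vecs G" for g w using A(1) that by (simp add: J_def)
  have invJ: "inv_into M J f \<in> M" "J (inv_into M J f) = f" if "f \<in> vecs H" for f
    using that unfolding V by (auto intro: inv_into_into f_inv_into_f)
  have invJ': "inv_into M J (J g) = g" if "g \<in> M" for g using inj that by simp
  have invJ_ops: "inv_into M J \<in> bounded_ops H G"
  proof (rule bounded_opsI[where C = 1])
    fix x y assume x: "x \<in> vecs H" and y: "y \<in> vecs H"
    have "inv_into M J x + inv_into M J y \<in> M"
      using M.add_mem invJ(1)[OF x] invJ(1)[OF y] by simp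
    moreover have "J (inv_into M J x + inv_into M J y) = x + y"
      using Jadd invJ x y MG by metis
    ultimately show "inv_into M J (x + y) = inv_into M J x + inv_into M J y" using invJ' by metis
  next
    fix c x assume x: "x \<in> vecs H"
    have "c *\<^sub>C inv_into M J x \<in> M"
      using M.scale_mem invJ(1)[OF x] by simp
    moreover have "J (c *\<^sub>C inv_into M J x) = c *\<^sub>C x"
      using Jscale invJ x MG by metis
    ultimately show "inv_into M J (c *\<^sub>C x) = c *\<^sub>C inv_into M J x" using invJ' by metis
  next
    fix x assume "x \<in> vecs H"
    then show "inv_into M J x \<in> vecs G" "hnorm G (inv_into M J x) \<le> 1 * hnorm H x"
      using invJ MG tr(3)[of "inv_into M J x"] by auto
  qed
  have unif: "uniformly_holomorphic E H"
    unfolding uniformly_holomorphic_def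
  proof
    fix z :: "complex^'n" assume z: "z \<in> unit_ball"
    obtain \<kappa>' where \<kappa>': "\<And>i. \<kappa>' i \<in> bounded_ops E G"
      "\<And>e. e > 0 \<Longrightarrow> \<exists>\<delta>>0. \<forall>w\<in>unit_ball. norm (w - z) < \<delta> \<longrightarrow> (\<forall>\<eta>\<in>vecs E.
          hnorm G (\<kappa> w \<eta> - \<kappa> z \<eta> - (\<Sum>i\<in>UNIV. cnj (w $ i - z $ i) *\<^sub>C \<kappa>' i \<eta>)) \<le> e * norm (w - z) * hnorm E \<eta>)"
      using deriv[OF z] by blast
    have b: "bounded_op E G (\<kappa>' i)" for i using \<kappa>' by (intro bounded_opI) unfold_locales
    \<comment> \<open>The partial derivatives of J g are the adjoints of those of \<kappa>, applied
      to g; passing to adjoints removes the conjugation of the increments.\<close>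
    define d where "d i = (\<lambda>f. adj E G (\<kappa>' i) (inv_into M J f))" for i
    have d: "d i \<in> bounded_ops H E" for i
      unfolding d_def by (rule bounded_ops_comp[OF invJ_ops bounded_op.adj_bounded[OF b]]) unfold_locales
    show "\<exists>d. (\<forall>i. d i \<in> bounded_ops H E) \<and>
     (\<forall>e>0. \<exists>\<delta>>0. \<forall>w\<in>unit_ball. norm (w - z) < \<delta> \<longrightarrow> (\<forall>f\<in>vecs H.
        hnorm E (f w - f z - (\<Sum>i\<in>UNIV. (w $ i - z $ i) *\<^sub>C d i f)) \<le> e * norm (w - z) * hnorm H f))"
    proof (rule exI[of _ d], intro conjI allI impI d)
      fix e :: real assume "e > 0"
      from \<kappa>'(2)[OF this] obtain \<delta> where \<delta>0: "\<delta> > 0 \<and> (\<forall>w\<in>unit_ball. norm (w - z) < \<delta> \<longrightarrow> (\<forall>\<eta>\<in>vecs E.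
          hnorm G (\<kappa> w \<eta> - \<kappa> z \<eta> - (\<Sum>i\<in>UNIV. cnj (w $ i - z $ i) *\<^sub>C \<kappa>' i \<eta>)) \<le> e * norm (w - z) * hnorm E \<eta>))" ..
      have \<delta>: "\<delta> > 0" "\<And>w \<eta>. w \<in> unit_ball \<Longrightarrow> norm (w - z) < \<delta> \<Longrightarrow> \<eta> \<in> vecs E \<Longrightarrow>
          hnorm G (\<kappa> w \<eta> - \<kappa> z \<eta> - (\<Sum>i\<in>UNIV. cnj (w $ i - z $ i) *\<^sub>C \<kappa>' i \<eta>)) \<le> e * norm (w - z) * hnorm E \<eta>"
        using \<delta>0 by blast+
      have "hnorm E (f w - f z - (\<Sum>i\<in>UNIV. (w $ i - z $ i) *\<^sub>C d i f)) \<le> e * norm (w - z) * hnorm H f"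
        if w: "w \<in> unit_ball" "norm (w - z) < \<delta>" and f: "f \<in> vecs H" for w f
      proof -
        define g where "g = inv_into M J f"
        have g: "g \<in> M" "g \<in> vecs G" "f = J g" using invJ[OF f] MG by (auto simp: g_def)
        \<comment> \<open>The remainder is tested against itself. This moves the estimate to the
          feature side, and one factor |y| cancels at the end.\<close>
        define y where "y = f w - f z - (\<Sum>i\<in>UNIV. (w $ i - z $ i) *\<^sub>C d i f)"
        have dm: "d i f \<in> vecs E" for i using bounded_opsD(1)[OF d f] .
        have fm: "f w \<in> vecs E" for w using Jmem g by simp
        have y: "y \<in> vecs E" using dm fm by (simp add: y_def)
        let ?v = "\<kappa> w y - \<kappa> z y - (\<Sum>i\<in>UNIV. cnj (w $ i - z $ i) *\<^sub>C \<kappa>' i y)"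
        have \<kappa>m: "\<kappa> w y \<in> vecs G" "\<kappa> z y \<in> vecs G" "\<kappa>' i y \<in> vecs G" for i
          using bounded_opsD(1)[OF \<kappa>] bounded_opsD(1)[OF \<kappa>'(1)] y w z by auto
        have vm: "?v \<in> vecs G" using \<kappa>m by simp
        have dy: "ip E (d i f) y = ip G g (\<kappa>' i y)" for i
          using bounded_op.ip_adj_left[OF b g(2) y] by (simp add: d_def g_def)
        have "ip E y y = ip E (f w) y - ip E (f z) y - (\<Sum>i\<in>UNIV. (w $ i - z $ i) * ip E (d i f) y)"
          by (subst (1) y_def) (simp add: E.ip_linear E.ip_sum_left y fm dm)
        also have "\<dots> = ip G g ?v"
          using \<kappa>m g(2) J_ip[OF g(2) w(1) y] J_ip[OF g(2) z y]
          unfolding dy by (simp add: g(3) G.ip_linear G.ip_sum_right)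
        finally have "(hnorm E y)\<^sup>2 \<le> hnorm G g * hnorm G ?v"
          using G.cauchy_schwarz[OF g(2) vm] complex_Re_le_cmod[of "ip G g ?v"] y by (simp add: E.hnorm_sq)
        also have "\<dots> \<le> hnorm G g * (e * norm (w - z) * hnorm E y)"
          using \<delta>(2)[OF w y] g(2) by (intro mult_left_mono) auto
        finally have "hnorm E y * hnorm E y \<le> (e * norm (w - z) * hnorm H f) * hnorm E y"
          using tr(3)[OF g(1)] g(3) by (simp add: power2_eq_square mult_ac)
        moreover have "0 \<le> e * norm (w - z) * hnorm H f" using \<open>e > 0\<close> f by simp
        ultimately have "hnorm E y \<le> e * norm (w - z) * hnorm H f"
          using E.hnorm_nonneg[OF y] by (cases "hnorm E y = 0") auto
        then show ?thesis by (simp add: y_def)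
      qed
      then show "\<exists>\<delta>>0. \<forall>w\<in>unit_ball. norm (w - z) < \<delta> \<longrightarrow> (\<forall>f\<in>vecs H.
        hnorm E (f w - f z - (\<Sum>i\<in>UNIV. (w $ i - z $ i) *\<^sub>C d i f)) \<le> e * norm (w - z) * hnorm H f)"
        using \<delta>(1) by blast
    qed
  qed
  have holo: "holomorphic_on_ball (vecs E) (hnorm E) f" if f: "f \<in> vecs H" for f
    unfolding holomorphic_on_ball_def
  proof (intro conjI ballI)
    show "f z \<in> vecs E" for z using f Jmem MG unfolding V by auto
    fix z :: "complex^'n" assume z: "z \<in> unit_ball"
    from unif z obtain d where d0: "(\<forall>i. d i \<in> bounded_ops H E) \<and> (\<forall>e>0. \<exists>\<delta>>0. \<forall>w\<in>unit_ball. norm (w - z) < \<delta> \<longrightarrow> (\<forall>f\<in>vecs H.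
        hnorm E (f w - f z - (\<Sum>i\<in>UNIV. (w $ i - z $ i) *\<^sub>C d i f)) \<le> e * norm (w - z) * hnorm H f))"
      unfolding uniformly_holomorphic_def by blast
    have d: "\<And>i. d i \<in> bounded_ops H E" "\<And>e. e > 0 \<Longrightarrow> \<exists>\<delta>>0. \<forall>w\<in>unit_ball. norm (w - z) < \<delta> \<longrightarrow> (\<forall>f\<in>vecs H.
        hnorm E (f w - f z - (\<Sum>i\<in>UNIV. (w $ i - z $ i) *\<^sub>C d i f)) \<le> e * norm (w - z) * hnorm H f)"
      using d0 by blast+
    show "\<exists>d. (\<forall>i. d i \<in> vecs E) \<and> (\<forall>e>0. \<exists>\<delta>>0. \<forall>w\<in>unit_ball. norm (w - z) < \<delta> \<longrightarrow>
           hnorm E (f w - f z - (\<Sum>i\<in>UNIV. (w $ i - z $ i) *\<^sub>C d i)) \<le> e * norm (w - z))"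
    proof (rule exI[of _ "\<lambda>i. d i f"], intro conjI allI impI)
      show "d i f \<in> vecs E" for i using bounded_opsD(1)[OF d(1) f] .
      fix e :: real assume e: "e > 0"
      have n1: "hnorm H f + 1 > 0" using H.hnorm_nonneg[OF f] by linarith
      from d(2)[OF divide_pos_pos[OF e n1]] obtain \<delta> where \<delta>0: "\<delta> > 0 \<and> (\<forall>w\<in>unit_ball. norm (w - z) < \<delta> \<longrightarrow> (\<forall>f'\<in>vecs H.
          hnorm E (f' w - f' z - (\<Sum>i\<in>UNIV. (w $ i - z $ i) *\<^sub>C d i f')) \<le> e / (hnorm H f + 1) * norm (w - z) * hnorm H f'))" ..
      have \<delta>: "\<delta> > 0" "\<And>w. w \<in> unit_ball \<Longrightarrow> norm (w - z) < \<delta> \<Longrightarrow>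
          hnorm E (f w - f z - (\<Sum>i\<in>UNIV. (w $ i - z $ i) *\<^sub>C d i f)) \<le> e / (hnorm H f + 1) * norm (w - z) * hnorm H f"
        using \<delta>0 f by blast+
      have "e / (hnorm H f + 1) * norm (w - z) * hnorm H f \<le> e * norm (w - z)" for w
      proof -
        have "e / (hnorm H f + 1) * hnorm H f \<le> e" using n1 e by (simp add: field_simps)
        from mult_right_mono[OF this, of "norm (w - z)"] show ?thesis by (simp add: mult_ac)
      qed
      then show "\<exists>\<delta>>0. \<forall>w\<in>unit_ball. norm (w - z) < \<delta> \<longrightarrow>
           hnorm E (f w - f z - (\<Sum>i\<in>UNIV. (w $ i - z $ i) *\<^sub>C d i f)) \<le> e * norm (w - z)"
        using \<delta> by (meson order_trans)
    qed
  qed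
  have kerJ: "(\<lambda>z. if z \<in> unit_ball then k z w *\<^sub>C \<eta> else 0) = J (\<kappa> w \<eta>)" if w: "w \<in> unit_ball" "\<eta> \<in> vecs E" for w \<eta>
  proof
    fix z show "(if z \<in> unit_ball then k z w *\<^sub>C \<eta> else 0) = J (\<kappa> w \<eta>) z"
    proof (cases "z \<in> unit_ball")
      case True
      have \<kappa>m: "\<kappa> w \<eta> \<in> vecs G" using bounded_opsD(1)[OF \<kappa>] w by auto
      have "k z w *\<^sub>C \<eta> = J (\<kappa> w \<eta>) z"
        using J_ip[OF \<kappa>m True] ker[OF w(1) True w(2)] w(2) Jmem[OF \<kappa>m]
        by (intro E.ip_eqI_left) (auto simp: E.ip_linear)
      then show ?thesis using True by simp
    qed (auto simp: J_def)
  qed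
  have "is_rkhs E k H"
    unfolding is_rkhs_def
  proof (intro conjI ballI allI impI)
    show "f z = 0" if "f \<in> vecs H" "z \<notin> unit_ball" for f z
      using that unfolding V by (auto simp: J_def)
    show "(\<lambda>z. if z \<in> unit_ball then k z w *\<^sub>C \<eta> else 0) \<in> vecs H" if "w \<in> unit_ball" "\<eta> \<in> vecs E" for w \<eta>
      using kerJ[OF that] \<kappa>M[OF that] V by simp
    show "ip H f (\<lambda>z. if z \<in> unit_ball then k z w *\<^sub>C \<eta> else 0) = ip E (f w) \<eta>"
      if "w \<in> unit_ball" "\<eta> \<in> vecs E" "f \<in> vecs H" for w \<eta> f
      using kerJ[OF that(1,2)] \<kappa>M[OF that(1,2)] that(3) tr(2) J_ip[OF _ that(1,2)] MG unfolding V by auto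
  qed (use tr(1) holo in auto)
  then show ?thesis using unif by blast
qed

text \<open>The feature space of \<open>(1 - \<langle>z,w\<rangle>)\<^sup>-\<^sup>m\<close> is the full Fock space: words \<open>u\<close> over the coordinate
  indices replace multi-indices, so that no multinomial coefficients occur. Words of length \<open>k\<close>
  carry the weight \<open>c k\<close>, the coefficient of \<open>t\<^sup>k\<close> in \<open>(1 - t)\<^sup>-\<^sup>m\<close>.\<close>

abbreviation words :: "nat \<Rightarrow> 'n list set" where
  "words k \<equiv> {u. length u = k}"

primrec mon :: "complex^'n \<Rightarrow> 'n list \<Rightarrow> complex" where
  "mon w [] = 1"
| "mon w (j # u) = w $ j * mon w u"

text \<open>The partial derivative of \<open>mon z u\<close> with respect to z_i, by the product
  rule along the word.\<close>

primrec pmon :: "complex^'n \<Rightarrow> 'n \<Rightarrow> 'n list \<Rightarrow> complex" where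
  "pmon z i [] = 0"
| "pmon z i (j # u) = (if i = j then mon z u else 0) + z $ j * pmon z i u"

lemma finite_words: "finite (words k :: 'n::finite list set)"
  using finite_lists_length_eq[of "UNIV :: 'n set" k] by simp

lemma sum_words_0: "(\<Sum>u\<in>words 0. f u) = f []"
  by simp

lemma sum_words_Suc:
  fixes f :: "'n::finite list \<Rightarrow> 'b::comm_monoid_add"
  shows "(\<Sum>u\<in>words (Suc k). f u) = (\<Sum>i\<in>UNIV. \<Sum>u\<in>words k. f (i # u))"
proof -
  have "bij_betw (\<lambda>(i, u). i # u) (UNIV \<times> words k) (words (Suc k) :: 'n list set)"
    by (rule bij_betwI[where g = "\<lambda>u. (hd u, tl u)"]) (auto simp: length_Suc_conv)
  note sum.reindex_bij_betw[OF this, of f, symmetric]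
  then have "(\<Sum>u\<in>words (Suc k). f u) = (\<Sum>(i, u)\<in>UNIV \<times> words k. f (i # u))"
    by (simp add: case_prod_beta)
  then show ?thesis by (simp add: sum.cartesian_product)
qed

lemma sum_mon_cnj: "(\<Sum>u\<in>words k. mon z u * cnj (mon w u)) = cdot z w ^ k"
proof (induction k)
  case (Suc k)
  have "(\<Sum>u\<in>words (Suc k). mon z u * cnj (mon w u))
      = (\<Sum>i\<in>UNIV. z $ i * cnj (w $ i) * (\<Sum>u\<in>words k. mon z u * cnj (mon w u)))"
    unfolding sum_words_Suc by (simp add: sum_distrib_left mult_ac)
  then show ?case by (simp add: Suc cdot_def flip: sum_distrib_right)
qed (simp add: sum_words_0)

abbreviation wnorm :: "nat \<Rightarrow> ('n list \<Rightarrow> complex) \<Rightarrow> real" where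
  "wnorm k f \<equiv> L2_set (\<lambda>u. cmod (f u)) (words k)"

lemma wnorm_triangle: "wnorm k (\<lambda>u. f u + g u) \<le> wnorm k f + wnorm k g"
  by (rule order_trans[OF L2_set_mono L2_set_triangle_ineq]) (auto intro: norm_triangle_ineq)

text \<open>A word of length k + 1 is a head and a tail, so a function of the head times a function
  of the tail is an elementary tensor, with multiplicative norm. The estimates below are inductions
  built on this.\<close>

lemma wnorm_Suc_scale: "wnorm (Suc k) (\<lambda>u. h $ hd u * g (tl u)) = norm h * wnorm k g"
  for h :: "complex^'n::finite"
proof -
  have "(\<Sum>u\<in>words (Suc k). (cmod (h $ hd u * g (tl u)))\<^sup>2) = (\<Sum>i\<in>UNIV. (cmod (h $ i))\<^sup>2) * (\<Sum>u\<in>words k. (cmod (g u))\<^sup>2)"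
    unfolding sum_words_Suc by (simp add: norm_mult power_mult_distrib sum_product)
  then show ?thesis by (simp add: L2_set_def norm_vec_def real_sqrt_mult)
qed

lemma wnorm_mon: "wnorm k (mon w) = norm w ^ k"
proof (induction k)
  case (Suc k)
  have "wnorm (Suc k) (mon w) = wnorm (Suc k) (\<lambda>u. w $ hd u * mon w (tl u))"
    by (rule L2_set_cong) (auto simp: length_Suc_conv)
  then show ?case by (simp add: wnorm_Suc_scale Suc)
qed (simp add: L2_set_def)

lemma norm_axis_complex: "norm (axis i (1::complex)) = 1"
proof -
  have "(\<Sum>j\<in>UNIV. (cmod (axis i (1::complex) $ j))\<^sup>2) = (\<Sum>j\<in>UNIV. if j = i then 1 else 0)"
    by (intro sum.cong) (auto simp: axis_def)
  then show ?thesis by (simp add: norm_vec_def L2_set_def)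
qed

text \<open>The bound is k r^(k-1), written with a division so that k = 0 is covered; r > 0 stands
  in for |z|, which may vanish.\<close>

lemma wnorm_pmon:
  assumes r: "0 < r" and z: "norm z \<le> r"
  shows "wnorm k (pmon z i) \<le> real k / r * r ^ k"
proof (induction k)
  case (Suc k)
  have "wnorm (Suc k) (pmon z i) = wnorm (Suc k) (\<lambda>u. axis i 1 $ hd u * mon z (tl u) + z $ hd u * pmon z i (tl u))"
    by (rule L2_set_cong) (auto simp: length_Suc_conv axis_def)
  also have "\<dots> \<le> norm (axis i (1::complex)) * norm z ^ k + norm z * wnorm k (pmon z i)"
    by (rule order_trans[OF wnorm_triangle]) (simp only: wnorm_Suc_scale wnorm_mon order_refl)
  also have "\<dots> \<le> r ^ k + r * (real k / r * r ^ k)"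
    using Suc z r by (intro add_mono mult_mono power_mono) (auto simp: norm_axis_complex intro: power_mono)
  also have "\<dots> = real (Suc k) / r * r ^ Suc k" using r by (simp add: field_simps)
  finally show ?case .
qed (simp add: L2_set_def)

lemma wnorm_mon_diff:
  assumes r: "0 < r" and z: "norm z \<le> r" "norm w \<le> r"
  shows "wnorm k (\<lambda>u. mon w u - mon z u) \<le> real k / r * r ^ k * norm (w - z)"
proof (induction k)
  case (Suc k)
  have "wnorm (Suc k) (\<lambda>u. mon w u - mon z u)
      = wnorm (Suc k) (\<lambda>u. (w - z) $ hd u * mon w (tl u) + z $ hd u * (mon w (tl u) - mon z (tl u)))"
    by (rule L2_set_cong) (auto simp: length_Suc_conv algebra_simps)
  also have "\<dots> \<le> norm (w - z) * norm w ^ k + norm z * wnorm k (\<lambda>u. mon w u - mon z u)"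
    by (rule order_trans[OF wnorm_triangle]) (simp only: wnorm_Suc_scale[where g = "mon w"] wnorm_Suc_scale[where g = "\<lambda>u. mon w u - mon z u"] wnorm_mon order_refl)
  also have "\<dots> \<le> norm (w - z) * r ^ k + r * (real k / r * r ^ k * norm (w - z))"
    using Suc z r by (intro add_mono mult_mono power_mono) auto
  also have "\<dots> = real (Suc k) / r * r ^ Suc k * norm (w - z)" using r by (simp add: field_simps)
  finally show ?case .
qed (simp add: L2_set_def)

text \<open>Splitting off the first letter, the first-order remainder satisfies R(j u) = (w - z)_j
  (mon w u - mon z u) + z_j R(u), and k + k^2 <= (k + 1)^2 closes the induction.\<close>

lemma wnorm_mon_remainder:
  fixes w z :: "complex^'n"
  assumes r: "0 < r" and z: "norm z \<le> r" "norm w \<le> r"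
  shows "wnorm k (\<lambda>u. mon w u - mon z u - (\<Sum>i\<in>UNIV. (w $ i - z $ i) * pmon z i u))
      \<le> (real k / r)\<^sup>2 * r ^ k * (norm (w - z))\<^sup>2"
proof (induction k)
  case (Suc k)
  let ?R = "\<lambda>u. mon w u - mon z u - (\<Sum>i\<in>UNIV. (w $ i - z $ i) * pmon z i u)"
  have "?R (j # u) = (w - z) $ j * (mon w u - mon z u) + z $ j * ?R u" for j u
  proof -
    have "(\<Sum>i\<in>UNIV. (w $ i - z $ i) * pmon z i (j # u))
        = (\<Sum>i\<in>UNIV. (if i = j then (w $ i - z $ i) * mon z u else 0)) + z $ j * (\<Sum>i\<in>UNIV. (w $ i - z $ i) * pmon z i u)"
      unfolding sum_distrib_left sum.distrib[symmetric] by (intro sum.cong) (auto simp: algebra_simps)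
    then show ?thesis by (simp add: algebra_simps)
  qed
  then have "wnorm (Suc k) ?R = wnorm (Suc k) (\<lambda>u. (w - z) $ hd u * (mon w (tl u) - mon z (tl u)) + z $ hd u * ?R (tl u))"
    by (intro L2_set_cong) (auto simp: length_Suc_conv)
  also have "\<dots> \<le> norm (w - z) * wnorm k (\<lambda>u. mon w u - mon z u) + norm z * wnorm k ?R"
    by (rule order_trans[OF wnorm_triangle])
      (simp only: wnorm_Suc_scale[where g = "\<lambda>u. mon w u - mon z u"] wnorm_Suc_scale[where g = ?R] order_refl)
  also have "\<dots> \<le> norm (w - z) * (real k / r * r ^ k * norm (w - z)) + r * ((real k / r)\<^sup>2 * r ^ k * (norm (w - z))\<^sup>2)"
    using Suc z r wnorm_mon_diff[OF r z, of k] by (intro add_mono mult_mono) auto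
  also have "\<dots> = (real k / r + real k * real k / r) * r ^ k * (norm (w - z))\<^sup>2"
    using r by (simp add: power2_eq_square field_simps)
  also have "\<dots> \<le> ((real (Suc k))\<^sup>2 / r) * r ^ k * (norm (w - z))\<^sup>2"
    using r by (intro mult_right_mono) (auto simp: power2_eq_square divide_simps algebra_simps)
  also have "\<dots> = (real (Suc k) / r)\<^sup>2 * r ^ Suc k * (norm (w - z))\<^sup>2"
    using r by (simp add: power2_eq_square)
  finally show ?case .
qed (simp add: L2_set_def)

section \<open>Binomial weights and sums over words\<close>

definition wt :: "nat \<Rightarrow> nat \<Rightarrow> real" where
  "wt m k = real ((m + k - 1) choose k)"

lemma wt_sums:
  assumes m: "1 \<le> m" and t: "cmod t < 1"
  shows "(\<lambda>k. of_real (wt m k) * t ^ k) sums (1 / (1 - t) ^ m)"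
proof -
  have "(\<lambda>k. ((- of_nat m) gchoose k) * (- t) ^ k) sums (1 + - t) powr (- of_nat m :: complex)"
    using t by (intro gen_binomial_complex) simp
  moreover have "((- of_nat m) gchoose k) * (- t) ^ k = of_real (wt m k) * t ^ k" for k
  proof -
    have "((- of_nat m :: complex) gchoose k) = (-1) ^ k * ((of_nat m + of_nat k - 1) gchoose k)"
      by (rule gbinomial_minus)
    also have "(of_nat m + of_nat k - 1 :: complex) = of_nat (m + k - 1)"
      using m by (simp add: of_nat_diff)
    finally have "((- of_nat m :: complex) gchoose k) = (-1) ^ k * of_real (wt m k)"
      unfolding wt_def binomial_gbinomial[symmetric] of_real_of_nat_eq .
    then have "((- of_nat m) gchoose k) * (- t) ^ k = ((-1) ^ k * (-1) ^ k) * (of_real (wt m k) * t ^ k)"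
      unfolding power_minus[of t k] by (simp only: mult_ac)
    also have "(-1) ^ k * (-1) ^ k = (1 :: complex)" by (simp flip: power_mult_distrib)
    finally show ?thesis by simp
  qed
  moreover have "(1 + - t) powr (- of_nat m :: complex) = 1 / (1 - t) ^ m"
  proof -
    have "1 - t \<noteq> 0" using t by auto
    then show ?thesis using powr_nat'[of "1 - t" m] by (simp add: powr_minus divide_inverse)
  qed
  ultimately show ?thesis by simp
qed

text \<open>With s = sqrt(\<rho>), one factor k is absorbed by s^k, since k s^k is bounded; the
  other s^k is left for the induction hypothesis, which therefore ranges over all \<rho>.\<close>

lemma summable_power_geometric:
  fixes \<rho> :: real
  assumes "0 < \<rho>" "\<rho> < 1"
  shows "summable (\<lambda>k. real k ^ j * \<rho> ^ k)"
  using assms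
proof (induction j arbitrary: \<rho>)
  case 0
  then show ?case by (simp add: summable_geometric)
next
  case (Suc j)
  define s where "s = sqrt \<rho>"
  have s: "0 < s" "s < 1" "\<rho> = s * s" using Suc.prems by (auto simp: s_def)
  have "(\<lambda>n. real n * s ^ n) \<longlonglongrightarrow> 0" using powser_times_n_limit_0[of s] s by simp
  then have "Bseq (\<lambda>n. real n * s ^ n)" using convergent_imp_Bseq convergentI by blast
  then obtain B where B: "\<And>n. \<bar>real n * s ^ n\<bar> \<le> B"
    unfolding Bseq_def real_norm_def by blast
  show ?case
  proof (rule summable_comparison_test')
    show "summable (\<lambda>k. B * (real k ^ j * s ^ k))" using Suc.IH s by (intro summable_mult) auto
    fix k assume "(0::nat) \<le> k"
    have "real k ^ Suc j * \<rho> ^ k = (real k * s ^ k) * (real k ^ j * s ^ k)"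
      by (simp add: s(3) power_mult_distrib)
    also have "\<dots> \<le> B * (real k ^ j * s ^ k)"
      using B[of k] s by (intro mult_right_mono) auto
    finally show "norm (real k ^ Suc j * \<rho> ^ k) \<le> B * (real k ^ j * s ^ k)"
      using s(1) by (simp add: s(3))
  qed
qed

lemma wt_nonneg [simp]: "0 \<le> wt m k"
  by (simp add: wt_def)

text \<open>The terms \<open>wt m k\<close> r^k of the convergent binomial series are bounded, and
  the second r^k controls the powers of k. The exponents j = 0, 1, 2 serve values, first derivatives
  and remainders of the feature map.\<close>

lemma summable_wt_power:
  assumes m: "1 \<le> m" and r: "0 < r" "r < 1"
  shows "summable (\<lambda>k. wt m k * (real k ^ j * r ^ k)\<^sup>2)"
proof -
  have "(\<lambda>k. of_real (wt m k) * complex_of_real r ^ k) sums (1 / (1 - complex_of_real r) ^ m)"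
    using r by (intro wt_sums m) simp
  then have "(\<lambda>k. of_real (wt m k) * complex_of_real r ^ k) \<longlonglongrightarrow> 0"
    using summable_LIMSEQ_zero sums_summable by blast
  then have "Bseq (\<lambda>k. of_real (wt m k) * complex_of_real r ^ k)" using convergent_imp_Bseq convergentI by blast
  then obtain B where B: "\<And>k. cmod (of_real (wt m k) * complex_of_real r ^ k) \<le> B"
    unfolding Bseq_def by blast
  show ?thesis
  proof (rule summable_comparison_test')
    show "summable (\<lambda>k. B * (real k ^ (2 * j) * r ^ k))"
      using summable_power_geometric r by (intro summable_mult) auto
    fix k assume "(0::nat) \<le> k"
    have "wt m k * (real k ^ j * r ^ k)\<^sup>2 = (wt m k * r ^ k) * (real k ^ (2 * j) * r ^ k)"
      by (simp add: power_mult_distrib power_mult power2_eq_square flip: power_mult) (simp add: power_mult power2_eq_square power_mult_distrib flip: power_add)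
    also have "\<dots> \<le> B * (real k ^ (2 * j) * r ^ k)"
      using B[of k] r by (intro mult_right_mono) (auto simp: norm_mult norm_power)
    finally show "norm (wt m k * (real k ^ j * r ^ k)\<^sup>2) \<le> B * (real k ^ (2 * j) * r ^ k)" by simp
  qed
qed

lemma words_exhaust: 
  assumes "finite (F :: 'n list set)"
  obtains N where "F \<subseteq> (\<Union>k<N. words k)"
proof -
  obtain N where "\<forall>u\<in>F. length u < N" using finite_nat_set_iff_bounded[of "length ` F"] assms by auto
  then show ?thesis using that[of N] by auto
qed

lemma sum_UN_words:
  fixes f :: "'n::finite list \<Rightarrow> 'b::comm_monoid_add"
  shows "sum f (\<Union>k<N. words k) = (\<Sum>k<N. sum f (words k))"
  by (rule sum.UNION_disjoint) (auto simp: finite_words)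

lemma words_bound:
  fixes f :: "'n::finite list \<Rightarrow> real"
  assumes pos: "\<And>u. 0 \<le> f u" and le: "\<And>k. (\<Sum>u\<in>words k. f u) \<le> b k" and b: "summable b"
  shows "f summable_on UNIV" "infsum f UNIV \<le> suminf b"
proof -
  have b0: "0 \<le> b k" for k using le[of k] pos by (meson order_trans sum_nonneg)
  have *: "sum f F \<le> suminf b" if F: "finite F" for F
  proof -
    obtain N where N: "F \<subseteq> (\<Union>k<N. words k)" using words_exhaust[OF F] .
    have "sum f F \<le> sum f (\<Union>k<N. words k)"
      using N pos finite_words by (intro sum_mono2) auto
    also have "\<dots> \<le> (\<Sum>k<N. b k)" unfolding sum_UN_words by (intro sum_mono le)
    also have "\<dots> \<le> suminf b" using b b0 by (intro sum_le_suminf) auto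
    finally show ?thesis .
  qed
  show s: "f summable_on UNIV"
    using pos * by (intro nonneg_bounded_partial_sums_imp_summable_on[where C = "suminf b"])
      (auto simp: eventually_finite_subsets_at_top_weakI)
  show "infsum f UNIV \<le> suminf b" using s * by (intro infsum_le_finite_sums) auto
qed

lemma words_sums:
  fixes f :: "'n::finite list \<Rightarrow> complex"
  assumes "f summable_on UNIV"
  shows "(\<lambda>k. \<Sum>u\<in>words k. f u) sums infsum f UNIV"
proof -
  have "filterlim (\<lambda>N. \<Union>k<N. words k :: 'n list set) (finite_subsets_at_top UNIV) sequentially"
    unfolding filterlim_finite_subsets_at_top
  proof (intro allI impI)
    fix X :: "'n list set" assume X: "finite X \<and> X \<subseteq> UNIV"
    obtain N where N: "X \<subseteq> (\<Union>k<N. words k)" using words_exhaust X by blast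
    show "\<forall>\<^sub>F M in sequentially. finite (\<Union>k<M. words k :: 'n list set) \<and> X \<subseteq> (\<Union>k<M. words k) \<and> (\<Union>k<M. words k :: 'n list set) \<subseteq> UNIV"
      using eventually_ge_at_top[of N]
    proof eventually_elim
      case (elim M)
      have "(\<Union>k<N. words k) \<subseteq> (\<Union>k<M. words k :: 'n list set)" using elim by (intro UN_mono) auto
      then show ?case using N finite_words by auto
    qed
  qed
  moreover have "(sum f \<longlongrightarrow> infsum f UNIV) (finite_subsets_at_top UNIV)"
    using assms has_sum_infsum unfolding has_sum_def by blast
  ultimately have "(\<lambda>N. sum f (\<Union>k<N. words k)) \<longlonglongrightarrow> infsum f UNIV"
    by (rule filterlim_compose[rotated])
  then show ?thesis by (simp add: sums_def sum_UN_words)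
qed

text \<open>The elementary tensor of a scalar sequence and a vector.\<close>

definition seqop :: "('i \<Rightarrow> complex) \<Rightarrow> 'e::complex_vector \<Rightarrow> 'i \<Rightarrow> 'e" where
  "seqop a \<eta> = (\<lambda>u. a u *\<^sub>C \<eta>)"

definition sq_summable :: "('i \<Rightarrow> complex) \<Rightarrow> bool" where
  "sq_summable a \<longleftrightarrow> (\<lambda>u. (cmod (a u))\<^sup>2) summable_on UNIV"

context hilbert_space
begin

lemma seqop_mem: "sq_summable a \<Longrightarrow> \<eta> \<in> vecs H \<Longrightarrow> seqop a \<eta> \<in> vecs (l2_hspace H)"
  by (simp add: vecs_l2 seqop_def sq_summable_def power_mult_distrib summable_on_cmult_left)

lemma hnorm_seqop:
  assumes "sq_summable a" "\<eta> \<in> vecs H"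
  shows "(hnorm (l2_hspace H) (seqop a \<eta>))\<^sup>2 = (\<Sum>\<^sub>\<infinity>u. (cmod (a u))\<^sup>2) * (hnorm H \<eta>)\<^sup>2"
  using assms unfolding hnorm_l2_sq[OF seqop_mem[OF assms]]
  by (simp add: seqop_def power_mult_distrib sq_summable_def infsum_cmult_left)

lemma seqop_bounded: "sq_summable a \<Longrightarrow> seqop a \<in> bounded_ops H (l2_hspace H)"
proof -
  assume a: "sq_summable a"
  interpret L: hilbert_space "l2_hspace H :: ('b \<Rightarrow> 'a) hspace" by (rule l2_hilbert)
  define C where "C = (\<Sum>\<^sub>\<infinity>u. (cmod (a u))\<^sup>2)"
  have C: "C \<ge> 0" by (simp add: C_def infsum_nonneg)
  show ?thesis
  proof (rule bounded_opsI[where C = "sqrt C"])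
    fix x assume x: "x \<in> vecs H"
    have sq: "(hnorm (l2_hspace H) (seqop a x))\<^sup>2 \<le> (sqrt C * hnorm H x)\<^sup>2"
      using hnorm_seqop[OF a x] C by (simp add: power_mult_distrib C_def)
    have "0 \<le> sqrt C * hnorm H x" using C x by simp
    then show "hnorm (l2_hspace H) (seqop a x) \<le> sqrt C * hnorm H x"
      using power2_le_imp_le[OF sq] by blast
  next
    show "seqop a (x + y) = seqop a x + seqop a y" for x y
      by (simp add: seqop_def scaleC_add_right fun_eq_iff)
    show "seqop a (c *\<^sub>C x) = c *\<^sub>C seqop a x" for c x
      by (simp add: seqop_def scaleC_scaleC mult.commute fun_eq_iff)
  qed (rule seqop_mem[OF a])
qed

lemma ip_seqop:
  assumes "sq_summable a" "sq_summable b" "\<eta> \<in> vecs H" "\<zeta> \<in> vecs H"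
    and "(\<lambda>u. a u * cnj (b u)) summable_on UNIV"
  shows "ip (l2_hspace H) (seqop a \<eta>) (seqop b \<zeta>) = (\<Sum>\<^sub>\<infinity>u. a u * cnj (b u)) * ip H \<eta> \<zeta>"
proof -
  have "ip (l2_hspace H) (seqop a \<eta>) (seqop b \<zeta>) = (\<Sum>\<^sub>\<infinity>u. (a u * cnj (b u)) * ip H \<eta> \<zeta>)"
    unfolding ip_l2 using assms(3,4) by (simp add: seqop_def ip_linear mult_ac)
  also have "\<dots> = (\<Sum>\<^sub>\<infinity>u. a u * cnj (b u)) * ip H \<eta> \<zeta>" using assms(5) by (intro infsum_cmult_left) auto
  finally show ?thesis .
qed

end

lemma sum_fun_apply: "(\<Sum>i\<in>I. f i) x = (\<Sum>i\<in>I. f i x)"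
  by (induction I rule: infinite_finite_induct) auto

text \<open>The square root splits the weight evenly between the two factors of an inner product;
  the conjugate makes the features antiholomorphic.\<close>

lemma sq_summable_weighted:
  fixes a :: "'n::finite list \<Rightarrow> complex"
  assumes le: "\<And>k. wnorm k a \<le> q k" and s: "summable (\<lambda>k. wt m k * (q k)\<^sup>2)"
  defines "b \<equiv> \<lambda>u. of_real (sqrt (wt m (length u))) * cnj (a u)"
  shows "sq_summable b" "(\<Sum>\<^sub>\<infinity>u. (cmod (b u))\<^sup>2) \<le> (\<Sum>k. wt m k * (q k)\<^sup>2)"
proof -
  have "(\<Sum>u\<in>words k. (cmod (b u))\<^sup>2) \<le> wt m k * (q k)\<^sup>2" for k
  proof -
    have "(\<Sum>u\<in>words k. (cmod (b u))\<^sup>2) = wt m k * (\<Sum>u\<in>words k. (cmod (a u))\<^sup>2)"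
      unfolding sum_distrib_left by (intro sum.cong) (auto simp: b_def norm_mult power_mult_distrib)
    also have "(\<Sum>u\<in>words k. (cmod (a u))\<^sup>2) = (wnorm k a)\<^sup>2"
      by (simp add: L2_set_def sum_nonneg)
    also have "\<dots> \<le> (q k)\<^sup>2" using le by (intro power_mono) (auto simp: L2_set_nonneg)
    finally show ?thesis by (simp add: mult_left_mono)
  qed
  from words_bound[OF _ this s] show "sq_summable b" "(\<Sum>\<^sub>\<infinity>u. (cmod (b u))\<^sup>2) \<le> (\<Sum>k. wt m k * (q k)\<^sup>2)"
    by (auto simp: sq_summable_def)
qed

lemma sq_summable_mult:
  assumes "sq_summable a" "sq_summable b"
  shows "(\<lambda>u. a u * cnj (b u)) summable_on UNIV"
proof (rule Infinite_Sum.abs_summable_summable, rule Infinite_Sum.abs_summable_on_comparison_test')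
  show "(\<lambda>u. (cmod (a u))\<^sup>2 + (cmod (b u))\<^sup>2) summable_on UNIV"
    using assms by (intro summable_on_add) (auto simp: sq_summable_def)
  fix u
  have "0 \<le> cmod (a u) * cmod (b u)" by simp
  then show "norm (a u * cnj (b u)) \<le> (cmod (a u))\<^sup>2 + (cmod (b u))\<^sup>2"
    using sum_squares_bound[of "cmod (a u)" "cmod (b u)"] unfolding norm_mult complex_mod_cnj by linarith
qed

text \<open>\<open>Hm\<close> is a Hilbert choice, so nothing can be said about it without this
  witness. The feature of (w, \<eta>) at a word u is \<eta> times the conjugate of the product of
  the coordinates of w along u, times the square root of the weight of the length of u.\<close>

theorem weighted_bergman_exists:
  fixes E :: "'e::complex_vector hspace"
  assumes "hilbert_space E" and m: "1 \<le> m"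
  shows "\<exists>H :: (complex^'n \<Rightarrow> 'e) hspace. is_rkhs E (\<lambda>z w. 1 / (1 - cdot z w) ^ m) H \<and> uniformly_holomorphic E H"
proof -
  interpret E: hilbert_space E by fact
  interpret L: hilbert_space "l2_hspace E :: ('n list \<Rightarrow> 'e) hspace" by (rule E.l2_hilbert)
  define W where "W f = (\<lambda>u. of_real (sqrt (wt m (length u))) * cnj (f u))" for f :: "'n list \<Rightarrow> complex"
  have sqW: "sq_summable (W f)" "(\<Sum>\<^sub>\<infinity>u. (cmod (W f u))\<^sup>2) \<le> (\<Sum>k. wt m k * (q k)\<^sup>2)"
    if "\<And>k. wnorm k f \<le> q k" "summable (\<lambda>k. wt m k * (q k)\<^sup>2)" for f q
    using sq_summable_weighted[OF that] unfolding W_def by blast+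
  have radius: "\<exists>r. 0 < r \<and> r < 1 \<and> norm w < r" if "w \<in> unit_ball" for w :: "complex^'n"
    using that norm_ge_zero[of w] by (intro exI[of _ "(1 + norm w) / 2"]) (auto simp del: norm_ge_zero)
  have sqmon: "sq_summable (W (mon w))" if w: "w \<in> unit_ball" for w :: "complex^'n"
  proof -
    obtain r where r: "0 < r" "r < 1" "norm w < r" using radius[OF w] by blast
    show ?thesis
      using r summable_wt_power[OF m r(1,2), of 0]
      by (intro sqW(1)[where q = "\<lambda>k. real k ^ 0 * r ^ k"]) (auto simp: wnorm_mon intro: power_mono)
  qed
  show ?thesis
  proof (rule rkhs_from_feature[where \<kappa> = "\<lambda>w. seqop (W (mon w))"])
    show "hilbert_space E" "hilbert_space (l2_hspace E :: ('n list \<Rightarrow> 'e) hspace)" by unfold_locales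
    show "seqop (W (mon w)) \<in> bounded_ops E (l2_hspace E)" if "w \<in> unit_ball" for w :: "complex^'n"
      by (rule E.seqop_bounded[OF sqmon[OF that]])
    show "ip (l2_hspace E) (seqop (W (mon w)) \<eta>) (seqop (W (mon z)) \<zeta>) = 1 / (1 - cdot z w) ^ m * ip E \<eta> \<zeta>"
      if w: "w \<in> unit_ball" and z: "z \<in> unit_ball" and v: "\<eta> \<in> vecs E" "\<zeta> \<in> vecs E" for w z :: "complex^'n" and \<eta> \<zeta>
    proof -
      note sm = sq_summable_mult[OF sqmon[OF w] sqmon[OF z]]
      have "(\<Sum>u\<in>words k. W (mon w) u * cnj (W (mon z) u)) = of_real (wt m k) * cdot z w ^ k" for k
        unfolding sum_mon_cnj[symmetric] sum_distrib_left
        by (intro sum.cong) (auto simp: W_def mult_ac simp flip: of_real_mult)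
      then have "(\<lambda>k. of_real (wt m k) * cdot z w ^ k) sums (\<Sum>\<^sub>\<infinity>u. W (mon w) u * cnj (W (mon z) u))"
        using words_sums[OF sm] by simp
      moreover have "(\<lambda>k. of_real (wt m k) * cdot z w ^ k) sums (1 / (1 - cdot z w) ^ m)"
        by (rule wt_sums[OF m cdot_less_1[OF z w]])
      ultimately have "(\<Sum>\<^sub>\<infinity>u. W (mon w) u * cnj (W (mon z) u)) = 1 / (1 - cdot z w) ^ m"
        by (rule sums_unique2)
      then show ?thesis using E.ip_seqop[OF sqmon[OF w] sqmon[OF z] v sm] by simp
    qed
    fix z :: "complex^'n" assume z: "z \<in> unit_ball"
    \<comment> \<open>One radius between |z| and 1 serves z and all w near it, so that the constant
      in the remainder estimate does not depend on w.\<close>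
    obtain r where r: "0 < r" "r < 1" "norm z < r" using radius[OF z] by blast
    define b where "b i = W (pmon z i)" for i
    have b: "sq_summable (b i)" for i
      unfolding b_def
    proof (rule sqW(1)[where q = "\<lambda>k. real k / r * r ^ k"])
      show "wnorm k (pmon z i) \<le> real k / r * r ^ k" for k using r by (intro wnorm_pmon) auto
      have "summable (\<lambda>k. wt m k * (real k ^ 1 * r ^ k)\<^sup>2 * (1 / r)\<^sup>2)"
        by (intro summable_mult2 summable_wt_power m r)
      then show "summable (\<lambda>k. wt m k * (real k / r * r ^ k)\<^sup>2)"
        by (simp add: power_mult_distrib power_divide mult.assoc)
    qed
    \<comment> \<open>The weighted sum of the squared remainder bounds over all lengths, with |w -
      z|^4 taken out.\<close>
    define C where "C = (\<Sum>k. wt m k * (real k ^ 2 * r ^ k)\<^sup>2) * (1 / r\<^sup>2)\<^sup>2"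
    have sC: "summable (\<lambda>k. wt m k * (real k ^ 2 * r ^ k)\<^sup>2)" by (intro summable_wt_power m r)
    have C: "C \<ge> 0" unfolding C_def by (intro mult_nonneg_nonneg suminf_nonneg sC) auto
    have est: "hnorm (l2_hspace E) (seqop (W (mon w)) \<eta> - seqop (W (mon z)) \<eta> - (\<Sum>i\<in>UNIV. cnj (w $ i - z $ i) *\<^sub>C seqop (b i) \<eta>))
        \<le> sqrt C * (norm (w - z))\<^sup>2 * hnorm E \<eta>" if w: "norm w < r" and v: "\<eta> \<in> vecs E" for w \<eta>
    proof -
      let ?R = "\<lambda>u. mon w u - mon z u - (\<Sum>i\<in>UNIV. (w $ i - z $ i) * pmon z i u)"
      let ?q = "\<lambda>k. (real k / r)\<^sup>2 * r ^ k * (norm (w - z))\<^sup>2"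
      have q: "wt m k * (?q k)\<^sup>2 = wt m k * (real k ^ 2 * r ^ k)\<^sup>2 * ((1 / r\<^sup>2)\<^sup>2 * ((norm (w - z))\<^sup>2)\<^sup>2)" for k
        by (simp add: power_mult_distrib power_divide)
      have le: "wnorm k ?R \<le> ?q k" for k using r w by (intro wnorm_mon_remainder) auto
      have sq: "summable (\<lambda>k. wt m k * (?q k)\<^sup>2)" unfolding q by (intro summable_mult2 sC)
      note R = sqW[OF le sq]
      have eq: "seqop (W (mon w)) \<eta> - seqop (W (mon z)) \<eta> - (\<Sum>i\<in>UNIV. cnj (w $ i - z $ i) *\<^sub>C seqop (b i) \<eta>) = seqop (W ?R) \<eta>"
      proof
        fix u
        have "(\<Sum>i\<in>UNIV. cnj (w $ i - z $ i) *\<^sub>C seqop (b i) \<eta>) u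
            = (\<Sum>i\<in>UNIV. of_real (sqrt (wt m (length u))) * (cnj (w $ i - z $ i) * cnj (pmon z i u))) *\<^sub>C \<eta>"
          unfolding sum_fun_apply by (simp add: seqop_def b_def W_def scaleC_scaleC complex_vector.scale_sum_left mult_ac)
        then show "(seqop (W (mon w)) \<eta> - seqop (W (mon z)) \<eta> - (\<Sum>i\<in>UNIV. cnj (w $ i - z $ i) *\<^sub>C seqop (b i) \<eta>)) u = seqop (W ?R) \<eta> u"
          by (simp add: seqop_def W_def complex_vector.scale_left_diff_distrib[symmetric] right_diff_distrib sum_distrib_left)
      qed
      have "(hnorm (l2_hspace E) (seqop (W ?R) \<eta>))\<^sup>2 = (\<Sum>\<^sub>\<infinity>u. (cmod (W ?R u))\<^sup>2) * (hnorm E \<eta>)\<^sup>2"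
        by (rule E.hnorm_seqop[OF R(1) v])
      also have "\<dots> \<le> (\<Sum>k. wt m k * (?q k)\<^sup>2) * (hnorm E \<eta>)\<^sup>2"
        using R(2) by (intro mult_right_mono) auto
      also have "(\<Sum>k. wt m k * (?q k)\<^sup>2) = C * ((norm (w - z))\<^sup>2)\<^sup>2"
        unfolding q C_def by (subst suminf_mult2[OF sC, symmetric]) (simp add: mult.assoc)
      also have "C * ((norm (w - z))\<^sup>2)\<^sup>2 * (hnorm E \<eta>)\<^sup>2 = (sqrt C * (norm (w - z))\<^sup>2 * hnorm E \<eta>)\<^sup>2"
        using C by (simp add: power_mult_distrib)
      finally have sq: "(hnorm (l2_hspace E) (seqop (W ?R) \<eta>))\<^sup>2 \<le> (sqrt C * (norm (w - z))\<^sup>2 * hnorm E \<eta>)\<^sup>2" .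
      have "0 \<le> sqrt C * (norm (w - z))\<^sup>2 * hnorm E \<eta>" using C v by simp
      then show ?thesis unfolding eq using power2_le_imp_le[OF sq] by blast
    qed
    show "\<exists>\<kappa>'. (\<forall>i. \<kappa>' i \<in> bounded_ops E (l2_hspace E)) \<and>
        (\<forall>e>0. \<exists>\<delta>>0. \<forall>w\<in>unit_ball. norm (w - z) < \<delta> \<longrightarrow> (\<forall>\<eta>\<in>vecs E.
          hnorm (l2_hspace E) (seqop (W (mon w)) \<eta> - seqop (W (mon z)) \<eta> - (\<Sum>i\<in>UNIV. cnj (w $ i - z $ i) *\<^sub>C \<kappa>' i \<eta>))
            \<le> e * norm (w - z) * hnorm E \<eta>))"
    proof (rule exI[of _ "\<lambda>i. seqop (b i)"], intro conjI allI impI)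
      show "seqop (b i) \<in> bounded_ops E (l2_hspace E)" for i by (rule E.seqop_bounded[OF b])
      fix e :: real assume e: "e > 0"
      \<comment> \<open>The first term keeps w inside radius r, the second turns the quadratic error
        into e |w - z|; the added 1 covers C = 0.\<close>
      define \<delta> where "\<delta> = min (r - norm z) (e / (sqrt C + 1))"
      have sC1: "sqrt C + 1 > 0" using C by (simp add: add_nonneg_pos)
      have \<delta>: "\<delta> > 0" using r(3) e sC1 by (simp add: \<delta>_def)
      have "hnorm (l2_hspace E) (seqop (W (mon w)) \<eta> - seqop (W (mon z)) \<eta> - (\<Sum>i\<in>UNIV. cnj (w $ i - z $ i) *\<^sub>C seqop (b i) \<eta>))
          \<le> e * norm (w - z) * hnorm E \<eta>" if w: "norm (w - z) < \<delta>" and v: "\<eta> \<in> vecs E" for w \<eta>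
      proof -
        have "norm w \<le> norm (w - z) + norm z" using norm_triangle_ineq[of "w - z" z] by simp
        then have wr: "norm w < r" using w by (simp add: \<delta>_def)
        have "norm (w - z) * (sqrt C + 1) < e" using w sC1 by (simp add: \<delta>_def pos_less_divide_eq)
        then have "sqrt C * norm (w - z) \<le> e" using norm_ge_zero[of "w - z"] by (simp add: algebra_simps del: norm_ge_zero)
        then have "sqrt C * norm (w - z) * norm (w - z) * hnorm E \<eta> \<le> e * norm (w - z) * hnorm E \<eta>"
          using v by (intro mult_right_mono) auto
        then show ?thesis using est[OF wr v] by (simp add: power2_eq_square mult.assoc)
      qed
      then show "\<exists>\<delta>>0. \<forall>w\<in>unit_ball. norm (w - z) < \<delta> \<longrightarrow> (\<forall>\<eta>\<in>vecs E.
          hnorm (l2_hspace E) (seqop (W (mon w)) \<eta> - seqop (W (mon z)) \<eta> - (\<Sum>i\<in>UNIV. cnj (w $ i - z $ i) *\<^sub>C seqop (b i) \<eta>))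
            \<le> e * norm (w - z) * hnorm E \<eta>)"
        using \<delta> by blast
    qed
  qed
qed

section \<open>The chosen spaces \<open>Hm\<close> and evaluation at a point\<close>

abbreviation kpow :: "nat \<Rightarrow> complex^'n \<Rightarrow> complex^'n \<Rightarrow> complex" where
  "kpow m \<equiv> (\<lambda>z w. 1 / (1 - cdot z w) ^ m)"

lemma Hm_rkhs:
  assumes "hilbert_space E" "1 \<le> m"
  shows "rkhs E (kpow m) (Hm m E)"
proof -
  have "is_rkhs E (kpow m) (Hm m E)"
    unfolding Hm_def by (rule someI_ex) (use weighted_bergman_exists[OF assms] in blast)
  then show ?thesis using assms(1) by (simp add: rkhs_def rkhs_axioms_def)
qed

text \<open>The chosen space may differ from the constructed one off the carrier.
  \<open>rkhs_inclusion\<close> in both directions shows that carriers and norms agree, and the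
  property depends on these alone.\<close>

lemma Hm_uniformly_holomorphic:
  fixes E :: "'e::complex_vector hspace"
  assumes "hilbert_space E" "1 \<le> m"
  shows "uniformly_holomorphic E (Hm m E :: (complex^'n \<Rightarrow> 'e) hspace)"
proof -
  obtain H :: "(complex^'n \<Rightarrow> 'e) hspace" where H: "is_rkhs E (kpow m) H" "uniformly_holomorphic E H"
    using weighted_bergman_exists[OF assms] by blast
  have r: "rkhs E (kpow m) H" using H(1) assms(1) by (simp add: rkhs_def rkhs_axioms_def)
  note r' = Hm_rkhs[OF assms]
  have V: "vecs H = vecs (Hm m E)" using rkhs_inclusion[OF r r'] rkhs_inclusion[OF r' r] by blast
  have N: "hnorm H f = hnorm (Hm m E) f" if "f \<in> vecs H" for f
    using rkhs_inclusion[OF r r', of f] rkhs_inclusion[OF r' r, of f] that by force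
  have "bounded_ops H E = bounded_ops (Hm m E) E" using N by (auto simp: bounded_ops_def V)
  then show ?thesis using H(2) N unfolding uniformly_holomorphic_def V by simp
qed

context rkhs
begin

text \<open>Pairing f with the kernel function at w in the direction f(w) gives |f(w)|^2 <= |f| |k_w
  f(w)|, and the last norm is at most sqrt |k(w,w)| times |f(w)|.\<close>

lemma eval_bounded: "w \<in> unit_ball \<Longrightarrow> (\<lambda>f. f w) \<in> bounded_ops H E"
proof (rule bounded_opsI[where C = "sqrt (cmod (k w w))"])
  fix f assume w: "w \<in> unit_ball" and f: "f \<in> vecs H"
  have p: "(w, f w) \<in> pts E" using w f by auto
  have "(hnorm E (f w))\<^sup>2 = Re (ip H f (kerf k (w, f w)))"
    using ip_kerf[OF p f] f by (simp add: E.hnorm_sq)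
  also have "\<dots> \<le> hnorm H f * hnorm H (kerf k (w, f w))"
    using H.cauchy_schwarz[OF f kerf_mem[OF p]] complex_Re_le_cmod[of "ip H f (kerf k (w, f w))"] by linarith
  finally have 1: "(hnorm E (f w))\<^sup>2 \<le> hnorm H f * hnorm H (kerf k (w, f w))" .
  have "hnorm H (kerf k (w, f w)) \<le> sqrt (cmod (k w w)) * hnorm E (f w)"
  proof (rule power2_le_imp_le)
    have "(hnorm H (kerf k (w, f w)))\<^sup>2 = Re (k w w * of_real ((hnorm E (f w))\<^sup>2))"
      using ip_kerf_kerf[OF p p] kerf_mem[OF p] f by (simp add: H.hnorm_sq E.ip_self)
    also have "\<dots> \<le> cmod (k w w) * (hnorm E (f w))\<^sup>2"
      using complex_Re_le_cmod[of "k w w"] by (simp add: mult_right_mono)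
    finally show "(hnorm H (kerf k (w, f w)))\<^sup>2 \<le> (sqrt (cmod (k w w)) * hnorm E (f w))\<^sup>2"
      by (simp add: power_mult_distrib)
  qed (use f in auto)
  from order_trans[OF 1 mult_left_mono[OF this, of "hnorm H f"]]
  have "hnorm E (f w) * hnorm E (f w) \<le> (sqrt (cmod (k w w)) * hnorm H f) * hnorm E (f w)"
    using f by (simp add: power2_eq_square mult_ac)
  moreover have "0 \<le> sqrt (cmod (k w w)) * hnorm H f" using f by simp
  ultimately show "hnorm E (f w) \<le> sqrt (cmod (k w w)) * hnorm H f"
    using E.hnorm_nonneg[OF eval_mem[OF f, of w]] by (cases "hnorm E (f w) = 0") auto
qed auto

text \<open>\<Phi>(z) is evaluation at z after one fixed operator T, so it inherits the
  differentiability of evaluations in operator norm. Both factors of the factorization have this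
  shape: the transfer function and the evaluation symbol.\<close>

lemma holomorphic_in_op_norm:
  fixes D :: "'d::complex_vector hspace"
  assumes unif: "uniformly_holomorphic E H" and D: "hilbert_space D" and T: "T \<in> bounded_ops D H"
    and eq: "\<And>z e. z \<in> unit_ball \<Longrightarrow> e \<in> vecs D \<Longrightarrow> \<Phi> z e = T e z"
  shows "holomorphic_on_ball (bounded_ops D E) (op_norm D E) \<Phi>"
  unfolding holomorphic_on_ball_def
proof (intro conjI ballI)
  interpret D: hilbert_space D by fact
  note Tl = bounded_opsD[OF T]
  obtain C where C: "C > 0" "\<And>x. x \<in> vecs D \<Longrightarrow> hnorm H (T x) \<le> C * hnorm D x"
    using bounded_ops_bound[OF T D] by blast
  fix z :: "complex^'n" assume z: "z \<in> unit_ball"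
  have comp: "(\<lambda>e. T e z) \<in> bounded_ops D E"
    using bounded_ops_comp[OF T eval_bounded[OF z] D H.hilbert_space_axioms] .
  show "\<Phi> z \<in> bounded_ops D E"
    using comp z eq unfolding bounded_ops_def by simp
  from unif z obtain d where d0: "(\<forall>i. d i \<in> bounded_ops H E) \<and> (\<forall>e>0. \<exists>\<delta>>0. \<forall>w\<in>unit_ball. norm (w - z) < \<delta> \<longrightarrow> (\<forall>f\<in>vecs H.
        hnorm E (f w - f z - (\<Sum>i\<in>UNIV. (w $ i - z $ i) *\<^sub>C d i f)) \<le> e * norm (w - z) * hnorm H f))"
    unfolding uniformly_holomorphic_def by blast
  show "\<exists>d. (\<forall>i. d i \<in> bounded_ops D E) \<and> (\<forall>e>0. \<exists>\<delta>>0. \<forall>w\<in>unit_ball. norm (w - z) < \<delta> \<longrightarrow>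
      op_norm D E (\<Phi> w - \<Phi> z - (\<Sum>i\<in>UNIV. (w $ i - z $ i) *\<^sub>C d i)) \<le> e * norm (w - z))"
  proof (rule exI[of _ "\<lambda>i x. d i (T x)"], intro conjI allI impI)
    show "(\<lambda>x. d i (T x)) \<in> bounded_ops D E" for i
      using bounded_ops_comp[OF T _ D H.hilbert_space_axioms] d0 by blast
    fix e :: real assume e: "e > 0"
    have "e / C > 0" using e C by simp
    with d0 obtain \<delta> where \<delta>: "\<delta> > 0 \<and> (\<forall>w\<in>unit_ball. norm (w - z) < \<delta> \<longrightarrow> (\<forall>f\<in>vecs H.
        hnorm E (f w - f z - (\<Sum>i\<in>UNIV. (w $ i - z $ i) *\<^sub>C d i f)) \<le> e / C * norm (w - z) * hnorm H f))"
      by blast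
    have "op_norm D E (\<Phi> w - \<Phi> z - (\<Sum>i\<in>UNIV. (w $ i - z $ i) *\<^sub>C (\<lambda>x. d i (T x)))) \<le> e * norm (w - z)"
      if w: "w \<in> unit_ball" "norm (w - z) < \<delta>" for w
      unfolding op_norm_def
    proof (rule cSUP_least)
      have "(0::'d) \<in> {x \<in> vecs D. hnorm D x \<le> 1}" by simp
      then show "{x \<in> vecs D. hnorm D x \<le> 1} \<noteq> {}" by blast
      fix x assume "x \<in> {x \<in> vecs D. hnorm D x \<le> 1}"
      then have x: "x \<in> vecs D" "hnorm D x \<le> 1" by auto
      have "hnorm H (T x) \<le> C * hnorm D x" by (rule C(2)[OF x(1)])
      also have "\<dots> \<le> C * 1" using x C(1) by (intro mult_left_mono) auto
      finally have TC: "hnorm H (T x) \<le> C" by simp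
      have "hnorm E (T x w - T x z - (\<Sum>i\<in>UNIV. (w $ i - z $ i) *\<^sub>C d i (T x))) \<le> e / C * norm (w - z) * hnorm H (T x)"
        using \<delta> w Tl(1)[OF x(1)] by blast
      also have "\<dots> \<le> e / C * norm (w - z) * C"
        using TC e C(1) by (intro mult_left_mono) auto
      also have "\<dots> = e * norm (w - z)" using C(1) by simp
      finally show "hnorm E ((\<Phi> w - \<Phi> z - (\<Sum>i\<in>UNIV. (w $ i - z $ i) *\<^sub>C (\<lambda>x. d i (T x)))) x) \<le> e * norm (w - z)"
        using eq[OF w(1) x(1)] eq[OF z x(1)] by (simp add: sum_fun_apply)
    qed
    then show "\<exists>\<delta>>0. \<forall>w\<in>unit_ball. norm (w - z) < \<delta> \<longrightarrow>
        op_norm D E (\<Phi> w - \<Phi> z - (\<Sum>i\<in>UNIV. (w $ i - z $ i) *\<^sub>C (\<lambda>x. d i (T x)))) \<le> e * norm (w - z)"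
      using \<delta> by blast
  qed
qed

end

section \<open>Bounded Hermitian forms and the operator \<open>1 - \<sigma>\<close>\<close>

text \<open>In terms of forms, sigma is pullback along the T_i, which passes through an intertwining
  map by substitution. Conjugate symmetry supplies conjugate linearity in the second
  argument.\<close>

definition sform :: "'a::complex_vector hspace \<Rightarrow> ('a \<Rightarrow> 'a \<Rightarrow> complex) \<Rightarrow> bool" where
  "sform H B \<longleftrightarrow>
     (\<forall>f\<in>vecs H. \<forall>g\<in>vecs H. \<forall>h\<in>vecs H. B (f + g) h = B f h + B g h) \<and>
     (\<forall>c. \<forall>f\<in>vecs H. \<forall>g\<in>vecs H. B (c *\<^sub>C f) g = c * B f g) \<and>
     (\<forall>f\<in>vecs H. \<forall>g\<in>vecs H. B g f = cnj (B f g)) \<and>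
     (\<exists>C\<ge>0. \<forall>f\<in>vecs H. \<forall>g\<in>vecs H. cmod (B f g) \<le> C * (hnorm H f * hnorm H g))"

lemma sformD:
  assumes "sform H B"
  shows "\<And>f g h. f \<in> vecs H \<Longrightarrow> g \<in> vecs H \<Longrightarrow> h \<in> vecs H \<Longrightarrow> B (f + g) h = B f h + B g h"
    and "\<And>c f g. f \<in> vecs H \<Longrightarrow> g \<in> vecs H \<Longrightarrow> B (c *\<^sub>C f) g = c * B f g"
    and "\<And>f g. f \<in> vecs H \<Longrightarrow> g \<in> vecs H \<Longrightarrow> B g f = cnj (B f g)"
  using assms unfolding sform_def by blast+

lemma sform_bound:
  assumes "sform H B"
  obtains C where "C \<ge> 0" "\<And>f g. f \<in> vecs H \<Longrightarrow> g \<in> vecs H \<Longrightarrow> cmod (B f g) \<le> C * (hnorm H f * hnorm H g)"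
  using assms unfolding sform_def by blast

lemma sformI:
  assumes "\<And>f g h. f \<in> vecs H \<Longrightarrow> g \<in> vecs H \<Longrightarrow> h \<in> vecs H \<Longrightarrow> B (f + g) h = B f h + B g h"
    and "\<And>c f g. f \<in> vecs H \<Longrightarrow> g \<in> vecs H \<Longrightarrow> B (c *\<^sub>C f) g = c * B f g"
    and "\<And>f g. f \<in> vecs H \<Longrightarrow> g \<in> vecs H \<Longrightarrow> B g f = cnj (B f g)"
    and "C \<ge> 0" "\<And>f g. f \<in> vecs H \<Longrightarrow> g \<in> vecs H \<Longrightarrow> cmod (B f g) \<le> C * (hnorm H f * hnorm H g)"
  shows "sform H B"
  using assms unfolding sform_def by blast

context hilbert_space
begin

lemma sform_add_right:
  assumes B: "sform H B" and m: "f \<in> vecs H" "g \<in> vecs H" "h \<in> vecs H"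
  shows "B h (f + g) = B h f + B h g"
proof -
  have "B h (f + g) = cnj (B (f + g) h)" using m by (intro sformD(3)[OF B]) auto
  also have "\<dots> = cnj (B f h) + cnj (B g h)" using m by (simp add: sformD(1)[OF B])
  also have "cnj (B f h) = B h f" using sformD(3)[OF B m(1,3)] by simp
  also have "cnj (B g h) = B h g" using sformD(3)[OF B m(2,3)] by simp
  finally show ?thesis .
qed

lemma sform_scale_right:
  assumes B: "sform H B" and m: "f \<in> vecs H" "h \<in> vecs H"
  shows "B h (c *\<^sub>C f) = cnj c * B h f"
proof -
  have "B h (c *\<^sub>C f) = cnj (B (c *\<^sub>C f) h)" using m by (intro sformD(3)[OF B]) auto
  also have "\<dots> = cnj c * cnj (B f h)" using m by (simp add: sformD(2)[OF B])
  also have "cnj (B f h) = B h f" using sformD(3)[OF B m] by simp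
  finally show ?thesis .
qed

lemma sform_diff_left:
  "sform H B \<Longrightarrow> f \<in> vecs H \<Longrightarrow> g \<in> vecs H \<Longrightarrow> h \<in> vecs H \<Longrightarrow> B (f - g) h = B f h - B g h"
  using sformD(1)[of H B "f - g" g h] by simp

lemma sform_diff_right:
  "sform H B \<Longrightarrow> f \<in> vecs H \<Longrightarrow> g \<in> vecs H \<Longrightarrow> h \<in> vecs H \<Longrightarrow> B h (f - g) = B h f - B h g"
  using sform_add_right[of B "f - g" g h] by simp

lemma sform_zero_left: "sform H B \<Longrightarrow> h \<in> vecs H \<Longrightarrow> B 0 h = 0"
  using sformD(2)[of H B 0 h 0] by simp

lemma sform_zero_right: "sform H B \<Longrightarrow> h \<in> vecs H \<Longrightarrow> B h 0 = 0"
  using sform_scale_right[of B 0 h 0] by simp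

lemma sform_sum_list_left:
  "sform H B \<Longrightarrow> (\<And>p. p \<in> set l \<Longrightarrow> b p \<in> vecs H) \<Longrightarrow> h \<in> vecs H \<Longrightarrow> B (\<Sum>p\<leftarrow>l. b p) h = (\<Sum>p\<leftarrow>l. B (b p) h)"
  by (induction l) (auto simp: sform_zero_left sformD(1))

lemma sform_sum_list_right:
  "sform H B \<Longrightarrow> (\<And>p. p \<in> set l \<Longrightarrow> b p \<in> vecs H) \<Longrightarrow> h \<in> vecs H \<Longrightarrow> B h (\<Sum>p\<leftarrow>l. b p) = (\<Sum>p\<leftarrow>l. B h (b p))"
  by (induction l) (auto simp: sform_zero_right sform_add_right)

lemma sform_ip: "sform H (ip H)"
  by (rule sformI[where C = 1]) (auto simp: ip_linear intro: ip_commute cauchy_schwarz)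

lemma sform_diff:
  assumes "sform H A" "sform H B"
  shows "sform H (\<lambda>f g. A f g - B f g)"
proof -
  obtain C where C: "C \<ge> 0" "\<And>f g. f \<in> vecs H \<Longrightarrow> g \<in> vecs H \<Longrightarrow> cmod (A f g) \<le> C * (hnorm H f * hnorm H g)"
    using sform_bound[OF assms(1)] by blast
  obtain D where D: "D \<ge> 0" "\<And>f g. f \<in> vecs H \<Longrightarrow> g \<in> vecs H \<Longrightarrow> cmod (B f g) \<le> D * (hnorm H f * hnorm H g)"
    using sform_bound[OF assms(2)] by blast
  show ?thesis
  proof (rule sformI[where C = "C + D"])
    show "A g f - B g f = cnj (A f g - B f g)" if "f \<in> vecs H" "g \<in> vecs H" for f g
      using sformD(3)[OF assms(1) that] sformD(3)[OF assms(2) that] by simp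
    show "cmod (A f g - B f g) \<le> (C + D) * (hnorm H f * hnorm H g)" if "f \<in> vecs H" "g \<in> vecs H" for f g
      using C(2)[OF that] D(2)[OF that] norm_triangle_ineq4[of "A f g" "B f g"] by (simp add: algebra_simps)
  qed (use C D in \<open>auto simp: sformD(1,2)[OF assms(1)] sformD(1,2)[OF assms(2)] algebra_simps\<close>)
qed

lemma sform_comp:
  assumes L: "L \<in> bounded_ops H K" and B: "sform K B" and K: "hilbert_space K"
  shows "sform H (\<lambda>f g. B (L f) (L g))"
proof -
  interpret K: hilbert_space K by fact
  note Ll = bounded_opsD[OF L]
  obtain C where C: "C \<ge> 0" "\<And>f g. f \<in> vecs K \<Longrightarrow> g \<in> vecs K \<Longrightarrow> cmod (B f g) \<le> C * (hnorm K f * hnorm K g)"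
    using sform_bound[OF B] by blast
  obtain D where D: "D > 0" "\<And>f. f \<in> vecs H \<Longrightarrow> hnorm K (L f) \<le> D * hnorm H f"
    using bounded_ops_bound[OF L hilbert_space_axioms] by blast
  show ?thesis
  proof (rule sformI[where C = "C * (D * D)"])
    show "B (L g) (L f) = cnj (B (L f) (L g))" if "f \<in> vecs H" "g \<in> vecs H" for f g
      using that by (intro sformD(3)[OF B] Ll)
    show "cmod (B (L f) (L g)) \<le> C * (D * D) * (hnorm H f * hnorm H g)" if "f \<in> vecs H" "g \<in> vecs H" for f g
    proof -
      have "hnorm K (L f) * hnorm K (L g) \<le> (D * hnorm H f) * (D * hnorm H g)"
        using D that Ll by (intro mult_mono) auto
      from mult_left_mono[OF this C(1)] have "C * (hnorm K (L f) * hnorm K (L g)) \<le> C * (D * D) * (hnorm H f * hnorm H g)"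
        by (simp add: mult_ac)
      then show ?thesis using C(2)[OF Ll(1) Ll(1)] that by (meson order_trans)
    qed
  qed (use C D Ll sformD(1,2)[OF B] in auto)
qed

end

definition Delta :: "('n::finite \<Rightarrow> 'a \<Rightarrow> 'a) \<Rightarrow> ('a \<Rightarrow> 'a \<Rightarrow> complex) \<Rightarrow> 'a \<Rightarrow> 'a \<Rightarrow> complex" where
  "Delta T B f g = B f g - (\<Sum>i\<in>UNIV. B (T i f) (T i g))"

text \<open>\<open>Delta\<close> only substitutes T_i f and T_i g, so an intertwining L moves
  through every iteration. This carries forms from Q2 to a space in which kernel functions are
  available.\<close>

lemma Delta_intertwine:
  assumes "\<And>f i. f \<in> Q \<Longrightarrow> T i f \<in> Q" "\<And>f i. f \<in> Q \<Longrightarrow> L (T i f) = T' i (L f)"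
    and "\<And>f g. f \<in> Q \<Longrightarrow> g \<in> Q \<Longrightarrow> B f g = B' (L f) (L g)"
    and "f \<in> Q" "g \<in> Q"
  shows "(Delta T ^^ j) B f g = (Delta T' ^^ j) B' (L f) (L g)"
  using assms(4,5) by (induction j arbitrary: f g) (auto simp: Delta_def assms(1-3))

lemma Delta_power_diff:
  "(Delta T ^^ j) (\<lambda>f g. A f g - B f g) = (\<lambda>f g. (Delta T ^^ j) A f g - (Delta T ^^ j) B f g)"
  by (induction j) (auto simp: Delta_def fun_eq_iff sum_subtractf)

lemma (in hilbert_space) sform_Delta_power:
  assumes T: "\<And>i. contraction H H (T i)" and B: "sform H B"
  shows "sform H ((Delta T ^^ j) B)"
proof (induction j)
  case (Suc j)
  let ?B = "(Delta T ^^ j) B"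
  have "sform H (\<lambda>f g. \<Sum>i\<in>I. ?B (T i f) (T i g))" if "finite I" for I
    using that
  proof (induction I)
    case empty
    show ?case by (rule sformI[where C = 0]) auto
  next
    case (insert i I)
    have "sform H (\<lambda>f g. ?B (T i f) (T i g))"
      by (rule sform_comp[OF contractionD(1)[OF T] Suc hilbert_space_axioms])
    moreover have "sform H (\<lambda>f g. 0)" by (rule sformI[where C = 0]) auto
    ultimately have "sform H (\<lambda>f g. ?B (T i f) (T i g) - (0 - (\<Sum>i\<in>I. ?B (T i f) (T i g))))"
      using insert.IH by (intro sform_diff)
    then show ?case using insert.hyps by simp
  qed
  from sform_diff[OF Suc this[of UNIV]] show ?case by (simp add: Delta_def[abs_def])
qed (use B in simp)

text \<open>The sum of b(T_u f) over the words u of length N, in recursive form.\<close>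

primrec iter_sum :: "('n::finite \<Rightarrow> 'a \<Rightarrow> 'a) \<Rightarrow> ('a \<Rightarrow> real) \<Rightarrow> nat \<Rightarrow> 'a \<Rightarrow> real" where
  "iter_sum T b 0 f = b f"
| "iter_sum T b (Suc N) f = (\<Sum>i\<in>UNIV. iter_sum T b N (T i f))"

section \<open>Coordinate multipliers\<close>

locale bergman = rkhs E "kpow m" H
  for E :: "'e::complex_vector hspace" and m :: nat and H :: "(complex^'n \<Rightarrow> 'e) hspace" +
  assumes m: "1 \<le> m"
begin

abbreviation "k0 p q \<equiv> ip E (snd p) (snd q)"

lemma homogeneous_k0: "homogeneous E (\<lambda>p q. k0 p q)"
  by (rule E.homogeneous_gram) auto

lemma psd_k0: "psd (pts E) (\<lambda>p q. k0 p q)"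
  by (rule E.psd_gram) auto

lemma psd_kpow: "psd (pts E) (\<lambda>p q. kpow j (fst q) (fst p) * k0 p q)"
  by (rule E.psd_geometric_power[OF psd_k0 homogeneous_k0])

lemma kpow_mult_cdot:
  assumes "p \<in> pts E" "q \<in> pts E"
  shows "(1 - cdot (fst q) (fst p)) ^ j * kpow (i + j) (fst q) (fst p) = kpow i (fst q) (fst p)"
  using cdot_ne_1[of "fst q" "fst p"] assms by (auto simp: power_add)

text \<open>The row of adjoints is prescribed on kernel functions as k_p -> (cnj(w_i) k_p)_i. Its
  defect kernel is 1 - <z,w> times the kernel of exponent m, that is, the kernel of exponent m - 1,
  which is positive. Multiplication by z_i is recognised as an adjoint of an entry of this row,
  which yields its boundedness.\<close>

lemma coordinate_facts:
  obtains T where "contraction H (l2_hspace H) T"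
    "\<And>p i. p \<in> pts E \<Longrightarrow> T (kerf (kpow m) p) i = cnj (fst p $ i) *\<^sub>C kerf (kpow m) p"
    "\<And>i f. f \<in> vecs H \<Longrightarrow> mult_coord i f = adj H H (\<lambda>f. T f i) f"
    "\<And>i. (\<lambda>f. T f (i :: 'n)) \<in> bounded_ops H H"
proof -
  interpret L: hilbert_space "l2_hspace H :: ('n \<Rightarrow> complex^'n \<Rightarrow> 'e) hspace" by (rule H.l2_hilbert)
  let ?k = "kerf (kpow m) :: (complex^'n) \<times> 'e \<Rightarrow> complex^'n \<Rightarrow> 'e"
  obtain T where T: "contraction H (l2_hspace H :: ('n \<Rightarrow> complex^'n \<Rightarrow> 'e) hspace) T"
      "\<And>p. p \<in> pts E \<Longrightarrow> T (?k p) = (\<lambda>i. cnj (fst p $ i) *\<^sub>C ?k p)"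
  proof (rule contraction_from_kernels[of "l2_hspace H" "\<lambda>p i. cnj (fst p $ i) *\<^sub>C ?k p"])
    show "hilbert_space (l2_hspace H :: ('n \<Rightarrow> complex^'n \<Rightarrow> 'e) hspace)" by (rule H.l2_hilbert)
    show "(\<lambda>i. cnj (fst p $ i) *\<^sub>C ?k p) \<in> vecs (l2_hspace H)" if "p \<in> pts E" for p :: "(complex^'n) \<times> 'e"
      using kerf_mem[OF that] by (simp add: vecs_l2_finite)
    show "(\<lambda>i. cnj (fst (sc c p) $ i) *\<^sub>C ?k (sc c p)) = c *\<^sub>C (\<lambda>i. cnj (fst p $ i) *\<^sub>C ?k p)" if "p \<in> pts E" for p :: "(complex^'n) \<times> 'e" and c
      by (simp add: kerf_sc fun_eq_iff scaleC_scaleC mult.commute)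
    \<comment> \<open>For m = 1 the exponent m - 1 = 0 leaves the constant kernel 1, which is
      positive as well.\<close>
    have *: "kpow m (fst q) (fst p) * k0 p q - ip (l2_hspace H) (\<lambda>i. cnj (fst p $ i) *\<^sub>C ?k p) (\<lambda>i. cnj (fst q $ i) *\<^sub>C ?k q)
        = kpow (m - 1) (fst q) (fst p) * k0 p q" if p: "p \<in> pts E" and q: "q \<in> pts E" for p q :: "(complex^'n) \<times> 'e"
    proof -
      have "ip (l2_hspace H) (\<lambda>i. cnj (fst p $ i) *\<^sub>C ?k p) (\<lambda>i. cnj (fst q $ i) *\<^sub>C ?k q)
          = cdot (fst q) (fst p) * (kpow m (fst q) (fst p) * k0 p q)"
      proof -
        define c where "c = kpow m (fst q) (fst p) * k0 p q"
        have "ip H (?k p) (?k q) = c" unfolding c_def by (rule ip_kerf_kerf[OF p q])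
        then have "ip (l2_hspace H) (\<lambda>i. cnj (fst p $ i) *\<^sub>C ?k p) (\<lambda>i. cnj (fst q $ i) *\<^sub>C ?k q)
            = (\<Sum>i\<in>UNIV. fst q $ i * cnj (fst p $ i)) * c"
          using kerf_mem[OF p] kerf_mem[OF q] by (simp add: ip_l2_finite H.ip_linear sum_distrib_left sum_distrib_right mult_ac)
        then show ?thesis by (simp only: c_def cdot_def)
      qed
      then have "kpow m (fst q) (fst p) * k0 p q - ip (l2_hspace H) (\<lambda>i. cnj (fst p $ i) *\<^sub>C ?k p) (\<lambda>i. cnj (fst q $ i) *\<^sub>C ?k q)
          = ((1 - cdot (fst q) (fst p)) ^ 1 * kpow (m - 1 + 1) (fst q) (fst p)) * k0 p q"
        using m by (simp only: power_one_right left_diff_distrib mult_1 mult.assoc le_add_diff_inverse2)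
      then show ?thesis unfolding kpow_mult_cdot[OF p q] .
    qed
    show "psd (pts E) (\<lambda>p q. kpow m (fst q) (fst p) * k0 p q - ip (l2_hspace H) (\<lambda>i. cnj (fst p $ i) *\<^sub>C ?k p) (\<lambda>i. cnj (fst q $ i) *\<^sub>C ?k q))"
      by (rule psd_cong[OF * psd_kpow])
  qed blast
  note Tl = bounded_opsD[OF contractionD(1)[OF T(1)]]
  have Ti: "(\<lambda>f. T f i) \<in> bounded_ops H H" for i
  proof (rule bounded_opsI[where C = 1])
    fix f assume f: "f \<in> vecs H"
    show "T f i \<in> vecs H" using Tl(1)[OF f] by (simp add: vecs_l2_finite)
    show "hnorm H (T f i) \<le> 1 * hnorm H f"
      using H.l2_coord_le[OF Tl(1)[OF f], of i] contractionD(2)[OF T(1) f] by simp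
  qed (auto simp: Tl)
  have mc: "mult_coord i f = adj H H (\<lambda>f. T f i) f" if f: "f \<in> vecs H" for i f
  proof
    interpret Ti: bounded_op H H "\<lambda>f. T f i" using Ti by unfold_locales
    fix w show "mult_coord i f w = adj H H (\<lambda>f. T f i) f w"
    proof (cases "w \<in> unit_ball")
      case True
      show ?thesis
      proof (rule E.ip_eqI_left)
        fix y assume y: "y \<in> vecs E"
        have p: "(w, y) \<in> pts E" using True y by blast
        have "ip E (adj H H (\<lambda>f. T f i) f w) y = ip H f (T (?k (w, y)) i)"
          using ip_kerf[OF p Ti.adj_mem[OF f]] Ti.ip_adj_left[OF f kerf_mem[OF p]] by simp
        also have "\<dots> = w $ i * ip E (f w) y"
          using ip_kerf[OF p f] kerf_mem[OF p] f by (simp add: T(2)[OF p] H.ip_linear)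
        finally show "ip E (mult_coord i f w) y = ip E (adj H H (\<lambda>f. T f i) f w) y"
          using f y by (simp add: mult_coord_def E.ip_linear)
      qed (use f Ti.adj_mem[OF f] in \<open>auto simp: mult_coord_def\<close>)
    qed (use outside[OF f] outside[OF Ti.adj_mem[OF f]] in \<open>auto simp: mult_coord_def\<close>)
  qed
  show ?thesis by (rule that[OF T(1) _ mc Ti]) (simp add: T(2))
qed

definition Ms :: "'n \<Rightarrow> (complex^'n \<Rightarrow> 'e) \<Rightarrow> complex^'n \<Rightarrow> 'e" where
  "Ms i = adj H H (mult_coord i)"

lemma Ms_facts:
  shows mult_coord_bounded: "mult_coord i \<in> bounded_ops H H"
    and Ms_kerf: "p \<in> pts E \<Longrightarrow> Ms i (kerf (kpow m) p) = cnj (fst p $ i) *\<^sub>C kerf (kpow m) p"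
    and Ms_row: "f \<in> vecs H \<Longrightarrow> (\<Sum>i\<in>UNIV. (hnorm H (Ms i f))\<^sup>2) \<le> (hnorm H f)\<^sup>2"
proof -
  obtain T where T: "contraction H (l2_hspace H) T"
    "\<And>p i. p \<in> pts E \<Longrightarrow> T (kerf (kpow m) p) i = cnj (fst p $ i) *\<^sub>C kerf (kpow m) p"
    "\<And>i f. f \<in> vecs H \<Longrightarrow> mult_coord i f = adj H H (\<lambda>f. T f i) f"
    "\<And>i. (\<lambda>f. T f (i :: 'n)) \<in> bounded_ops H H"
    using coordinate_facts by blast
  have b: "bounded_op H H (\<lambda>f. T f i)" for i using T(4) by (intro bounded_opI) unfold_locales
  have mb: "mult_coord i \<in> bounded_ops H H" for i
    using bounded_op.adj_bounded[OF b, of i] T(3) unfolding bounded_ops_def by simp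
  then show "mult_coord i \<in> bounded_ops H H" .
  have MT: "Ms i f = T f i" if f: "f \<in> vecs H" for i f
  proof -
    interpret M: bounded_op H H "mult_coord i" using mb by unfold_locales
    show ?thesis unfolding Ms_def
      using f bounded_opsD(1)[OF T(4)] T(3) bounded_op.ip_adj_left[OF b]
      by (intro M.adj_eqI) auto
  qed
  show "p \<in> pts E \<Longrightarrow> Ms i (kerf (kpow m) p) = cnj (fst p $ i) *\<^sub>C kerf (kpow m) p"
    using T(2) MT kerf_mem by metis
  show "(\<Sum>i\<in>UNIV. (hnorm H (Ms i f))\<^sup>2) \<le> (hnorm H f)\<^sup>2" if f: "f \<in> vecs H"
  proof -
    have Tf: "T f \<in> vecs (l2_hspace H)" by (rule bounded_opsD(1)[OF contractionD(1)[OF T(1)] f])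
    interpret L: hilbert_space "l2_hspace H :: ('n \<Rightarrow> complex^'n \<Rightarrow> 'e) hspace" by (rule H.l2_hilbert)
    have "(hnorm (l2_hspace H) (T f))\<^sup>2 \<le> (hnorm H f)\<^sup>2"
      using contractionD(2)[OF T(1) f] Tf by (intro power_mono) auto
    then show ?thesis using H.hnorm_l2_finite_sq[of "T f"] Tf by (simp add: MT[OF f] vecs_l2_finite)
  qed
qed

lemma mult_coord_op: "bounded_op H H (mult_coord i)"
  using mult_coord_bounded by (intro bounded_opI) unfold_locales

lemma Ms_mem [simp]: "f \<in> vecs H \<Longrightarrow> Ms i f \<in> vecs H"
  unfolding Ms_def by (rule bounded_op.adj_mem[OF mult_coord_op])

lemma ip_Ms: "f \<in> vecs H \<Longrightarrow> g \<in> vecs H \<Longrightarrow> ip H g (Ms i f) = ip H (mult_coord i g) f"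
  unfolding Ms_def by (rule bounded_op.ip_adj[OF mult_coord_op])

lemma Ms_contraction: "contraction H H (Ms i)"
proof -
  have "hnorm H (Ms i f) \<le> hnorm H f" if f: "f \<in> vecs H" for f
  proof (rule power2_le_imp_le)
    have "(hnorm H (Ms i f))\<^sup>2 \<le> (\<Sum>i\<in>UNIV. (hnorm H (Ms i f))\<^sup>2)"
      by (rule member_le_sum) auto
    then show "(hnorm H (Ms i f))\<^sup>2 \<le> (hnorm H f)\<^sup>2" using Ms_row[OF f] by linarith
  qed (use f in auto)
  then show ?thesis
    unfolding contraction_def Ms_def using bounded_op.adj_bounded[OF mult_coord_op] by blast
qed

lemmas Ms_linear = bounded_opsD(2,3)[OF contractionD(1)[OF Ms_contraction]]
  bounded_ops_diff[OF contractionD(1)[OF Ms_contraction] H.hilbert_space_axioms]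

text \<open>Kernel functions are joint eigenvectors of the T_i with eigenvalues cnj(w_i), and a form
  is linear in its first and conjugate linear in its second argument.\<close>

lemma Delta_kerf:
  assumes B: "sform H B" and p: "p \<in> pts E" and q: "q \<in> pts E"
  shows "(Delta Ms ^^ j) B (kerf (kpow m) p) (kerf (kpow m) q) =
    (1 - cdot (fst q) (fst p)) ^ j * B (kerf (kpow m) p) (kerf (kpow m) q)"
proof (induction j)
  case (Suc j)
  let ?B = "(Delta Ms ^^ j) B" and ?p = "kerf (kpow m) p" and ?q = "kerf (kpow m) q"
  have sf: "sform H ?B" by (rule H.sform_Delta_power[OF Ms_contraction B])
  have "(Delta Ms ^^ Suc j) B ?p ?q = ?B ?p ?q - (\<Sum>i\<in>UNIV. fst q $ i * cnj (fst p $ i) * ?B ?p ?q)"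
    using kerf_mem[OF p] kerf_mem[OF q]
    by (simp add: Delta_def Ms_kerf[OF p] Ms_kerf[OF q] sformD(2)[OF sf] H.sform_scale_right[OF sf] mult_ac)
  also have "\<dots> = (1 - cdot (fst q) (fst p)) * ?B ?p ?q"
    by (simp add: cdot_def sum_distrib_right left_diff_distrib)
  finally show ?case using Suc by simp
qed simp

text \<open>On the span of the kernel functions positivity is the kernel condition, and boundedness
  of the form carries it to the closure. Kernel functions must lie in the domain, so this test is
  made on a full space and not on Q2.\<close>

lemma sform_nonneg:
  assumes B: "sform H B" and psd: "psd (pts E) (\<lambda>p q. B (kerf (kpow m) p) (kerf (kpow m) q))" and f: "f \<in> vecs H"
  shows "0 \<le> Re (B f f)"
proof -
  let ?k = "kerf (kpow m)"
  obtain C where C: "C \<ge> 0" "\<And>f g. f \<in> vecs H \<Longrightarrow> g \<in> vecs H \<Longrightarrow> cmod (B f g) \<le> C * (hnorm H f * hnorm H g)"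
    using sform_bound[OF B] by blast
  have comb0: "0 \<le> Re (B (comb l) (comb l))" if l: "set l \<subseteq> pts E" for l
  proof -
    have km: "?k p \<in> vecs H" if "p \<in> set l" for p using l kerf_mem that by blast
    have "B (comb l) (comb l) = (\<Sum>p\<leftarrow>l. B (?k p) (comb l))"
      unfolding comb_def using km by (intro H.sform_sum_list_left[OF B]) auto
    also have "\<dots> = (\<Sum>p\<leftarrow>l. \<Sum>q\<leftarrow>l. B (?k p) (?k q))"
      unfolding comb_def using km by (intro sum_list_cong_set H.sform_sum_list_right[OF B]) auto
    finally show ?thesis using psd l unfolding psd_def by simp
  qed
  have bound: "- (C * (2 * hnorm H f + 1) * e) \<le> Re (B f f)" if e: "0 < e" "e \<le> 1" for e
  proof -
    obtain l where l: "set l \<subseteq> pts E" "hnorm H (f - comb l) < e" using comb_dense[OF f e(1)] by blast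
    define c where "c = comb l"
    have c: "c \<in> vecs H" using comb_mem[OF l(1)] by (simp add: c_def)
    have cn: "hnorm H c \<le> hnorm H f + 1"
      using H.hnorm_triangle_abs[OF f c] l(2) e(2) by (simp add: c_def)
    have "B f f = B c c + B (f - c) c + B f (f - c)"
      using f c by (simp add: H.sform_diff_left[OF B] H.sform_diff_right[OF B])
    moreover have "cmod (B (f - c) c) \<le> C * (e * (hnorm H f + 1))"
    proof -
      have "hnorm H (f - c) * hnorm H c \<le> e * (hnorm H f + 1)"
        using l(2) cn c f e by (intro mult_mono) (auto simp: c_def)
      from mult_left_mono[OF this C(1)] show ?thesis using C(2)[of "f - c" c] f c by simp
    qed
    moreover have "cmod (B f (f - c)) \<le> C * (e * hnorm H f)"
    proof -
      have "hnorm H f * hnorm H (f - c) \<le> hnorm H f * e"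
        using l(2) f by (intro mult_left_mono) (auto simp: c_def)
      from mult_left_mono[OF this C(1)] show ?thesis using C(2)[of f "f - c"] f c by (simp add: mult.commute)
    qed
    moreover have "- cmod z \<le> Re z" for z using abs_Re_le_cmod[of z] by linarith
    moreover have "0 \<le> Re (B c c)" using comb0[OF l(1)] by (simp add: c_def)
    ultimately have "- (C * (e * (hnorm H f + 1))) - C * (e * hnorm H f) \<le> Re (B f f)"
      by (smt (verit) plus_complex.sel(1))
    then show ?thesis by (simp add: algebra_simps)
  qed
  show ?thesis
  proof (rule ccontr)
    assume neg: "\<not> 0 \<le> Re (B f f)"
    define D where "D = C * (2 * hnorm H f + 1)"
    have D: "D \<ge> 0" using C(1) f by (simp add: D_def)
    \<comment> \<open>Small enough that the error D e is at most half of - Re (B f f); the minimum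
      with 1 respects the range of \<open>bound\<close>.\<close>
    define e where "e = min 1 (- Re (B f f) / (2 * (D + 1)))"
    have e: "0 < e" "e \<le> 1" using neg D by (auto simp: e_def divide_neg_pos)
    have "D * e \<le> (D + 1) * e" using e by simp
    also have "\<dots> \<le> (D + 1) * (- Re (B f f) / (2 * (D + 1)))"
      using D by (intro mult_left_mono) (auto simp: e_def)
    also have "\<dots> = - Re (B f f) / 2" using D by (simp add: field_simps)
    finally show False using bound[OF e] neg by (simp add: D_def)
  qed
qed

lemma kerf_at_0: "kerf (kpow m) p 0 = snd p"
  by (simp add: kerf_def cdot_def scaleC_one)

text \<open>On kernel functions the m factors 1 - <z,w> cancel the kernel and leave the inner
  product of the vectors, which are also the values at 0. Two bounded forms that agree on kernel
  functions have both differences nonnegative, hence the same quadratic form.\<close>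

lemma Delta_ip:
  assumes f: "f \<in> vecs H"
  shows "Re ((Delta Ms ^^ m) (ip H) f f) = (hnorm E (f 0))\<^sup>2"
proof -
  let ?A = "(Delta Ms ^^ m) (ip H)" and ?B = "\<lambda>f g. ip E (f 0) (g 0)"
  have A: "sform H ?A" by (rule H.sform_Delta_power[OF Ms_contraction H.sform_ip])
  have B: "sform H ?B" using eval_bounded[of 0] by (intro H.sform_comp[OF _ E.sform_ip]) (auto, unfold_locales)
  have eq: "?A (kerf (kpow m) p) (kerf (kpow m) q) = ?B (kerf (kpow m) p) (kerf (kpow m) q)"
    if "p \<in> pts E" "q \<in> pts E" for p q :: "(complex^'n) \<times> 'e"
  proof -
    have "?A (kerf (kpow m) p) (kerf (kpow m) q)
        = (1 - cdot (fst q) (fst p)) ^ m * kpow (0 + m) (fst q) (fst p) * k0 p q"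
      by (simp only: Delta_kerf[OF H.sform_ip that] ip_kerf_kerf[OF that] mult.assoc add_0)
    then show ?thesis unfolding kpow_mult_cdot[OF that] by (simp add: kerf_at_0)
  qed
  have "psd (pts E) (\<lambda>p q. ?A (kerf (kpow m) p) (kerf (kpow m) q) - ?B (kerf (kpow m) p) (kerf (kpow m) q))"
    "psd (pts E) (\<lambda>p q. ?B (kerf (kpow m) p) (kerf (kpow m) q) - ?A (kerf (kpow m) p) (kerf (kpow m) q))"
    by (rule psd_cong[where K' = "\<lambda>p q. 0"]; simp add: eq psd_def)+
  from sform_nonneg[OF H.sform_diff[OF A B] this(1) f] sform_nonneg[OF H.sform_diff[OF B A] this(2) f]
  show ?thesis using f by (simp add: E.hnorm_sq)
qed

section \<open>Purity of the adjoint coordinate tuple\<close>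

abbreviation "nsq f \<equiv> (hnorm H f)\<^sup>2"

lemma iter_nonneg: "f \<in> vecs H \<Longrightarrow> 0 \<le> iter_sum Ms nsq N f"
  by (induction N arbitrary: f) (auto intro!: sum_nonneg)

lemma iter_le: "f \<in> vecs H \<Longrightarrow> iter_sum Ms nsq N f \<le> nsq f"
proof (induction N arbitrary: f)
  case (Suc N)
  then have "iter_sum Ms nsq (Suc N) f \<le> (\<Sum>i\<in>UNIV. nsq (Ms i f))" by (auto intro!: sum_mono)
  then show ?case using Ms_row[OF Suc.prems] by linarith
qed simp

lemma iter_add: "f \<in> vecs H \<Longrightarrow> g \<in> vecs H \<Longrightarrow>
    iter_sum Ms nsq N (f + g) \<le> 2 * iter_sum Ms nsq N f + 2 * iter_sum Ms nsq N g"
proof (induction N arbitrary: f g)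
  case (Suc N)
  have "iter_sum Ms nsq N (Ms i (f + g)) \<le> 2 * iter_sum Ms nsq N (Ms i f) + 2 * iter_sum Ms nsq N (Ms i g)" for i
    unfolding Ms_linear(1)[OF Suc.prems] using Suc.prems by (intro Suc.IH) simp_all
  then have "iter_sum Ms nsq (Suc N) (f + g) \<le> (\<Sum>i\<in>UNIV. 2 * iter_sum Ms nsq N (Ms i f) + 2 * iter_sum Ms nsq N (Ms i g))"
    unfolding iter_sum.simps by (intro sum_mono)
  also have "\<dots> = 2 * iter_sum Ms nsq (Suc N) f + 2 * iter_sum Ms nsq (Suc N) g"
    by (simp only: iter_sum.simps sum.distrib sum_distrib_left)
  finally show ?case .
qed (simp add: H.hnorm_add_sq_le)

lemma Ms_comb:
  assumes "set l \<subseteq> pts E"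
  shows "Ms i (comb l) = comb (map (\<lambda>p. sc (cnj (fst p $ i)) p) l)"
    and "set (map (\<lambda>p. sc (cnj (fst p $ i)) p) l) \<subseteq> pts E"
proof -
  have "Ms i (comb l) = (\<Sum>p\<leftarrow>l. Ms i (kerf (kpow m) p))"
    unfolding comb_def using assms kerf_mem
    by (intro bounded_ops_sum_list[OF contractionD(1)[OF Ms_contraction]]) (auto, unfold_locales)
  also have "\<dots> = (\<Sum>p\<leftarrow>l. kerf (kpow m) (sc (cnj (fst p $ i)) p))"
  proof (rule sum_list_cong_set)
    fix p assume "p \<in> set l"
    then have "p \<in> pts E" using assms by blast
    then show "Ms i (kerf (kpow m) p) = kerf (kpow m) (sc (cnj (fst p $ i)) p)" by (simp only: Ms_kerf kerf_sc)
  qed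
  finally show "Ms i (comb l) = comb (map (\<lambda>p. sc (cnj (fst p $ i)) p) l)" by (simp add: comb_def o_def)
  show "set (map (\<lambda>p. sc (cnj (fst p $ i)) p) l) \<subseteq> pts E"
  proof
    fix q assume "q \<in> set (map (\<lambda>p. sc (cnj (fst p $ i)) p) l)"
    then obtain p where "p \<in> set l" "q = sc (cnj (fst p $ i)) p" by auto
    then show "q \<in> pts E" using assms E.sc_pts by blast
  qed
qed

lemma iter_comb: "set l \<subseteq> pts E \<Longrightarrow>
    iter_sum Ms nsq N (comb l) = Re (\<Sum>p\<leftarrow>l. \<Sum>q\<leftarrow>l. cdot (fst q) (fst p) ^ N * (kpow m (fst q) (fst p) * k0 p q))"
proof (induction N arbitrary: l)
  case 0
  then show ?case using comb_norm_sq[OF 0] by simp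
next
  case (Suc N)
  let ?s = "\<lambda>i p. sc (cnj (fst p $ i)) p" and ?K = "\<lambda>p q. cdot (fst q) (fst p) ^ N * (kpow m (fst q) (fst p) * k0 p q)"
  have "iter_sum Ms nsq (Suc N) (comb l) = (\<Sum>i\<in>UNIV. Re (\<Sum>p\<leftarrow>map (?s i) l. \<Sum>q\<leftarrow>map (?s i) l. ?K p q))"
    unfolding iter_sum.simps Ms_comb(1)[OF Suc.prems]
    by (intro sum.cong refl Suc.IH[OF Ms_comb(2)[OF Suc.prems]])
  also have "\<dots> = Re (\<Sum>i\<in>UNIV. \<Sum>p\<leftarrow>l. \<Sum>q\<leftarrow>l. ?K (?s i p) (?s i q))"
    by (simp add: o_def)
  also have "(\<Sum>i\<in>UNIV. \<Sum>p\<leftarrow>l. \<Sum>q\<leftarrow>l. ?K (?s i p) (?s i q)) = (\<Sum>p\<leftarrow>l. \<Sum>q\<leftarrow>l. \<Sum>i\<in>UNIV. ?K (?s i p) (?s i q))"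
    by (simp only: sum_sum_list_swap)
  also have "\<dots> = (\<Sum>p\<leftarrow>l. \<Sum>q\<leftarrow>l. cdot (fst q) (fst p) ^ Suc N * (kpow m (fst q) (fst p) * k0 p q))"
  proof (intro sum_list_cong_set)
    fix p q assume "p \<in> set l" "q \<in> set l"
    then have "snd p \<in> vecs E" "snd q \<in> vecs E" using Suc.prems by auto
    then have "?K (?s i p) (?s i q) = fst q $ i * cnj (fst p $ i) * ?K p q" for i
      by (simp add: E.ip_linear)
    then have "(\<Sum>i\<in>UNIV. ?K (?s i p) (?s i q)) = (\<Sum>i\<in>UNIV. fst q $ i * cnj (fst p $ i)) * ?K p q"
      by (simp only: sum_distrib_right)
    then show "(\<Sum>i\<in>UNIV. ?K (?s i p) (?s i q)) = cdot (fst q) (fst p) ^ Suc N * (kpow m (fst q) (fst p) * k0 p q)"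
      by (simp add: cdot_def mult.assoc)
  qed
  finally show ?case .
qed

text \<open>For a finite combination of kernel functions the sum is a finite double sum with factors
  <z,w>^N, which tend to 0. The approximation error is controlled uniformly in N by
  \<open>iter_le\<close>.\<close>

lemma purity:
  assumes f: "f \<in> vecs H"
  shows "(\<lambda>N. iter_sum Ms nsq N f) \<longlonglongrightarrow> 0"
proof (rule LIMSEQ_I)
  fix r :: real assume r: "r > 0"
  \<comment> \<open>By \<open>iter_add\<close> both the combination and the error count twice, each
    with less than r / 4.\<close>
  define e where "e = sqrt (r / 4)"
  have e: "e > 0" "e\<^sup>2 = r / 4" using r by (auto simp: e_def)
  obtain l where l: "set l \<subseteq> pts E" "hnorm H (f - comb l) < e" using comb_dense[OF f e(1)] by blast
  have c: "comb l \<in> vecs H" by (rule comb_mem[OF l(1)])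
  have "(\<lambda>N. Re (\<Sum>p\<leftarrow>l. \<Sum>q\<leftarrow>l. cdot (fst q) (fst p) ^ N * (kpow m (fst q) (fst p) * k0 p q)))
      \<longlonglongrightarrow> Re (\<Sum>p\<leftarrow>l. \<Sum>q\<leftarrow>l. 0)"
  proof (intro tendsto_Re tendsto_sum_list tendsto_mult_left_zero)
    fix p q assume "p \<in> set l" "q \<in> set l"
    then have "cmod (cdot (fst q) (fst p)) < 1" using l(1) by (intro cdot_less_1) auto
    then show "(\<lambda>N. cdot (fst q) (fst p) ^ N) \<longlonglongrightarrow> 0" by (rule LIMSEQ_power_zero)
  qed
  then have "(\<lambda>N. iter_sum Ms nsq N (comb l)) \<longlonglongrightarrow> 0"
    by (simp add: iter_comb[OF l(1)])
  from LIMSEQ_D[OF this, of "r / 4"] r obtain M where M: "\<And>N. N \<ge> M \<Longrightarrow> \<bar>iter_sum Ms nsq N (comb l)\<bar> < r / 4" by auto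
  have "norm (iter_sum Ms nsq N f - 0) < r" if N: "N \<ge> M" for N
  proof -
    have "iter_sum Ms nsq N (comb l + (f - comb l)) \<le> 2 * iter_sum Ms nsq N (comb l) + 2 * iter_sum Ms nsq N (f - comb l)"
      using c f by (intro iter_add) auto
    moreover have "iter_sum Ms nsq N (f - comb l) \<le> nsq (f - comb l)" using c f by (intro iter_le) auto
    moreover have "nsq (f - comb l) < e\<^sup>2" using l(2) c f by (intro power_strict_mono) auto
    ultimately show ?thesis using M[OF N] iter_nonneg[OF f, of N] e(2) by simp
  qed
  then show "\<exists>M. \<forall>N\<ge>M. norm (iter_sum Ms nsq N f - 0) < r" by blast
qed

text \<open>Iterating the inequality bounds b f by the sum of b(T_u f) over words of length N, thus
  by C times a null sequence. Since b may take negative values, the lemma can be applied to a form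
  and to its negative.\<close>

lemma vanish_by_purity:
  assumes Q: "Q \<subseteq> vecs H" "\<And>f i. f \<in> Q \<Longrightarrow> Ms i f \<in> Q"
    and le: "\<And>f. f \<in> Q \<Longrightarrow> b f \<le> C * nsq f"
    and sub: "\<And>f. f \<in> Q \<Longrightarrow> b f \<le> (\<Sum>i\<in>UNIV. b (Ms i f))"
    and f: "f \<in> Q"
  shows "b f \<le> 0"
proof -
  have "b f \<le> C * iter_sum Ms nsq N f" if "f \<in> Q" for N f
    using that
  proof (induction N arbitrary: f)
    case (Suc N)
    have "b f \<le> (\<Sum>i\<in>UNIV. b (Ms i f))" by (rule sub[OF Suc.prems])
    also have "\<dots> \<le> (\<Sum>i\<in>UNIV. C * iter_sum Ms nsq N (Ms i f))" using Suc Q(2) by (intro sum_mono) auto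
    finally show ?case by (simp add: sum_distrib_left)
  qed (use le in simp)
  moreover have "(\<lambda>N. C * iter_sum Ms nsq N f) \<longlonglongrightarrow> C * 0"
    using Q(1) f by (intro tendsto_mult_left purity) auto
  ultimately show ?thesis using LIMSEQ_le_const[of "\<lambda>N. C * iter_sum Ms nsq N f" "C * 0" "b f"] f by auto
qed

text \<open>Descending induction on the exponent of \<open>Delta\<close>. With exponent m the form
  is |f(0)|^2 = 0 on Q. If exponent k + 1 gives 0, the form with exponent k equals the sum of its
  values at the T_i f, and purity applied to it and to its negative makes it 0. Exponent 0 is
  |f|^2.\<close>

lemma invariant_vanishing_at_0:
  assumes Q: "Q \<subseteq> vecs H" "\<And>f i. f \<in> Q \<Longrightarrow> Ms i f \<in> Q" and z: "\<And>f. f \<in> Q \<Longrightarrow> f 0 = 0" and f: "f \<in> Q"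
  shows "f = 0"
proof -
  define a where "a j f = Re ((Delta Ms ^^ j) (ip H) f f)" for j f
  have bound: "\<exists>C. \<forall>f\<in>vecs H. \<bar>a j f\<bar> \<le> C * nsq f" for j
  proof -
    have sf: "sform H ((Delta Ms ^^ j) (ip H))" by (rule H.sform_Delta_power[OF Ms_contraction H.sform_ip])
    obtain C where "C \<ge> 0" "\<And>f g. f \<in> vecs H \<Longrightarrow> g \<in> vecs H \<Longrightarrow> cmod ((Delta Ms ^^ j) (ip H) f g) \<le> C * (hnorm H f * hnorm H g)"
      using sform_bound[OF sf] by blast
    then have "\<bar>a j f\<bar> \<le> C * nsq f" if "f \<in> vecs H" for f
      using abs_Re_le_cmod[of "(Delta Ms ^^ j) (ip H) f f"] that unfolding a_def power2_eq_square by (meson order_trans)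
    then show ?thesis by blast
  qed
  have step: "a (Suc j) f = a j f - (\<Sum>i\<in>UNIV. a j (Ms i f))" for j f
    by (simp add: a_def Delta_def)
  have "\<forall>f\<in>Q. a (m - j) f = 0" if "j \<le> m" for j
    using that
  proof (induction j)
    case 0
    have "a m f = (hnorm E (f 0))\<^sup>2" if "f \<in> Q" for f
      unfolding a_def using Q(1) that by (intro Delta_ip) blast
    then have "a m f = 0" if "f \<in> Q" for f
      using z[OF that] that by simp
    then show ?case by simp
  next
    case (Suc j)
    define k where "k = m - Suc j"
    have k: "m - j = Suc k" using Suc.prems by (simp add: k_def)
    have eq: "a k f = (\<Sum>i\<in>UNIV. a k (Ms i f))" if "f \<in> Q" for f
      using Suc step[of k f] that by (simp add: k)
    obtain C where C: "\<And>f. f \<in> vecs H \<Longrightarrow> \<bar>a k f\<bar> \<le> C * nsq f" using bound by blast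
    have "a k f = 0" if fQ: "f \<in> Q" for f
    proof (rule antisym)
      show "a k f \<le> 0"
      proof (rule vanish_by_purity[OF Q _ _ fQ, where C = C])
        show "a k f \<le> C * nsq f" if "f \<in> Q" for f using C[of f] Q(1) that by force
        show "a k f \<le> (\<Sum>i\<in>UNIV. a k (Ms i f))" if "f \<in> Q" for f using eq[OF that] by simp
      qed
      have "- a k f \<le> 0"
      proof (rule vanish_by_purity[OF Q _ _ fQ, where C = C and b = "\<lambda>f. - a k f"])
        show "- a k f \<le> C * nsq f" if "f \<in> Q" for f using C[of f] Q(1) that by force
        show "- a k f \<le> (\<Sum>i\<in>UNIV. - a k (Ms i f))" if "f \<in> Q" for f using eq[OF that] by (simp add: sum_negf)
      qed
      then show "0 \<le> a k f" by simp
    qed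
    then show ?case by (simp add: k_def)
  qed
  from this[of m] f have "a 0 f = 0" by simp
  then show ?thesis using H.ip_pos[of f] f Q(1) by (force simp: a_def)
qed

end

lemma Hm_bergman: "hilbert_space E \<Longrightarrow> 1 \<le> m \<Longrightarrow> bergman E m (Hm m E)"
  by (simp add: bergman_def bergman_axioms_def Hm_rkhs)

section \<open>Compressions to co-invariant subspaces\<close>

text \<open>Identified with the adjoint of the inclusion, the projection inherits existence and
  boundedness from the facts on \<open>adj\<close>.\<close>

lemma proj_facts:
  assumes "hilbert_space H" "closed_subspace H Q"
  shows "x \<in> vecs H \<Longrightarrow> proj H Q x = adj (H \<restriction>\<^sub>H Q) H (\<lambda>x. x) x"
    and "bounded_op (H \<restriction>\<^sub>H Q) H (\<lambda>x. x)"
proof -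
  interpret H: hilbert_space H by fact
  interpret Q: hilbert_space "H \<restriction>\<^sub>H Q" by (rule restrict_hilbert[OF assms])
  have QH: "q \<in> vecs H" if "q \<in> Q" for q using assms(2) that by (auto simp: closed_subspace_def)
  show I: "bounded_op (H \<restriction>\<^sub>H Q) H (\<lambda>x. x)"
    by unfold_locales (auto intro!: bounded_opsI[where C = 1] QH)
  interpret I: bounded_op "H \<restriction>\<^sub>H Q" H "\<lambda>x. x" by (rule I)
  assume x: "x \<in> vecs H"
  show "proj H Q x = adj (H \<restriction>\<^sub>H Q) H (\<lambda>x. x) x"
    unfolding proj_def
  proof (rule the_equality)
    let ?y = "adj (H \<restriction>\<^sub>H Q) H (\<lambda>x. x) x"
    have y: "?y \<in> Q" using I.adj_mem[OF x] by simp
    have "ip H (x - ?y) q = 0" if "q \<in> Q" for q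
      using I.ip_adj_left[OF x, of q] that x QH[OF y] QH by (simp add: H.ip_linear)
    then show "?y \<in> Q \<and> (\<forall>q\<in>Q. ip H (x - ?y) q = 0)" using y by blast
    fix y assume y': "y \<in> Q \<and> (\<forall>q\<in>Q. ip H (x - y) q = 0)"
    have "ip H y q = ip H ?y q" if "q \<in> Q" for q
    proof -
      have "ip H (x - y) q = 0" using y' that by blast
      then have "ip H y q = ip H x q" using x y' that QH by (simp add: H.ip_linear)
      then show ?thesis using I.ip_adj_left[OF x, of q] that by simp
    qed
    then show "y = ?y" using y y' by (intro Q.ip_eqI_left) auto
  qed
qed

context bergman
begin

lemma coinvariant_facts:
  assumes "coinvariant H Q"
  shows "closed_subspace H Q" "hilbert_space (H \<restriction>\<^sub>H Q)" "Q \<subseteq> vecs H" "\<And>f i. f \<in> Q \<Longrightarrow> Ms i f \<in> Q"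
  using assms restrict_hilbert[OF H.hilbert_space_axioms]
  unfolding coinvariant_def Ms_def by (auto simp: closed_subspace_def)

text \<open>By co-invariance the adjoint of the compression is the restriction of T_i, with no
  projection left; thus \<open>sigma_op\<close> on Q2 becomes pullback along the T_i.\<close>

lemma compressed_facts:
  assumes Q: "coinvariant H Q"
  shows "bounded_op (H \<restriction>\<^sub>H Q) (H \<restriction>\<^sub>H Q) (compressed_coord H Q i)"
    and "f \<in> Q \<Longrightarrow> g \<in> Q \<Longrightarrow> ip H (compressed_coord H Q i f) g = ip H f (Ms i g)"
    and "f \<in> Q \<Longrightarrow> adj (H \<restriction>\<^sub>H Q) (H \<restriction>\<^sub>H Q) (compressed_coord H Q i) f = Ms i f"
    and "f \<in> Q \<Longrightarrow> compressed_coord H Q i f \<in> Q"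
proof -
  note Qf = coinvariant_facts[OF Q]
  have QH: "f \<in> vecs H" if "f \<in> Q" for f using Qf(3) that by blast
  interpret I: bounded_op "H \<restriction>\<^sub>H Q" H "\<lambda>x. x" by (rule proj_facts(2)[OF H.hilbert_space_axioms Qf(1)])
  have mcm: "mult_coord i f \<in> vecs H" if "f \<in> vecs H" for f using bounded_opsD(1)[OF mult_coord_bounded that] .
  have eq: "compressed_coord H Q i f = adj (H \<restriction>\<^sub>H Q) H (\<lambda>x. x) (mult_coord i f)" if "f \<in> Q" for f
    unfolding compressed_coord_def by (rule proj_facts(1)[OF H.hilbert_space_axioms Qf(1) mcm[OF QH[OF that]]])
  have "(\<lambda>f. adj (H \<restriction>\<^sub>H Q) H (\<lambda>x. x) (mult_coord i f)) \<in> bounded_ops (H \<restriction>\<^sub>H Q) (H \<restriction>\<^sub>H Q)"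
    using bounded_ops_comp[OF bounded_ops_comp[OF I.T mult_coord_bounded] I.adj_bounded]
      I.H.hilbert_space_axioms H.hilbert_space_axioms by blast
  then have "compressed_coord H Q i \<in> bounded_ops (H \<restriction>\<^sub>H Q) (H \<restriction>\<^sub>H Q)"
    unfolding bounded_ops_def using eq I.H.add_mem I.H.scale_mem by simp
  then show b: "bounded_op (H \<restriction>\<^sub>H Q) (H \<restriction>\<^sub>H Q) (compressed_coord H Q i)"
    using Qf(2) by (intro bounded_opI)
  show mem: "f \<in> Q \<Longrightarrow> compressed_coord H Q i f \<in> Q" for f
    using bounded_opsD(1)[OF bounded_op.T[OF b], of f] by simp
  show ip: "f \<in> Q \<Longrightarrow> g \<in> Q \<Longrightarrow> ip H (compressed_coord H Q i f) g = ip H f (Ms i g)" for f g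
    using I.ip_adj_left[OF mcm, of f g] QH eq ip_Ms[of g f] by simp
  show "f \<in> Q \<Longrightarrow> adj (H \<restriction>\<^sub>H Q) (H \<restriction>\<^sub>H Q) (compressed_coord H Q i) f = Ms i f"
    using Qf(4) ip by (intro bounded_op.adj_eqI[OF b]) auto
qed

lemma Ms_contraction_restrict:
  assumes "coinvariant H Q"
  shows "contraction (H \<restriction>\<^sub>H Q) (H \<restriction>\<^sub>H Q) (Ms i)"
proof -
  note Qf = coinvariant_facts[OF assms]
  have QH: "f \<in> vecs H" if "f \<in> Q" for f using Qf(3) that by blast
  show ?thesis
    unfolding contraction_def
  proof
    show "Ms i \<in> bounded_ops (H \<restriction>\<^sub>H Q) (H \<restriction>\<^sub>H Q)"
      by (rule bounded_opsI[where C = 1])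
        (auto simp: QH Qf(4) Ms_linear contractionD(2)[OF Ms_contraction])
  qed (simp add: QH contractionD(2)[OF Ms_contraction])
qed

end

section \<open>Adjoints of multipliers and the Schur-Agler condition\<close>

lemma adj_mult_intertwines:
  assumes "bergman E m H1" "bergman F p H2" and M: "mult_op \<Phi> \<in> bounded_ops H1 H2"
    and \<Phi>: "\<And>z. z \<in> unit_ball \<Longrightarrow> \<Phi> z \<in> bounded_ops E F" and f: "f \<in> vecs H2"
  shows "adj H1 H2 (mult_op \<Phi>) (bergman.Ms H2 i f) = bergman.Ms H1 i (adj H1 H2 (mult_op \<Phi>) f)"
proof -
  interpret A: bergman E m H1 by fact
  interpret B: bergman F p H2 by fact
  interpret M: bounded_op H1 H2 "mult_op \<Phi>" using M by unfold_locales
  show ?thesis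
  proof (rule M.adj_eqI)
    fix x assume x: "x \<in> vecs H1"
    have mx: "mult_coord i x \<in> vecs H1" by (rule bounded_opsD(1)[OF A.mult_coord_bounded x])
    have "mult_coord i (mult_op \<Phi> x) = mult_op \<Phi> (mult_coord i x)"
      using x bounded_opsD(3)[OF \<Phi>] by (auto simp: mult_coord_def mult_op_def fun_eq_iff)
    then have "ip H2 (mult_op \<Phi> x) (B.Ms i f) = ip H2 (mult_op \<Phi> (mult_coord i x)) f"
      using B.ip_Ms[OF f bounded_opsD(1)[OF M x]] by simp
    also have "\<dots> = ip H1 x (A.Ms i (adj H1 H2 (mult_op \<Phi>) f))"
      using M.ip_adj[OF f mx] A.ip_Ms[OF M.adj_mem[OF f] x] by simp
    finally show "ip H2 (mult_op \<Phi> x) (B.Ms i f) = ip H1 x (A.Ms i (adj H1 H2 (mult_op \<Phi>) f))" .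
  qed (use f in auto)
qed

lemma mult_op_comp: "mult_op (\<lambda>z. \<Phi>2 z \<circ> \<Phi>1 z) f = mult_op \<Phi>2 (mult_op \<Phi>1 f)"
  by (auto simp: mult_op_def)

lemma adj_comp:
  assumes "bounded_op H K S" "bounded_op K L T" and y: "y \<in> vecs L" and eq: "\<And>x. U x = T (S x)"
  shows "adj H L U y = adj H K S (adj K L T y)"
proof -
  interpret S: bounded_op H K S by fact
  interpret T: bounded_op K L T by fact
  have "U \<in> bounded_ops H L"
    using bounded_ops_comp[OF S.T T.T S.H.hilbert_space_axioms S.K.hilbert_space_axioms] eq
    unfolding bounded_ops_def by simp
  then interpret U: bounded_op H L U by unfold_locales
  show ?thesis
    using y by (intro U.adj_eqI) (auto simp: eq S.ip_adj T.ip_adj bounded_opsD(1)[OF S.T])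
qed

text \<open>The double sum over a list is |s|^2 - |T s|^2 for the sum s of its vectors.\<close>

lemma psd_contraction_defect:
  assumes "hilbert_space H" "hilbert_space K" and T: "contraction H K T" and b: "\<And>p. p \<in> A \<Longrightarrow> b p \<in> vecs H"
  shows "psd A (\<lambda>p q. ip H (b p) (b q) - ip K (T (b p)) (T (b q)))"
  unfolding psd_def
proof (intro allI impI)
  interpret H: hilbert_space H by fact
  interpret K: hilbert_space K by fact
  fix l assume l: "set l \<subseteq> A"
  have m: "b p \<in> vecs H" if "p \<in> set l" for p using l b that by blast
  have Tm: "T (b p) \<in> vecs K" if "p \<in> set l" for p using bounded_opsD(1)[OF contractionD(1)[OF T] m[OF that]] .
  let ?s = "\<Sum>p\<leftarrow>l. b p"
  have s: "?s \<in> vecs H" using m by simp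
  have "T ?s = (\<Sum>p\<leftarrow>l. T (b p))" by (rule bounded_ops_sum_list[OF contractionD(1)[OF T] H.hilbert_space_axioms m])
  then have "(\<Sum>p\<leftarrow>l. \<Sum>q\<leftarrow>l. ip H (b p) (b q) - ip K (T (b p)) (T (b q))) = ip H ?s ?s - ip K (T ?s) (T ?s)"
    using H.ip_sum_list_sum_list[of l b, OF m] K.ip_sum_list_sum_list[of l "\<lambda>p. T (b p)", OF Tm]
    by (simp add: sum_list_subtractf)
  moreover have "(hnorm K (T ?s))\<^sup>2 \<le> (hnorm H ?s)\<^sup>2"
    using contractionD(2)[OF T s] bounded_opsD(1)[OF contractionD(1)[OF T] s] by (intro power_mono) auto
  ultimately show "0 \<le> Re (\<Sum>p\<leftarrow>l. \<Sum>q\<leftarrow>l. ip H (b p) (b q) - ip K (T (b p)) (T (b q)))"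
    using s bounded_opsD(1)[OF contractionD(1)[OF T] s] by (simp add: H.hnorm_sq K.hnorm_sq)
qed

context two_rkhs
begin

lemma multiplier_psd:
  assumes c: "contraction H1 H2 (mult_op \<Phi>)"
  shows "psd (pts F) (\<lambda>p q. k2 (fst q) (fst p) * ip F (snd p) (snd q)
      - k1 (fst q) (fst p) * ip E (snd (adjker p)) (snd (adjker q)))"
proof -
  interpret M: bounded_op H1 H2 "mult_op \<Phi>" using contractionD(1)[OF c] by unfold_locales
  have "psd (pts F) (\<lambda>p q. ip H2 (kerf k2 p) (kerf k2 q)
      - ip H1 (adj H1 H2 (mult_op \<Phi>) (kerf k2 p)) (adj H1 H2 (mult_op \<Phi>) (kerf k2 q)))"
    using M.contraction_adj[OF c] by (intro psd_contraction_defect) (auto, unfold_locales)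
  then show ?thesis
  proof (rule psd_cong[rotated])
    fix p q :: "(complex^'n) \<times> 'f" assume pq: "p \<in> pts F" "q \<in> pts F"
    show "k2 (fst q) (fst p) * ip F (snd p) (snd q) - k1 (fst q) (fst p) * ip E (snd (adjker p)) (snd (adjker q))
      = ip H2 (kerf k2 p) (kerf k2 q) - ip H1 (adj H1 H2 (mult_op \<Phi>) (kerf k2 p)) (adj H1 H2 (mult_op \<Phi>) (kerf k2 q))"
      unfolding adj_mult_kerf[OF M.T pq(1)] adj_mult_kerf[OF M.T pq(2)] H2.ip_kerf_kerf[OF pq]
        H1.ip_kerf_kerf[OF adjker_mem[OF pq(1)] adjker_mem[OF pq(2)]] by simp
  qed
qed

lemma homogeneous_adjker: "homogeneous F (\<lambda>p q. ip E (snd (adjker p)) (snd (adjker q)))"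
proof (rule H1.E.homogeneous_gram)
  show "snd (adjker p) \<in> vecs E" if "p \<in> pts F" for p using adjker_mem[OF that] by auto
  show "snd (adjker (sc c p)) = c *\<^sub>C snd (adjker p)" if "p \<in> pts F" for p c
    using that bounded_opsD(3)[OF bounded_op.adj_bounded[OF bounded_op_\<Phi>]] by auto
qed

end

lemma schur_agler_psd:
  fixes E :: "'e::complex_vector hspace" and F :: "'f::complex_vector hspace" and \<Phi> :: "complex^'n \<Rightarrow> 'e \<Rightarrow> 'f"
  assumes E: "hilbert_space E" and F: "hilbert_space F" and sa: "\<Phi> \<in> schur_agler E F"
  shows "psd (pts F) (\<lambda>p q. kpow 1 (fst q) (fst p) * ip F (snd p) (snd q)
      - kpow 1 (fst q) (fst p) * ip E (adj E F (\<Phi> (fst p)) (snd p)) (adj E F (\<Phi> (fst q)) (snd q)))"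
proof -
  interpret A: rkhs E "kpow 1" "Hm 1 E :: (complex^'n \<Rightarrow> 'e) hspace" by (rule Hm_rkhs[OF E]) simp
  interpret B: rkhs F "kpow 1" "Hm 1 F :: (complex^'n \<Rightarrow> 'f) hspace" by (rule Hm_rkhs[OF F]) simp
  interpret two_rkhs E "kpow 1" "Hm 1 E :: (complex^'n \<Rightarrow> 'e) hspace" F "kpow 1" "Hm 1 F :: (complex^'n \<Rightarrow> 'f) hspace" \<Phi>
    using sa by unfold_locales (auto simp: schur_agler_def contractive_multipliers_def holomorphic_on_ball_def)
  show ?thesis
    using multiplier_psd sa unfolding schur_agler_def contractive_multipliers_def snd_conv by blast
qed

text \<open>The defect kernel of exponent m is the one of exponent 1 divided by the power m - 1 of 1
  - <z,w>, and this division preserves positivity of homogeneous kernels.\<close>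

lemma schur_agler_contraction:
  fixes E :: "'e::complex_vector hspace" and F :: "'f::complex_vector hspace" and \<Phi> :: "complex^'n \<Rightarrow> 'e \<Rightarrow> 'f"
  assumes E: "hilbert_space E" and F: "hilbert_space F" and sa: "\<Phi> \<in> schur_agler E F" and m: "1 \<le> m"
  shows "contraction (Hm m E) (Hm m F) (mult_op \<Phi>)"
proof -
  interpret A: rkhs E "kpow m" "Hm m E :: (complex^'n \<Rightarrow> 'e) hspace" by (rule Hm_rkhs[OF E m])
  interpret B: rkhs F "kpow m" "Hm m F :: (complex^'n \<Rightarrow> 'f) hspace" by (rule Hm_rkhs[OF F m])
  interpret two_rkhs E "kpow m" "Hm m E :: (complex^'n \<Rightarrow> 'e) hspace" F "kpow m" "Hm m F :: (complex^'n \<Rightarrow> 'f) hspace" \<Phi>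
    using sa by unfold_locales (auto simp: schur_agler_def contractive_multipliers_def holomorphic_on_ball_def)
  define K where "K = (\<lambda>p q. ip F (snd p) (snd q) - ip E (snd (adjker p)) (snd (adjker q)))"
  have hom: "homogeneous F K"
    unfolding K_def by (intro homogeneous_diff homogeneous_adjker B.E.homogeneous_gram) auto
  have psd1: "psd (pts F) (\<lambda>p q. kpow 1 (fst q) (fst p) * K p q)"
    using schur_agler_psd[OF E F sa] by (simp add: K_def right_diff_distrib)
  have "psd (pts F) (\<lambda>p q. 1 / (1 - cdot (fst q) (fst p)) ^ (m - 1) * (kpow 1 (fst q) (fst p) * K p q))"
    using homogeneous_scale[OF hom, of "\<lambda>w z. kpow 1 z w"]
    by (intro B.E.psd_geometric_power[OF psd1]) simp
  then show ?thesis
  proof (intro multiplier_contraction, elim psd_cong[rotated])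
    fix p q :: "(complex^'n) \<times> 'f"
    have "kpow m (fst q) (fst p) = 1 / (1 - cdot (fst q) (fst p)) ^ (m - 1) * kpow 1 (fst q) (fst p)"
      using m by (cases m) auto
    then show "kpow m (fst q) (fst p) * ip F (snd p) (snd q) - kpow m (fst q) (fst p) * ip E (snd (adjker p)) (snd (adjker q))
      = 1 / (1 - cdot (fst q) (fst p)) ^ (m - 1) * (kpow 1 (fst q) (fst p) * K p q)"
      by (simp only: K_def right_diff_distrib mult.assoc)
  qed
qed

text \<open>An operator representing a bounded form is linear because the inner product is
  nondegenerate, and bounded by testing A f against itself. \<open>Y j\<close> is an iterate of
  operations on bare functions, and this supplies its linearity on Q2.\<close>

lemma form_operator_bounded:
  assumes "hilbert_space H" and A: "\<And>f. f \<in> vecs H \<Longrightarrow> A f \<in> vecs H"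
    and AB: "\<And>f g. f \<in> vecs H \<Longrightarrow> g \<in> vecs H \<Longrightarrow> ip H (A f) g = B f g" and B: "sform H B"
  shows "A \<in> bounded_ops H H"
proof -
  interpret H: hilbert_space H by fact
  obtain C where C: "C \<ge> 0" "\<And>f g. f \<in> vecs H \<Longrightarrow> g \<in> vecs H \<Longrightarrow> cmod (B f g) \<le> C * (hnorm H f * hnorm H g)"
    using sform_bound[OF B] by blast
  show ?thesis
  proof (rule bounded_opsI[where C = C])
    show "A (f + g) = A f + A g" if "f \<in> vecs H" "g \<in> vecs H" for f g
      using that A by (intro H.ip_eqI_left) (auto simp: AB H.ip_linear sformD(1)[OF B])
    show "A (c *\<^sub>C f) = c *\<^sub>C A f" if "f \<in> vecs H" for f c
      using that A by (intro H.ip_eqI_left) (auto simp: AB H.ip_linear sformD(2)[OF B])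
    fix f assume f: "f \<in> vecs H"
    have "(hnorm H (A f))\<^sup>2 = Re (B f (A f))" using AB[OF f A[OF f]] A[OF f] by (simp add: H.hnorm_sq)
    also have "\<dots> \<le> C * (hnorm H f * hnorm H (A f))"
      using C(2)[OF f A[OF f]] complex_Re_le_cmod[of "B f (A f)"] by linarith
    finally have "hnorm H (A f) * hnorm H (A f) \<le> (C * hnorm H f) * hnorm H (A f)"
      by (simp add: power2_eq_square mult_ac)
    moreover have "0 \<le> C * hnorm H f" using C(1) f by simp
    ultimately show "hnorm H (A f) \<le> C * hnorm H f"
      using H.hnorm_nonneg[OF A[OF f]] by (cases "hnorm H (A f) = 0") auto
  qed (rule A)
qed

section \<open>The intertwiner X and necessity of the positivity condition\<close>

locale intertwiner = A: bergman E m "Hm m E :: (complex^'n \<Rightarrow> 'e) hspace" + S: bergman Es p "Hm p Es :: (complex^'n \<Rightarrow> 's) hspace"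
  for E :: "'e::complex_vector hspace" and Es :: "'s::complex_vector hspace" and m p :: nat +
  fixes Q1 :: "(complex^'n \<Rightarrow> 'e) set" and Q2 :: "(complex^'n \<Rightarrow> 's) set"
    and X :: "(complex^'n \<Rightarrow> 'e) \<Rightarrow> complex^'n \<Rightarrow> 's"
  assumes mp: "m < p" and Q1: "coinvariant (Hm m E) Q1" and Q2: "coinvariant (Hm p Es) Q2"
    and X: "contraction (Hm m E \<restriction>\<^sub>H Q1) (Hm p Es \<restriction>\<^sub>H Q2) X"
    and XM: "\<And>i f. f \<in> Q1 \<Longrightarrow> X (compressed_coord (Hm m E) Q1 i f) = compressed_coord (Hm p Es) Q2 i (X f)"
begin

abbreviation "H1 \<equiv> Hm m E :: (complex^'n \<Rightarrow> 'e) hspace"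
abbreviation "H2 \<equiv> Hm p Es :: (complex^'n \<Rightarrow> 's) hspace"
abbreviation "G1 \<equiv> H1 \<restriction>\<^sub>H Q1"
abbreviation "G2 \<equiv> H2 \<restriction>\<^sub>H Q2"

lemmas Q1f = A.coinvariant_facts[OF Q1]
lemmas Q2f = S.coinvariant_facts[OF Q2]

lemma Q1H: "f \<in> Q1 \<Longrightarrow> f \<in> vecs H1"
  using Q1f(3) by blast

lemma Q2H: "f \<in> Q2 \<Longrightarrow> f \<in> vecs H2"
  using Q2f(3) by blast

sublocale G1: hilbert_space G1 by (rule Q1f(2))
sublocale G2: hilbert_space G2 by (rule Q2f(2))
sublocale X: bounded_op G1 G2 X using contractionD(1)[OF X] by unfold_locales

definition Xa :: "(complex^'n \<Rightarrow> 's) \<Rightarrow> complex^'n \<Rightarrow> 'e" where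
  "Xa = adj G1 G2 X"

lemma Xa_mem: "f \<in> Q2 \<Longrightarrow> Xa f \<in> Q1"
  using X.adj_mem[of f] by (simp add: Xa_def)

lemma X_mem: "f \<in> Q1 \<Longrightarrow> X f \<in> Q2"
  using bounded_opsD(1)[OF X.T, of f] by simp

lemma ip_Xa: "f \<in> Q2 \<Longrightarrow> x \<in> Q1 \<Longrightarrow> ip H1 x (Xa f) = ip H2 (X x) f"
  using X.ip_adj[of f x] by (simp add: Xa_def)

lemma Xa_bounded: "Xa \<in> bounded_ops G2 H1"
proof -
  have "Xa \<in> bounded_ops G2 G1" unfolding Xa_def by (rule X.adj_bounded)
  then show ?thesis unfolding bounded_ops_def using Q1H by auto
qed

lemma Xa_Ms: 
  assumes f: "f \<in> Q2"
  shows "Xa (S.Ms i f) = A.Ms i (Xa f)"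
proof (rule G1.ip_eqI)
  show "Xa (S.Ms i f) \<in> vecs G1" "A.Ms i (Xa f) \<in> vecs G1" using f Xa_mem Q1f(4) Q2f(4) by auto
  fix x assume "x \<in> vecs G1"
  then have x: "x \<in> Q1" by simp
  have "ip H1 x (Xa (S.Ms i f)) = ip H2 (X x) (S.Ms i f)" using ip_Xa x f Q2f(4) by simp
  also have "\<dots> = ip H2 (compressed_coord H2 Q2 i (X x)) f"
    using S.compressed_facts(2)[OF Q2] X_mem x f by simp
  also have "\<dots> = ip H1 (compressed_coord H1 Q1 i x) (Xa f)"
    using XM[OF x] ip_Xa[OF f] A.compressed_facts(4)[OF Q1 x] by simp
  also have "\<dots> = ip H1 x (A.Ms i (Xa f))"
    using A.compressed_facts(2)[OF Q1 x Xa_mem[OF f]] by simp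
  finally show "ip G1 x (Xa (S.Ms i f)) = ip G1 x (A.Ms i (Xa f))" by simp
qed

text \<open>Spelled exactly like the iterate in the theorem, so that it can be folded there; only
  its values on Q2 carry meaning.\<close>

definition Y :: "nat \<Rightarrow> (complex^'n \<Rightarrow> 's) \<Rightarrow> complex^'n \<Rightarrow> 's" where
  "Y j = ((\<lambda>Y. Y - sigma_op G2 (compressed_coord H2 Q2) Y) ^^ j) (id - (X \<circ> adj G1 G2 X))"

definition Bq :: "(complex^'n \<Rightarrow> 's) \<Rightarrow> (complex^'n \<Rightarrow> 's) \<Rightarrow> complex" where
  "Bq f g = ip H2 f g - ip H1 (Xa f) (Xa g)"

text \<open>Membership in Q2 and the form identity go through the induction together, since the
  facts about the compression hold on Q2 only. In \<open>sigma_op\<close> the inner adjoint is T_i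
  f, and the outer compression passes to T_i g.\<close>

lemma Y_form:
  "f \<in> Q2 \<Longrightarrow> Y j f \<in> Q2 \<and> (\<forall>g\<in>Q2. ip H2 (Y j f) g = (Delta S.Ms ^^ j) Bq f g)"
proof (induction j arbitrary: f)
  case 0
  have Y0: "Y 0 f = f - X (Xa f)" by (simp add: Y_def Xa_def)
  have m: "X (Xa f) \<in> Q2" using 0 X_mem Xa_mem by blast
  have "f - X (Xa f) \<in> Q2" using G2.diff_mem[of f "X (Xa f)"] 0 m by simp
  moreover have "ip H2 (f - X (Xa f)) g = Bq f g" if "g \<in> Q2" for g
    using ip_Xa[OF that Xa_mem[OF 0]] 0 m that Q2H by (simp add: Bq_def S.H.ip_linear)
  ultimately show ?case unfolding Y0 funpow_0 by blast
next
  case (Suc j)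
  let ?c = "\<lambda>i. compressed_coord H2 Q2 i (Y j (S.Ms i f))"
  have YS: "Y (Suc j) f = Y j f - (\<Sum>i\<in>UNIV. ?c i)"
    using S.compressed_facts(3)[OF Q2 Suc.prems] by (simp add: Y_def sigma_op_def sum_fun_apply)
  have T: "S.Ms i f \<in> Q2" for i using Q2f(4) Suc.prems by blast
  have Yi: "Y j (S.Ms i f) \<in> Q2" "\<And>g. g \<in> Q2 \<Longrightarrow> ip H2 (Y j (S.Ms i f)) g = (Delta S.Ms ^^ j) Bq (S.Ms i f) g" for i
    using Suc.IH[OF T] by blast+
  have ci: "?c i \<in> Q2" for i by (rule S.compressed_facts(4)[OF Q2 Yi(1)])
  have Yf: "Y j f \<in> Q2" "\<And>g. g \<in> Q2 \<Longrightarrow> ip H2 (Y j f) g = (Delta S.Ms ^^ j) Bq f g"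
    using Suc.IH[OF Suc.prems] by blast+
  have s: "(\<Sum>i\<in>UNIV. ?c i) \<in> Q2" using G2.sum_mem[of UNIV ?c] ci by simp
  have "ip H2 (Y (Suc j) f) g = (Delta S.Ms ^^ Suc j) Bq f g" if g: "g \<in> Q2" for g
  proof -
    have "ip H2 (Y (Suc j) f) g = ip H2 (Y j f) g - (\<Sum>i\<in>UNIV. ip H2 (?c i) g)"
      unfolding YS using Yf(1) ci s g Q2H by (simp add: S.H.ip_diff_left S.H.ip_sum_left)
    also have "\<dots> = (Delta S.Ms ^^ j) Bq f g - (\<Sum>i\<in>UNIV. (Delta S.Ms ^^ j) Bq (S.Ms i f) (S.Ms i g))"
      using Yf(2)[OF g] Yi(2)[OF Q2f(4)[OF g]] S.compressed_facts(2)[OF Q2 Yi(1) g] by simp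
    finally show ?thesis by (simp add: Delta_def)
  qed
  moreover have "Y (Suc j) f \<in> Q2" unfolding YS using G2.diff_mem[of "Y j f"] Yf(1) s by simp
  ultimately show ?case by blast
qed

lemma sform_Bq: "sform G2 Bq"
proof -
  have "sform G2 (\<lambda>f g. ip G2 f g - ip H1 (Xa f) (Xa g))"
    by (intro G2.sform_diff G2.sform_ip G2.sform_comp[OF Xa_bounded A.H.sform_ip A.H.hilbert_space_axioms])
  then show ?thesis unfolding Bq_def[abs_def] by simp
qed

lemma sform_Delta_Bq: "sform G2 ((Delta S.Ms ^^ j) Bq)"
  by (rule G2.sform_Delta_power[OF S.Ms_contraction_restrict[OF Q2] sform_Bq])

lemma positive_iff: "positive_op G2 (Y j) \<longleftrightarrow> (\<forall>f\<in>Q2. 0 \<le> Re ((Delta S.Ms ^^ j) Bq f f))"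
proof -
  have "Im ((Delta S.Ms ^^ j) Bq f f) = 0" if "f \<in> Q2" for f
  proof -
    have "(Delta S.Ms ^^ j) Bq f f = cnj ((Delta S.Ms ^^ j) Bq f f)"
      using that by (intro sformD(3)[OF sform_Delta_Bq]) auto
    then show ?thesis by (metis Reals_cnj_iff complex_is_Real_iff)
  qed
  then show ?thesis using Y_form unfolding positive_op_def by auto
qed

text \<open>F has an arbitrary type here, which is what lets a solution over any type be traded for
  one over the fixed type.\<close>

lemma positive_if_factors:
  fixes F :: "'f::complex_vector hspace"
  assumes F: "hilbert_space F" and fac: "factors_through m p E Es Q1 Q2 X F"
  shows "positive_op G2 (Y (m - 1))"
  unfolding positive_iff
proof
  fix f assume f: "f \<in> Q2"
  obtain \<Phi>1 \<Phi>2 where \<Phi>1: "\<Phi>1 \<in> schur_agler E F" and \<Phi>2: "coisometric_multiplier m F p Es \<Phi>2"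
    and XF: "\<And>f. f \<in> Q2 \<Longrightarrow> adj H1 H2 (mult_op (\<lambda>z. \<Phi>2 z \<circ> \<Phi>1 z)) f = Xa f"
    using fac unfolding factors_through_def Xa_def by blast
  let ?HF = "Hm m F :: (complex^'n \<Rightarrow> 'f) hspace"
  interpret C: bergman F m ?HF by (rule Hm_bergman[OF F A.m])
  have c2: "contraction ?HF H2 (mult_op \<Phi>2)" and iso: "\<And>f. f \<in> vecs H2 \<Longrightarrow> mult_op \<Phi>2 (adj ?HF H2 (mult_op \<Phi>2) f) = f"
    and \<Phi>2b: "\<And>z. z \<in> unit_ball \<Longrightarrow> \<Phi>2 z \<in> bounded_ops F Es"
    using \<Phi>2 by (auto simp: coisometric_multiplier_def contractive_multipliers_def holomorphic_on_ball_def)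
  interpret M2: bounded_op ?HF H2 "mult_op \<Phi>2" using contractionD(1)[OF c2] by unfold_locales
  define L where "L = adj ?HF H2 (mult_op \<Phi>2)"
  have c1: "contraction H1 ?HF (mult_op \<Phi>1)" by (rule schur_agler_contraction[OF A.E.hilbert_space_axioms F \<Phi>1 A.m])
  interpret M1: bounded_op H1 ?HF "mult_op \<Phi>1" using contractionD(1)[OF c1] by unfold_locales
  interpret two_rkhs E "kpow m" H1 F "kpow m" ?HF \<Phi>1
    using \<Phi>1 by unfold_locales (auto simp: schur_agler_def contractive_multipliers_def holomorphic_on_ball_def)
  define B where "B h k = ip ?HF h k - ip H1 (adj H1 ?HF (mult_op \<Phi>1) h) (adj H1 ?HF (mult_op \<Phi>1) k)" for h k
  have Lm: "L f \<in> vecs ?HF" if "f \<in> Q2" for f using that Q2H by (simp add: L_def)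
  have XL: "Xa f = adj H1 ?HF (mult_op \<Phi>1) (L f)" if "f \<in> Q2" for f
    unfolding XF[OF that, symmetric] L_def
    by (rule adj_comp[OF M1.bounded_op_axioms M2.bounded_op_axioms Q2H[OF that]]) (rule mult_op_comp)
  have Bq: "Bq f g = B (L f) (L g)" if "f \<in> Q2" "g \<in> Q2" for f g
  proof -
    \<comment> \<open>Co-isometry of the multiplier is isometry of its adjoint L.\<close>
    have "ip ?HF (L f) (L g) = ip H2 f g"
      using M2.ip_adj[OF Q2H[OF that(2)] Lm[OF that(1)]] iso[OF Q2H[OF that(1)]] by (simp add: L_def)
    then show ?thesis by (simp add: Bq_def B_def XL that)
  qed
  have LT: "L (S.Ms i f) = C.Ms i (L f)" if "f \<in> Q2" for f i
    unfolding L_def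
    by (rule adj_mult_intertwines[OF C.bergman_axioms S.bergman_axioms contractionD(1)[OF c2] \<Phi>2b Q2H[OF that]])
  have eq: "(Delta S.Ms ^^ (m - 1)) Bq f f = (Delta C.Ms ^^ (m - 1)) B (L f) (L f)"
    by (rule Delta_intertwine[where Q = Q2 and L = L]) (use f Q2f(4) LT Bq in auto)
  have sB: "sform ?HF B"
    unfolding B_def[abs_def]
    by (intro C.H.sform_diff C.H.sform_ip C.H.sform_comp[OF M1.adj_bounded A.H.sform_ip A.H.hilbert_space_axioms])
  show "0 \<le> Re ((Delta S.Ms ^^ (m - 1)) Bq f f)"
    unfolding eq
  proof (rule C.sform_nonneg[OF C.H.sform_Delta_power[OF C.Ms_contraction sB] _ Lm[OF f]])
    show "psd (pts F) (\<lambda>p q. (Delta C.Ms ^^ (m - 1)) B (kerf (kpow m) p) (kerf (kpow m) q))"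
    proof (rule psd_cong[OF _ schur_agler_psd[OF A.E.hilbert_space_axioms F \<Phi>1]])
      fix p q :: "(complex^'n) \<times> 'f" assume pq: "p \<in> pts F" "q \<in> pts F"
      have "B (kerf (kpow m) p) (kerf (kpow m) q) = kpow m (fst q) (fst p) * (ip F (snd p) (snd q)
          - ip E (snd (adjker p)) (snd (adjker q)))"
        unfolding B_def adj_mult_kerf[OF M1.T pq(1)] adj_mult_kerf[OF M1.T pq(2)] C.ip_kerf_kerf[OF pq]
          A.ip_kerf_kerf[OF adjker_mem[OF pq(1)] adjker_mem[OF pq(2)]] fst_conv
        by (simp only: right_diff_distrib)
      \<comment> \<open>Of the m factors in the denominator m - 1 are cancelled; what remains is the
        kernel of exponent 1, to which the Schur-Agler property applies.\<close>
      then have "(Delta C.Ms ^^ (m - 1)) B (kerf (kpow m) p) (kerf (kpow m) q)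
          = ((1 - cdot (fst q) (fst p)) ^ (m - 1) * kpow (1 + (m - 1)) (fst q) (fst p)) * (ip F (snd p) (snd q)
          - ip E (snd (adjker p)) (snd (adjker q)))"
        using A.m by (simp only: C.Delta_kerf[OF sB pq] mult.assoc le_add_diff_inverse)
      then show "(Delta C.Ms ^^ (m - 1)) B (kerf (kpow m) p) (kerf (kpow m) q)
        = kpow 1 (fst q) (fst p) * ip F (snd p) (snd q)
          - kpow 1 (fst q) (fst p) * ip E (adj E F (\<Phi>1 (fst p)) (snd p)) (adj E F (\<Phi>1 (fst q)) (snd q))"
        unfolding C.kpow_mult_cdot[OF pq] by (simp only: right_diff_distrib snd_conv)
    qed
  qed
qed

end

section \<open>Transfer functions of contractive colligations\<close>

lemma bounded_ops_pair:
  assumes "hilbert_space H" "hilbert_space K" "hilbert_space L" and A: "A \<in> bounded_ops H K" and B: "B \<in> bounded_ops H L"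
  shows "(\<lambda>x. (A x, B x)) \<in> bounded_ops H (K \<times>\<^sub>H L)"
proof -
  interpret H: hilbert_space H by fact
  interpret P: hilbert_space "K \<times>\<^sub>H L" by (rule prod_hilbert) fact+
  interpret K: hilbert_space K by fact
  interpret L: hilbert_space L by fact
  obtain C where C: "C > 0" "\<And>x. x \<in> vecs H \<Longrightarrow> hnorm K (A x) \<le> C * hnorm H x"
    using bounded_ops_bound[OF A] assms(1) by blast
  obtain D where D: "D > 0" "\<And>x. x \<in> vecs H \<Longrightarrow> hnorm L (B x) \<le> D * hnorm H x"
    using bounded_ops_bound[OF B] assms(1) by blast
  note Al = bounded_opsD[OF A] and Bl = bounded_opsD[OF B]
  show ?thesis
  proof (rule bounded_opsI[where C = "C + D"])
    fix x assume x: "x \<in> vecs H"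
    have m: "(A x, B x) \<in> vecs (K \<times>\<^sub>H L)" using Al(1) Bl(1) x by simp
    have sq: "(hnorm (K \<times>\<^sub>H L) (A x, B x))\<^sup>2 \<le> (hnorm K (A x) + hnorm L (B x))\<^sup>2"
      using hnorm_prod_sq[OF assms(2,3) m] Al(1)[OF x] Bl(1)[OF x] by (simp add: power2_sum)
    have "0 \<le> hnorm K (A x) + hnorm L (B x)" using Al(1)[OF x] Bl(1)[OF x] by simp
    from power2_le_imp_le[OF sq this] C(2)[OF x] D(2)[OF x]
    show "hnorm (K \<times>\<^sub>H L) (A x, B x) \<le> (C + D) * hnorm H x" by (simp add: algebra_simps)
  qed (auto simp: Al Bl scaleC_prod_def)
qed

lemma bounded_ops_l2:
  fixes A :: "'n::finite \<Rightarrow> 'a::complex_vector \<Rightarrow> 'b::complex_vector"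
  assumes "hilbert_space H" "hilbert_space K" and A: "\<And>i. A i \<in> bounded_ops H K"
  shows "(\<lambda>x i. A i x) \<in> bounded_ops H (l2_hspace K)"
proof -
  interpret H: hilbert_space H by fact
  interpret K: hilbert_space K by fact
  interpret L: hilbert_space "l2_hspace K :: ('n \<Rightarrow> 'b) hspace" by (rule K.l2_hilbert)
  have "\<forall>i. \<exists>C>0. \<forall>x\<in>vecs H. hnorm K (A i x) \<le> C * hnorm H x"
    using bounded_ops_bound[OF A] assms(1) by metis
  then obtain C where C: "\<And>i. C i > 0" "\<And>i x. x \<in> vecs H \<Longrightarrow> hnorm K (A i x) \<le> C i * hnorm H x" by metis
  note Al = bounded_opsD[OF A]
  define D where "D = (\<Sum>i\<in>UNIV. (C i)\<^sup>2)"
  have D: "D \<ge> 0" by (simp add: D_def sum_nonneg)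
  show ?thesis
  proof (rule bounded_opsI[where C = "sqrt D"])
    fix x assume x: "x \<in> vecs H"
    have "(hnorm (l2_hspace K) (\<lambda>i. A i x))\<^sup>2 = (\<Sum>i\<in>UNIV. (hnorm K (A i x))\<^sup>2)"
      using Al(1)[OF x] by (intro K.hnorm_l2_finite_sq) simp
    also have "\<dots> \<le> (\<Sum>i\<in>UNIV. (C i * hnorm H x)\<^sup>2)"
      using C(2)[OF x] Al(1)[OF x] by (intro sum_mono power_mono) auto
    also have "\<dots> = (sqrt D * hnorm H x)\<^sup>2"
      using D by (simp add: power_mult_distrib D_def sum_distrib_right)
    finally have sq: "(hnorm (l2_hspace K) (\<lambda>i. A i x))\<^sup>2 \<le> (sqrt D * hnorm H x)\<^sup>2" .
    have "0 \<le> sqrt D * hnorm H x" using D x by simp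
    from power2_le_imp_le[OF sq this] show "hnorm (l2_hspace K) (\<lambda>i. A i x) \<le> sqrt D * hnorm H x" .
  qed (auto simp: Al vecs_l2_finite fun_eq_iff)
qed

text \<open>V is oriented for the adjoint side: it maps n copies of G together with F to G together
  with E, so it realises the adjoint of the symbol, from F to E, and the state is fed back with
  conjugated coordinates. This matches the action of adjoint multipliers on kernel
  functions.\<close>

locale colligation = E: hilbert_space E + F: hilbert_space F + G: hilbert_space G
  for E :: "'e::complex_vector hspace" and F :: "'f::complex_vector hspace" and G :: "'g::complex_vector hspace" +
  fixes V :: "('n::finite \<Rightarrow> 'g) \<times> 'f \<Rightarrow> 'g \<times> 'e"
  assumes V: "contraction (l2_hspace G \<times>\<^sub>H F) (G \<times>\<^sub>H E) V"
begin

abbreviation "GF \<equiv> (l2_hspace G :: ('n \<Rightarrow> 'g) hspace) \<times>\<^sub>H F"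
abbreviation "GE \<equiv> G \<times>\<^sub>H E"

lemma l2G: "hilbert_space (l2_hspace G :: ('n \<Rightarrow> 'g) hspace)"
  by (rule G.l2_hilbert)

sublocale GF: hilbert_space GF by (rule prod_hilbert[OF l2G F.hilbert_space_axioms])
sublocale GE: hilbert_space GE by (rule prod_hilbert[OF G.hilbert_space_axioms E.hilbert_space_axioms])

lemmas Vl = bounded_opsD[OF contractionD(1)[OF V]]

definition emb :: "complex^'n \<Rightarrow> 'g \<Rightarrow> 'f \<Rightarrow> ('n \<Rightarrow> 'g) \<times> 'f" where
  "emb w d \<eta> = ((\<lambda>i. cnj (w $ i) *\<^sub>C d), \<eta>)"

lemma emb_mem: "d \<in> vecs G \<Longrightarrow> \<eta> \<in> vecs F \<Longrightarrow> emb w d \<eta> \<in> vecs GF"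
  by (simp add: emb_def vecs_l2_finite)

lemma emb_add: "emb w (d + d') (\<eta> + \<eta>') = emb w d \<eta> + emb w d' \<eta>'"
  by (simp add: emb_def scaleC_add_right fun_eq_iff)

lemma emb_scale: "emb w (c *\<^sub>C d) (c *\<^sub>C \<eta>) = c *\<^sub>C emb w d \<eta>"
  by (simp add: emb_def scaleC_prod_def scaleC_scaleC fun_eq_iff mult.commute)

lemma ip_emb:
  "d \<in> vecs G \<Longrightarrow> d' \<in> vecs G \<Longrightarrow> ip GF (emb w d \<eta>) (emb z d' \<eta>') = cdot z w * ip G d d' + ip F \<eta> \<eta>'"
  by (simp add: ip_prod emb_def ip_l2_finite G.ip_linear cdot_def sum_distrib_right sum_distrib_left mult_ac)

lemma hnorm_emb_sq:
  assumes "d \<in> vecs G" "\<eta> \<in> vecs F"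
  shows "(hnorm GF (emb w d \<eta>))\<^sup>2 \<le> (norm w * hnorm G d)\<^sup>2 + (hnorm F \<eta>)\<^sup>2"
proof -
  have "(hnorm GF (emb w d \<eta>))\<^sup>2 = Re (cdot w w * of_real ((hnorm G d)\<^sup>2) + of_real ((hnorm F \<eta>)\<^sup>2))"
    using ip_emb[OF assms(1,1), of w \<eta> w \<eta>] assms emb_mem[OF assms]
    by (simp add: GF.hnorm_sq G.ip_self F.ip_self)
  also have "\<dots> = Re (cdot w w) * (hnorm G d)\<^sup>2 + (hnorm F \<eta>)\<^sup>2" by simp
  also have "\<dots> \<le> (norm w * norm w) * (hnorm G d)\<^sup>2 + (hnorm F \<eta>)\<^sup>2"
    using cdot_norm_le[of w w] complex_Re_le_cmod[of "cdot w w"] by (intro add_right_mono mult_right_mono) auto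
  finally show ?thesis by (simp only: power_mult_distrib power2_eq_square[of "norm w"])
qed

text \<open>The state equation has the form d = N d + b with |N d| <= |w| |d| and |w| < 1.\<close>

lemma state_ex1:
  assumes w: "w \<in> unit_ball" and \<eta>: "\<eta> \<in> vecs F"
  shows "\<exists>!d. d \<in> vecs G \<and> d = fst (V (emb w d \<eta>))"
proof -
  define N where "N d = fst (V (emb w d 0))" for d
  define b where "b = fst (V (emb w 0 \<eta>))"
  have Vm: "fst (V u) \<in> vecs G" if "u \<in> vecs GF" for u using Vl(1)[OF that] by auto
  have eq: "fst (V (emb w d \<eta>)) = N d + b" if d: "d \<in> vecs G" for d
  proof -
    have "emb w d \<eta> = emb w d 0 + emb w 0 \<eta>" using emb_add[of w d 0 0 \<eta>] by simp
    then show ?thesis using Vl(2)[of "emb w d 0" "emb w 0 \<eta>"] emb_mem d \<eta> by (simp add: N_def b_def)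
  qed
  have Nn: "hnorm G (N d) \<le> norm w * hnorm G d" if d: "d \<in> vecs G" for d
  proof (rule power2_le_imp_le)
    have m: "emb w d 0 \<in> vecs GF" using d emb_mem by simp
    have "(hnorm G (N d))\<^sup>2 \<le> (hnorm GE (V (emb w d 0)))\<^sup>2"
      using hnorm_prod_sq[OF G.hilbert_space_axioms E.hilbert_space_axioms Vl(1)[OF m]] by (simp add: N_def)
    also have "\<dots> \<le> (hnorm GF (emb w d 0))\<^sup>2"
      using contractionD(2)[OF V m] Vl(1)[OF m] by (intro power_mono GE.hnorm_nonneg) auto
    also have "\<dots> \<le> (norm w * hnorm G d)\<^sup>2" using hnorm_emb_sq[OF d, of 0 w] by simp
    finally show "(hnorm G (N d))\<^sup>2 \<le> (norm w * hnorm G d)\<^sup>2" .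
  qed (use d in auto)
  have Nb: "N \<in> bounded_ops G G"
  proof (rule bounded_opsI[OF _ _ _ Nn])
    show "N d \<in> vecs G" if "d \<in> vecs G" for d unfolding N_def using that emb_mem by (intro Vm) auto
    show "N (x + y) = N x + N y" if "x \<in> vecs G" "y \<in> vecs G" for x y
      using Vl(2)[OF emb_mem[of x 0 w] emb_mem[of y 0 w]] that emb_add[of w x y 0 0] by (simp add: N_def)
    show "N (c *\<^sub>C x) = c *\<^sub>C N x" if "x \<in> vecs G" for x c
      using Vl(3)[OF emb_mem[of x 0 w], of c] that emb_scale[of w c x 0] by (simp add: N_def)
  qed
  have bm: "b \<in> vecs G" unfolding b_def using \<eta> emb_mem by (intro Vm) auto
  have "\<exists>!d. d \<in> vecs G \<and> d = N d + b"
    using w by (intro strict_contraction_fixpoint[OF G.hilbert_space_axioms Nb bm _ _ Nn]) auto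
  then show ?thesis using eq by metis
qed

definition state_vec :: "(complex^'n) \<times> 'f \<Rightarrow> 'g" where
  "state_vec p = (THE d. d \<in> vecs G \<and> d = fst (V (emb (fst p) d (snd p))))"

definition in_vec :: "(complex^'n) \<times> 'f \<Rightarrow> ('n \<Rightarrow> 'g) \<times> 'f" where
  "in_vec p = emb (fst p) (state_vec p) (snd p)"

definition out_vec :: "(complex^'n) \<times> 'f \<Rightarrow> 'e" where
  "out_vec p = snd (V (in_vec p))"

lemma state_facts:
  assumes "p \<in> pts F"
  shows "state_vec p \<in> vecs G" "state_vec p = fst (V (in_vec p))"
  using theI'[OF state_ex1[of "fst p" "snd p"]] assms unfolding state_vec_def[symmetric] in_vec_def by auto

lemma state_eqI:
  assumes "p \<in> pts F" "d \<in> vecs G" "d = fst (V (emb (fst p) d (snd p)))"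
  shows "state_vec p = d"
  unfolding state_vec_def using assms by (intro the1_equality state_ex1) auto

lemma input_mem: "p \<in> pts F \<Longrightarrow> in_vec p \<in> vecs GF"
  unfolding in_vec_def using state_facts by (intro emb_mem) auto

lemma V_input: "p \<in> pts F \<Longrightarrow> V (in_vec p) = (state_vec p, out_vec p)"
  using state_facts(2) by (simp add: out_vec_def prod_eq_iff)

lemma output_mem: "p \<in> pts F \<Longrightarrow> out_vec p \<in> vecs E"
  using Vl(1)[OF input_mem, of p] by (simp add: out_vec_def mem_Times_iff)

lemma state_sc:
  assumes p: "p \<in> pts F"
  shows "state_vec (sc c p) = c *\<^sub>C state_vec p" "in_vec (sc c p) = c *\<^sub>C in_vec p" "out_vec (sc c p) = c *\<^sub>C out_vec p"
proof -
  show s: "state_vec (sc c p) = c *\<^sub>C state_vec p"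
  proof (rule state_eqI)
    show "c *\<^sub>C state_vec p = fst (V (emb (fst (sc c p)) (c *\<^sub>C state_vec p) (snd (sc c p))))"
      unfolding fst_sc snd_sc emb_scale in_vec_def[symmetric] Vl(3)[OF input_mem[OF p]] fst_scaleC
        state_facts(2)[OF p, symmetric] ..
  qed (use state_facts(1)[OF p] F.sc_pts[OF p] in auto)
  show i: "in_vec (sc c p) = c *\<^sub>C in_vec p" by (simp add: in_vec_def s emb_scale)
  show "out_vec (sc c p) = c *\<^sub>C out_vec p" by (simp add: out_vec_def i Vl(3)[OF input_mem[OF p]])
qed

lemma output_add:
  assumes p: "(w, \<eta>) \<in> pts F" "(w, \<eta>') \<in> pts F"
  shows "out_vec (w, \<eta> + \<eta>') = out_vec (w, \<eta>) + out_vec (w, \<eta>')"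
proof -
  have q: "(w, \<eta> + \<eta>') \<in> pts F" using p by auto
  have s: "state_vec (w, \<eta> + \<eta>') = state_vec (w, \<eta>) + state_vec (w, \<eta>')"
  proof (rule state_eqI[OF q])
    show "state_vec (w, \<eta>) + state_vec (w, \<eta>') = fst (V (emb (fst (w, \<eta> + \<eta>')) (state_vec (w, \<eta>) + state_vec (w, \<eta>')) (snd (w, \<eta> + \<eta>'))))"
    proof -
      have "emb w (state_vec (w, \<eta>) + state_vec (w, \<eta>')) (\<eta> + \<eta>') = in_vec (w, \<eta>) + in_vec (w, \<eta>')"
        by (simp add: emb_add in_vec_def)
      then show ?thesis
        unfolding fst_conv snd_conv by (simp only: Vl(2)[OF input_mem[OF p(1)] input_mem[OF p(2)]] fst_add
          state_facts(2)[OF p(1), symmetric] state_facts(2)[OF p(2), symmetric])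
    qed
  qed (use state_facts(1)[OF p(1)] state_facts(1)[OF p(2)] in auto)
  have "in_vec (w, \<eta> + \<eta>') = in_vec (w, \<eta>) + in_vec (w, \<eta>')"
    unfolding in_vec_def s by (simp add: emb_add)
  then show ?thesis using Vl(2)[OF input_mem[OF p(1)] input_mem[OF p(2)]] by (simp add: out_vec_def)
qed

text \<open>Contractivity of V reads |state|^2 + |output|^2 <= |w|^2 |state|^2 + |input|^2, and |w|
  <= 1 lets the state terms drop out.\<close>

lemma hnorm_output_le:
  assumes p: "p \<in> pts F"
  shows "hnorm E (out_vec p) \<le> hnorm F (snd p)"
proof (rule power2_le_imp_le)
  have wle: "norm (fst p) \<le> 1" using p by auto
  have sm: "state_vec p \<in> vecs G" "snd p \<in> vecs F" using state_facts(1)[OF p] p by auto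
  have "(hnorm GE (V (in_vec p)))\<^sup>2 \<le> (hnorm GF (in_vec p))\<^sup>2"
    using contractionD(2)[OF V input_mem[OF p]] Vl(1)[OF input_mem[OF p]] by (intro power_mono GE.hnorm_nonneg) auto
  also have "\<dots> \<le> (norm (fst p) * hnorm G (state_vec p))\<^sup>2 + (hnorm F (snd p))\<^sup>2"
    unfolding in_vec_def by (rule hnorm_emb_sq[OF sm])
  also have "(norm (fst p) * hnorm G (state_vec p))\<^sup>2 \<le> (1 * hnorm G (state_vec p))\<^sup>2"
    using wle sm by (intro power_mono mult_right_mono) auto
  finally show "(hnorm E (out_vec p))\<^sup>2 \<le> (hnorm F (snd p))\<^sup>2"
    using hnorm_prod_sq[OF G.hilbert_space_axioms E.hilbert_space_axioms Vl(1)[OF input_mem[OF p]]] V_input[OF p] by simp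
qed (use p in auto)

lemma output_bounded:
  assumes z: "z \<in> unit_ball"
  shows "(\<lambda>\<eta>. out_vec (z, \<eta>)) \<in> bounded_ops F E"
proof (rule bounded_opsI[where C = 1])
  show "out_vec (z, c *\<^sub>C x) = c *\<^sub>C out_vec (z, x)" if "x \<in> vecs F" for x c
    using state_sc(3)[of "(z, x)" c] z that by (simp add: sc_def)
  show "out_vec (z, x + y) = out_vec (z, x) + out_vec (z, y)" if "x \<in> vecs F" "y \<in> vecs F" for x y
    using z that by (intro output_add) auto
  show "hnorm E (out_vec (z, x)) \<le> 1 * hnorm F x" if "x \<in> vecs F" for x
    using hnorm_output_le[of "(z, x)"] z that by simp
  show "out_vec (z, x) \<in> vecs E" if "x \<in> vecs F" for x using output_mem[of "(z, x)"] z that by simp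
qed

text \<open>Outputs depend antiholomorphically on the point, so the holomorphic symbol is the
  adjoint of the output map.\<close>

definition transfer :: "complex^'n \<Rightarrow> 'e \<Rightarrow> 'f" where
  "transfer z = adj F E (\<lambda>\<eta>. out_vec (z, \<eta>))"

lemma transfer_bounded: "z \<in> unit_ball \<Longrightarrow> transfer z \<in> bounded_ops E F"
  and adj_transfer: "z \<in> unit_ball \<Longrightarrow> \<eta> \<in> vecs F \<Longrightarrow> adj E F (transfer z) \<eta> = out_vec (z, \<eta>)"
proof -
  assume z: "z \<in> unit_ball"
  interpret O: bounded_op F E "\<lambda>\<eta>. out_vec (z, \<eta>)" using output_bounded[OF z] by unfold_locales
  show "transfer z \<in> bounded_ops E F" unfolding transfer_def by (rule O.adj_bounded)
  show "\<eta> \<in> vecs F \<Longrightarrow> adj E F (transfer z) \<eta> = out_vec (z, \<eta>)" unfolding transfer_def by (rule O.adj_adj)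
qed

lemma adj_transfer': "p \<in> pts F \<Longrightarrow> adj E F (transfer (fst p)) (snd p) = out_vec p"
  using adj_transfer[of "fst p" "snd p"] by auto

lemma homogeneous_facts:
  shows "homogeneous F (\<lambda>p q. ip F (snd p) (snd q) :: complex)"
    and "homogeneous F (\<lambda>p q. ip E (out_vec p) (out_vec q))"
    and "homogeneous F (\<lambda>p q. ip GF (in_vec p) (in_vec q))"
    and "homogeneous F (\<lambda>p q. ip GE (V (in_vec p)) (V (in_vec q)))"
proof -
  show "homogeneous F (\<lambda>p q. ip F (snd p) (snd q) :: complex)" by (rule F.homogeneous_gram) auto
  show "homogeneous F (\<lambda>p q. ip E (out_vec p) (out_vec q))"
    by (rule E.homogeneous_gram) (simp_all only: output_mem state_sc)
  show "homogeneous F (\<lambda>p q. ip GF (in_vec p) (in_vec q))"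
    by (rule GF.homogeneous_gram) (simp_all only: input_mem state_sc)
  show "homogeneous F (\<lambda>p q. ip GE (V (in_vec p)) (V (in_vec q)))"
    by (rule GE.homogeneous_gram) (simp_all only: Vl input_mem state_sc)
qed

abbreviation "kF p q \<equiv> ip F (snd p) (snd q)"
abbreviation "kO p q \<equiv> ip E (out_vec p) (out_vec q)"
abbreviation "kS p q \<equiv> ip G (state_vec p) (state_vec q)"

text \<open>The defect of the contraction \<open>V\<close> at the inputs is \<open>kF - kO - (1 - \<langle>z,w\<rangle>) kS\<close>.\<close>

lemma psd_colligation: "psd (pts F) (\<lambda>p q. kpow 1 (fst q) (fst p) * (kF p q - kO p q) - kS p q)"
proof (rule psd_cong)
  let ?D = "\<lambda>p q. ip GF (in_vec p) (in_vec q) - ip GE (V (in_vec p)) (V (in_vec q))"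
  show "psd (pts F) (\<lambda>p q. 1 / (1 - cdot (fst q) (fst p)) * ?D p q)"
    by (intro F.psd_geometric psd_contraction_defect[OF GF.hilbert_space_axioms GE.hilbert_space_axioms V]
        homogeneous_diff homogeneous_facts input_mem)
  fix p q :: "(complex^'n) \<times> 'f" assume p: "p \<in> pts F" and q: "q \<in> pts F"
  have ne: "1 - cdot (fst q) (fst p) \<noteq> 0" using p q by (intro cdot_ne_1) auto
  have "?D p q = kF p q - kO p q - (1 - cdot (fst q) (fst p)) * kS p q"
    unfolding V_input[OF p] V_input[OF q] using ip_emb[OF state_facts(1)[OF p] state_facts(1)[OF q]]
    by (simp add: in_vec_def ip_prod algebra_simps)
  then show "kpow 1 (fst q) (fst p) * (kF p q - kO p q) - kS p q = 1 / (1 - cdot (fst q) (fst p)) * ?D p q"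
    using ne by (simp add: field_simps)
qed

lemma psd_kS: "psd (pts F) (\<lambda>p q. kS p q)"
  by (rule G.psd_gram[OF state_facts(1)])

lemma psd_kO: "psd (pts F) (\<lambda>p q. kO p q)"
  by (rule E.psd_gram[OF output_mem])

lemma psd_kF: "psd (pts F) (\<lambda>p q :: (complex^'n) \<times> 'f. kF p q)"
  by (rule F.psd_gram) auto

lemma psd_output: "psd (pts F) (\<lambda>p q. kpow 1 (fst q) (fst p) * (kF p q - kO p q))"
  using psd_add[OF psd_colligation psd_kS] by simp

text \<open>Makes the map from kernel functions of exponent m to states a contraction. For m = 1 the
  difference is the colligation kernel plus kO / (1 - <z,w>), both positive; the step uses (1 -
  t)^-(j+1) = (1 - t)^-j + t (1 - t)^-(j+1).\<close>

lemma psd_state: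
  assumes "1 \<le> m"
  shows "psd (pts F) (\<lambda>p q. kpow m (fst q) (fst p) * kF p q - kS p q)"
  using assms
proof (induction m rule: dec_induct)
  case base
  have "psd (pts F) (\<lambda>p q. (kpow 1 (fst q) (fst p) * (kF p q - kO p q) - kS p q) + 1 / (1 - cdot (fst q) (fst p)) * kO p q)"
    by (intro psd_add psd_colligation F.psd_geometric psd_kO homogeneous_facts)
  then show ?case by (simp add: right_diff_distrib)
next
  case (step j)
  let ?K = "\<lambda>p q. kpow (Suc j) (fst q) (fst p) * kF p q"
  have "psd (pts F) (\<lambda>p q :: (complex^'n) \<times> 'f. cdot (fst q) (fst p) * ?K p q)"
    using F.psd_geometric_power[OF psd_kF homogeneous_facts(1), of "Suc j"]
      homogeneous_scale[OF homogeneous_facts(1), of "\<lambda>w z. kpow (Suc j) z w"]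
    by (intro F.psd_cdot) simp_all
  from psd_add[OF step.IH this] show ?case
  proof (rule psd_cong[rotated])
    fix p q :: "(complex^'n) \<times> 'f" assume p: "p \<in> pts F" and q: "q \<in> pts F"
    have ne: "1 - cdot (fst q) (fst p) \<noteq> 0" using p q by (intro cdot_ne_1) auto
    have "kpow (Suc j) (fst q) (fst p) = kpow j (fst q) (fst p) + cdot (fst q) (fst p) * kpow (Suc j) (fst q) (fst p)"
      using ne by (simp add: field_simps)
    then show "kpow (Suc j) (fst q) (fst p) * kF p q - kS p q
        = kpow j (fst q) (fst p) * kF p q - kS p q + cdot (fst q) (fst p) * (kpow (Suc j) (fst q) (fst p) * kF p q)"
      by algebra
  qed
qed

lemma transfer_schur_agler: "transfer \<in> schur_agler E F"
proof -
  interpret A: bergman E 1 "Hm 1 E :: (complex^'n \<Rightarrow> 'e) hspace" by (rule Hm_bergman[OF E.hilbert_space_axioms]) simp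
  interpret B: bergman F 1 "Hm 1 F :: (complex^'n \<Rightarrow> 'f) hspace" by (rule Hm_bergman[OF F.hilbert_space_axioms]) simp
  interpret two_rkhs E "kpow 1" "Hm 1 E :: (complex^'n \<Rightarrow> 'e) hspace" F "kpow 1" "Hm 1 F :: (complex^'n \<Rightarrow> 'f) hspace" transfer
    using transfer_bounded by unfold_locales
  have c: "contraction (Hm 1 E) (Hm 1 F) (mult_op transfer)"
  proof (rule multiplier_contraction, rule psd_cong[OF _ psd_output])
    fix p q :: "(complex^'n) \<times> 'f" assume p: "p \<in> pts F" and q: "q \<in> pts F"
    show "kpow 1 (fst q) (fst p) * kF p q - kpow 1 (fst q) (fst p) * ip E (snd (adjker p)) (snd (adjker q))
        = kpow 1 (fst q) (fst p) * (kF p q - kO p q)"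
      by (simp only: snd_conv adj_transfer'[OF p] adj_transfer'[OF q] right_diff_distrib)
  qed
  \<comment> \<open>The kernel at the origin is constant, so \<open>c0 e\<close> is the constant
    function e. Multiplying it and evaluating at z returns the transfer function at z, which gives
    holomorphy in operator norm.\<close>
  define c0 where "c0 e = kerf (kpow 1) (0 :: complex^'n, e)" for e :: 'e
  have p0: "(0 :: complex^'n, e) \<in> pts E" if "e \<in> vecs E" for e using that by simp
  have c0: "c0 \<in> bounded_ops E (Hm 1 E)"
  proof (rule bounded_opsI[where C = 1])
    show "c0 e \<in> vecs (Hm 1 E)" if "e \<in> vecs E" for e unfolding c0_def by (rule A.kerf_mem[OF p0[OF that]])
    show "c0 (x + y) = c0 x + c0 y" for x y by (auto simp: c0_def kerf_def scaleC_add_right fun_eq_iff)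
    show "c0 (c *\<^sub>C x) = c *\<^sub>C c0 x" for c x by (auto simp: c0_def kerf_def scaleC_scaleC mult.commute fun_eq_iff)
    show "hnorm (Hm 1 E) (c0 x) \<le> 1 * hnorm E x" if "x \<in> vecs E" for x
      using A.ip_kerf_kerf[OF p0[OF that] p0[OF that]] by (simp add: c0_def hnorm_def cdot_def)
  qed
  have "holomorphic_on_ball (bounded_ops E F) (op_norm E F) transfer"
  proof (rule B.holomorphic_in_op_norm[OF _ E.hilbert_space_axioms])
    show "uniformly_holomorphic F (Hm 1 F :: (complex^'n \<Rightarrow> 'f) hspace)"
      by (rule Hm_uniformly_holomorphic[OF F.hilbert_space_axioms]) simp
    show "(\<lambda>e. mult_op transfer (c0 e)) \<in> bounded_ops E (Hm 1 F)"
      by (rule bounded_ops_comp[OF c0 contractionD(1)[OF c] E.hilbert_space_axioms A.H.hilbert_space_axioms])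
    show "transfer z e = mult_op transfer (c0 e) z" if "z \<in> unit_ball" for z e
      using that by (simp add: mult_op_def c0_def kerf_def cdot_def scaleC_one)
  qed
  with c show ?thesis by (simp add: schur_agler_def contractive_multipliers_def)
qed

text \<open>The state equation at single points turns into an operator identity: on a kernel
  function \<open>\<Gamma>\<close> is the state, \<open>\<Gamma>\<close> after T_i scales it by
  cnj(w_i), and evaluation at 0 returns input and output. Both sides are bounded operators, so
  equality on kernel functions suffices.\<close>

lemma state_operator:
  assumes m: "1 \<le> m"
  defines "HE \<equiv> Hm m E :: (complex^'n \<Rightarrow> 'e) hspace" and "HF \<equiv> Hm m F :: (complex^'n \<Rightarrow> 'f) hspace"
  obtains \<Gamma> where "\<Gamma> \<in> bounded_ops HF G"
    "\<And>h. h \<in> vecs HF \<Longrightarrow> V ((\<lambda>i. \<Gamma> (bergman.Ms HF i h)), h 0) = (\<Gamma> h, adj HE HF (mult_op transfer) h 0)"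
proof -
  interpret A: bergman E m HE unfolding HE_def by (rule Hm_bergman[OF E.hilbert_space_axioms m])
  interpret B: bergman F m HF unfolding HF_def by (rule Hm_bergman[OF F.hilbert_space_axioms m])
  interpret two_rkhs E "kpow m" HE F "kpow m" HF transfer
    using transfer_bounded by unfold_locales
  have c: "contraction HE HF (mult_op transfer)"
    unfolding HE_def HF_def
    by (rule schur_agler_contraction[OF E.hilbert_space_axioms F.hilbert_space_axioms transfer_schur_agler m])
  interpret M: bounded_op HE HF "mult_op transfer" using contractionD(1)[OF c] by unfold_locales
  obtain \<Gamma> where \<Gamma>: "contraction HF G \<Gamma>" "\<And>p. p \<in> pts F \<Longrightarrow> \<Gamma> (kerf (kpow m) p) = state_vec p"
    using B.contraction_from_kernels[OF G.hilbert_space_axioms state_facts(1) state_sc(1) psd_state[OF m]] by blast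
  note \<Gamma>b = contractionD(1)[OF \<Gamma>(1)]
  show ?thesis
  proof (rule that[OF \<Gamma>b])
    have z0: "(0 :: complex^'n) \<in> unit_ball" by simp
    have 1: "(\<lambda>h. ((\<lambda>i. \<Gamma> (B.Ms i h)), h 0)) \<in> bounded_ops HF GF"
      by (intro bounded_ops_pair bounded_ops_l2 bounded_ops_comp[OF contractionD(1)[OF B.Ms_contraction] \<Gamma>b]
          B.eval_bounded[OF z0] B.H.hilbert_space_axioms G.hilbert_space_axioms F.hilbert_space_axioms l2G)
    have 2: "(\<lambda>h. (\<Gamma> h, adj HE HF (mult_op transfer) h 0)) \<in> bounded_ops HF GE"
      by (intro bounded_ops_pair \<Gamma>b bounded_ops_comp[OF M.adj_bounded A.eval_bounded[OF z0]]
          B.H.hilbert_space_axioms G.hilbert_space_axioms E.hilbert_space_axioms A.H.hilbert_space_axioms)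
    fix h assume h: "h \<in> vecs HF"
    show "V ((\<lambda>i. \<Gamma> (B.Ms i h)), h 0) = (\<Gamma> h, adj HE HF (mult_op transfer) h 0)"
    proof (rule B.bounded_ops_eqI[OF bounded_ops_comp[OF 1 contractionD(1)[OF V] B.H.hilbert_space_axioms GF.hilbert_space_axioms] 2 GE.hilbert_space_axioms _ h])
      fix p :: "(complex^'n) \<times> 'f" assume p: "p \<in> pts F"
      have "\<Gamma> (B.Ms i (kerf (kpow m) p)) = cnj (fst p $ i) *\<^sub>C state_vec p" for i
        using bounded_opsD(3)[OF \<Gamma>b B.kerf_mem[OF p]] by (simp add: B.Ms_kerf[OF p] \<Gamma>(2)[OF p])
      then have "((\<lambda>i. \<Gamma> (B.Ms i (kerf (kpow m) p))), kerf (kpow m) p 0) = in_vec p"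
        by (simp add: in_vec_def emb_def B.kerf_at_0)
      moreover have "adj HE HF (mult_op transfer) (kerf (kpow m) p) 0 = out_vec p"
        unfolding adj_mult_kerf[OF M.T p] A.kerf_at_0 by (simp add: adj_transfer'[OF p])
      ultimately show "V ((\<lambda>i. \<Gamma> (B.Ms i (kerf (kpow m) p))), kerf (kpow m) p 0)
          = (\<Gamma> (kerf (kpow m) p), adj HE HF (mult_op transfer) (kerf (kpow m) p) 0)"
        by (simp add: V_input[OF p] \<Gamma>(2)[OF p])
    qed
  qed
qed

end

section \<open>The factorization theorem\<close>

text \<open>Co-isometric because the kernels with exponents \<open>m\<close> and \<open>p - m\<close> multiply to the one with exponent \<open>p\<close>.\<close>

lemma evaluation_coisometric:
  fixes Es :: "'s::complex_vector hspace"
  assumes Es: "hilbert_space Es" and m: "1 \<le> m" and mp: "m < p"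
  shows "coisometric_multiplier m (Hm (p - m) Es :: (complex^'n \<Rightarrow> 's) hspace) p Es (\<lambda>z f. f z)"
proof -
  let ?F = "Hm (p - m) Es :: (complex^'n \<Rightarrow> 's) hspace"
  let ?k = "kpow (p - m) :: complex^'n \<Rightarrow> complex^'n \<Rightarrow> complex"
  interpret F: bergman Es "p - m" ?F using mp by (intro Hm_bergman Es) auto
  let ?HF = "Hm m ?F :: (complex^'n \<Rightarrow> complex^'n \<Rightarrow> 's) hspace" and ?H2 = "Hm p Es :: (complex^'n \<Rightarrow> 's) hspace"
  interpret C: bergman ?F m ?HF by (intro Hm_bergman F.H.hilbert_space_axioms m)
  interpret S: bergman Es p ?H2 using m mp by (intro Hm_bergman Es) auto
  interpret two_rkhs ?F "kpow m" ?HF Es "kpow p" ?H2 "\<lambda>z f. f z"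
    by unfold_locales (rule F.eval_bounded)
  have adjker: "adj ?F Es (\<lambda>f. f (fst q)) (snd q) = kerf ?k q" if q: "q \<in> pts Es" for q :: "(complex^'n) \<times> 's"
  proof -
    interpret ev: bounded_op ?F Es "\<lambda>f. f (fst q)" using q by (intro bounded_op_\<Phi>) auto
    show ?thesis using q F.kerf_mem[OF q] F.ip_kerf[OF q] by (intro ev.adj_eqI) auto
  qed
  have kk: "kpow m z w * ?k z w = kpow p z w" for z w :: "complex^'n"
    using mp by (simp flip: power_add)
  have c: "contraction ?HF ?H2 (mult_op (\<lambda>z f. f z))"
  proof (rule multiplier_contraction, rule psd_cong[where K' = "\<lambda>p q. 0"])
    fix q r :: "(complex^'n) \<times> 's" assume q: "q \<in> pts Es" and r: "r \<in> pts Es"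
    show "kpow p (fst r) (fst q) * ip Es (snd q) (snd r)
        - kpow m (fst r) (fst q) * ip ?F (snd (adjker q)) (snd (adjker r)) = 0"
      unfolding snd_conv adjker[OF q] adjker[OF r] F.ip_kerf_kerf[OF q r] kk[symmetric] by simp
  qed (simp add: psd_def)
  interpret M: bounded_op ?HF ?H2 "mult_op (\<lambda>z f. f z)" using contractionD(1)[OF c] by unfold_locales
  \<comment> \<open>The adjoint sends the kernel function at (w, \<eta>) to the one of exponent m at
    w whose vector is the kernel function of exponent p - m; evaluating at z multiplies the two
    kernels.\<close>
  have MM: "mult_op (\<lambda>z f. f z) (adj ?HF ?H2 (mult_op (\<lambda>z f. f z)) (kerf (kpow p) q)) = kerf (kpow p) q"
    if q: "q \<in> pts Es" for q
    unfolding adj_mult_kerf[OF M.T q] adjker[OF q] using kk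
    by (auto simp: mult_op_def kerf_def fun_eq_iff scaleC_scaleC)
  have "mult_op (\<lambda>z f. f z) (adj ?HF ?H2 (mult_op (\<lambda>z f. f z)) f) = f" if f: "f \<in> vecs ?H2" for f
  proof (rule S.eqI)
    fix q :: "(complex^'n) \<times> 's" assume q: "q \<in> pts Es"
    note kq = S.kerf_mem[OF q]
    have "ip ?H2 (mult_op (\<lambda>z f. f z) (adj ?HF ?H2 (mult_op (\<lambda>z f. f z)) f)) (kerf (kpow p) q)
        = ip ?HF (adj ?HF ?H2 (mult_op (\<lambda>z f. f z)) f) (adj ?HF ?H2 (mult_op (\<lambda>z f. f z)) (kerf (kpow p) q))"
      by (rule M.ip_adj[OF kq M.adj_mem[OF f], symmetric])
    also have "\<dots> = ip ?H2 f (kerf (kpow p) q)"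
      using M.ip_adj_left[OF f M.adj_mem[OF kq]] MM[OF q] by simp
    finally show "ip ?H2 (mult_op (\<lambda>z f. f z) (adj ?HF ?H2 (mult_op (\<lambda>z f. f z)) f)) (kerf (kpow p) q)
        = ip ?H2 f (kerf (kpow p) q)" .
  qed (use f bounded_opsD(1)[OF M.T] in auto)
  moreover have "holomorphic_on_ball (bounded_ops ?F Es) (op_norm ?F Es) (\<lambda>z f. f z)"
  proof (rule F.holomorphic_in_op_norm[OF _ F.H.hilbert_space_axioms, where T = "\<lambda>f. f"])
    show "uniformly_holomorphic Es ?F" using mp by (intro Hm_uniformly_holomorphic Es) auto
    show "(\<lambda>f. f) \<in> bounded_ops ?F ?F" by (rule bounded_opsI[where C = 1]) auto
  qed (rule refl)
  ultimately show ?thesis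
    using c by (simp add: coisometric_multiplier_def contractive_multipliers_def)
qed

section \<open>Sufficiency of the positivity condition\<close>

context intertwiner
begin

text \<open>\<open>Delta_ip\<close> pulled back to Q2. It is applied to the isometry into the space
  over F and to the adjoint of X, both of which land in spaces of exponent m.\<close>

lemma Delta_eval:
  assumes C: "bergman D m H" and L: "\<And>f. f \<in> Q2 \<Longrightarrow> L f \<in> vecs H"
    and LT: "\<And>f i. f \<in> Q2 \<Longrightarrow> L (S.Ms i f) = bergman.Ms H i (L f)" and f: "f \<in> Q2"
  shows "Re ((Delta S.Ms ^^ m) (\<lambda>f g. ip H (L f) (L g)) f f) = (hnorm D (L f 0))\<^sup>2"
proof -
  interpret C: bergman D m H by (rule C)
  have "(Delta S.Ms ^^ m) (\<lambda>f g. ip H (L f) (L g)) f f = (Delta C.Ms ^^ m) (ip H) (L f) (L f)"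
    by (rule Delta_intertwine[where Q = Q2 and L = L]) (use f Q2f(4) LT in auto)
  then show ?thesis using C.Delta_ip[OF L[OF f]] by simp
qed

lemma factors_if_positive:
  assumes pos: "positive_op G2 (Y (m - 1))"
  shows "factors_through m p E Es Q1 Q2 X (Hm (p - m) Es :: (complex^'n \<Rightarrow> 's) hspace)"
proof -
  let ?F = "Hm (p - m) Es :: (complex^'n \<Rightarrow> 's) hspace"
  interpret F: bergman Es "p - m" ?F using mp by (intro Hm_bergman S.E.hilbert_space_axioms) auto
  let ?HF = "Hm m ?F :: (complex^'n \<Rightarrow> complex^'n \<Rightarrow> 's) hspace"
  interpret C: bergman ?F m ?HF by (intro Hm_bergman F.H.hilbert_space_axioms A.m)
  define \<Phi>2 :: "complex^'n \<Rightarrow> (complex^'n \<Rightarrow> 's) \<Rightarrow> 's" where "\<Phi>2 = (\<lambda>z f. f z)"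
  have co: "coisometric_multiplier m ?F p Es \<Phi>2"
    unfolding \<Phi>2_def by (rule evaluation_coisometric[OF S.E.hilbert_space_axioms A.m mp])
  have c2: "contraction ?HF H2 (mult_op \<Phi>2)" and iso: "\<And>f. f \<in> vecs H2 \<Longrightarrow> mult_op \<Phi>2 (adj ?HF H2 (mult_op \<Phi>2) f) = f"
    and \<Phi>2b: "\<And>z. z \<in> unit_ball \<Longrightarrow> \<Phi>2 z \<in> bounded_ops ?F Es"
    using co by (auto simp: coisometric_multiplier_def contractive_multipliers_def holomorphic_on_ball_def)
  interpret M2: bounded_op ?HF H2 "mult_op \<Phi>2" using contractionD(1)[OF c2] by unfold_locales
  define L where "L = adj ?HF H2 (mult_op \<Phi>2)"
  have Lm: "L f \<in> vecs ?HF" if "f \<in> Q2" for f using that Q2H by (simp add: L_def)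
  have LT: "L (S.Ms i f) = C.Ms i (L f)" if "f \<in> Q2" for f i
    unfolding L_def
    by (rule adj_mult_intertwines[OF C.bergman_axioms S.bergman_axioms contractionD(1)[OF c2] \<Phi>2b Q2H[OF that]])
  have Lip: "ip ?HF (L f) (L g) = ip H2 f g" if "f \<in> Q2" "g \<in> Q2" for f g
    using M2.ip_adj[OF Q2H[OF that(2)] Lm[OF that(1)]] iso[OF Q2H[OF that(1)]] by (simp add: L_def)
  have Lb: "L \<in> bounded_ops G2 ?HF"
    using bounded_ops_comp[OF bounded_op.T[OF proj_facts(2)[OF S.H.hilbert_space_axioms Q2f(1)]] M2.adj_bounded
        G2.hilbert_space_axioms S.H.hilbert_space_axioms]
    by (simp add: L_def)

  let ?D = "(Delta S.Ms ^^ (m - 1)) Bq"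
  have Ym: "Y (m - 1) f \<in> vecs G2" if "f \<in> vecs G2" for f using Y_form[of f] that by simp
  have Yf: "ip G2 (Y (m - 1) f) g = ?D f g" if "f \<in> vecs G2" "g \<in> vecs G2" for f g
    using Y_form[of f] that by simp
  have Yb: "Y (m - 1) \<in> bounded_ops G2 G2"
    by (rule form_operator_bounded[OF G2.hilbert_space_axioms Ym Yf sform_Delta_Bq])
  have Ysym: "ip G2 (Y (m - 1) f) g = ip G2 f (Y (m - 1) g)" if "f \<in> vecs G2" "g \<in> vecs G2" for f g
    using G2.ip_commute[OF Ym[OF that(2)] that(1)] sformD(3)[OF sform_Delta_Bq that(2,1)] Yf[OF that] Yf[OF that(2,1)] by simp
  obtain R where R: "R \<in> bounded_ops G2 G2" "\<And>f. f \<in> Q2 \<Longrightarrow> (hnorm H2 (R f))\<^sup>2 = Re (?D f f)"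
  proof -
    obtain R where "R \<in> bounded_ops G2 G2" "\<And>f. f \<in> vecs G2 \<Longrightarrow> (hnorm G2 (R f))\<^sup>2 = Re (ip G2 (Y (m - 1) f) f)"
      using G2.positive_sqrt[OF Yb Ysym] pos unfolding positive_op_def by metis
    then show ?thesis using that Yf by simp
  qed
  have Rm: "R f \<in> Q2" if "f \<in> Q2" for f using bounded_opsD(1)[OF R(1), of f] that by simp
  have T: "S.Ms i f \<in> Q2" if "f \<in> Q2" for i f by (rule Q2f(4)[OF that])

  \<comment> \<open>The real part of \<open>Delta\<close> to the power m of \<open>Bq\<close> is
    computed twice: as one more \<open>Delta\<close> applied to the form of |R f|^2, and as the
    difference of two pulled back inner products, each reduced to a value at 0.\<close>
  have balance: "(hnorm H2 (R f))\<^sup>2 + (hnorm E (Xa f 0))\<^sup>2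
      = (\<Sum>i\<in>UNIV. (hnorm H2 (R (S.Ms i f)))\<^sup>2) + (hnorm ?F (L f 0))\<^sup>2" if f: "f \<in> Q2" for f
  proof -
    have "(Delta S.Ms ^^ Suc (m - 1)) Bq f f = ?D f f - (\<Sum>i\<in>UNIV. ?D (S.Ms i f) (S.Ms i f))"
      by (simp add: Delta_def)
    then have "Re ((Delta S.Ms ^^ m) Bq f f) = (hnorm H2 (R f))\<^sup>2 - (\<Sum>i\<in>UNIV. (hnorm H2 (R (S.Ms i f)))\<^sup>2)"
      using A.m R(2)[OF f] R(2)[OF T[OF f]] by simp
    moreover have "(Delta S.Ms ^^ m) Bq f f
        = (Delta S.Ms ^^ m) (\<lambda>f g. ip ?HF (L f) (L g) - ip H1 (Xa f) (Xa g)) f f"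
      by (rule Delta_intertwine[where Q = Q2 and L = "\<lambda>f. f"]) (use f T Lip in \<open>auto simp: Bq_def\<close>)
    moreover have "Re ((Delta S.Ms ^^ m) (\<lambda>f g. ip ?HF (L f) (L g)) f f) = (hnorm ?F (L f 0))\<^sup>2"
      by (rule Delta_eval[OF C.bergman_axioms Lm LT f])
    moreover have "Re ((Delta S.Ms ^^ m) (\<lambda>f g. ip H1 (Xa f) (Xa g)) f f) = (hnorm E (Xa f 0))\<^sup>2"
      by (rule Delta_eval[OF A.bergman_axioms _ Xa_Ms f]) (use Xa_mem Q1H in auto)
    ultimately show ?thesis by (simp add: Delta_power_diff)
  qed

  have z0: "(0 :: complex^'n) \<in> unit_ball" by simp
  let ?GF = "(l2_hspace G2 :: ('n \<Rightarrow> complex^'n \<Rightarrow> 's) hspace) \<times>\<^sub>H ?F" and ?GE = "G2 \<times>\<^sub>H E"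
  have l2: "hilbert_space (l2_hspace G2 :: ('n \<Rightarrow> complex^'n \<Rightarrow> 's) hspace)" by (rule G2.l2_hilbert)
  note hs = G2.hilbert_space_axioms A.E.hilbert_space_axioms F.H.hilbert_space_axioms C.H.hilbert_space_axioms A.H.hilbert_space_axioms l2
  \<comment> \<open>Input and output of the lurking isometry: \<open>a f\<close> has the states R
    T_i f and the input (L f)(0), \<open>b f\<close> the state R f and as output the value at 0 of
    \<open>Xa f\<close>.\<close>
  define a where "a f = ((\<lambda>i. R (S.Ms i f)), L f 0)" for f
  define b where "b f = (R f, Xa f 0)" for f
  have RT: "(\<lambda>f. R (S.Ms i f)) \<in> bounded_ops G2 G2" for i
    by (rule bounded_ops_comp[OF contractionD(1)[OF S.Ms_contraction_restrict[OF Q2]] R(1) hs(1) hs(1)])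
  have ab: "a \<in> bounded_ops G2 ?GF"
    unfolding a_def[abs_def]
    by (intro bounded_ops_pair bounded_ops_l2 RT bounded_ops_comp[OF Lb C.eval_bounded[OF z0]] hs)
  have bb: "b \<in> bounded_ops G2 ?GE"
    unfolding b_def[abs_def]
    by (intro bounded_ops_pair R(1) bounded_ops_comp[OF Xa_bounded A.eval_bounded[OF z0]] hs)
  note al = bounded_opsD[OF ab] and bl = bounded_opsD[OF bb]
  have hGF: "hilbert_space ?GF" by (rule prod_hilbert[OF l2 F.H.hilbert_space_axioms])
  have hGE: "hilbert_space ?GE" by (rule prod_hilbert[OF hs(1,2)])
  interpret GF: hilbert_space ?GF by (rule hGF)
  interpret GE: hilbert_space ?GE by (rule hGE)
  have norm_eq: "hnorm ?GE (b f) \<le> hnorm ?GF (a f)" if f: "f \<in> Q2" for f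
  proof (rule power2_le_imp_le)
    have m: "a f \<in> vecs ?GF" "b f \<in> vecs ?GE" using al(1) bl(1) f by auto
    show "(hnorm ?GE (b f))\<^sup>2 \<le> (hnorm ?GF (a f))\<^sup>2"
      unfolding hnorm_prod_sq[OF hs(1,2) m(2)] hnorm_prod_sq[OF l2 hs(3) m(1)]
      using balance[OF f] G2.hnorm_l2_finite_sq[of "\<lambda>i. R (S.Ms i f)"] Rm T f by (simp add: a_def b_def)
    show "0 \<le> hnorm ?GF (a f)" by (rule GF.hnorm_nonneg[OF m(1)])
  qed
  obtain V where V: "contraction ?GF ?GE V" "\<And>x y. (x, y) \<in> {(a f, b f) | f. f \<in> Q2} \<Longrightarrow> V x = y"
  proof (rule contraction_extension[OF hGF hGE, of "{(a f, b f) | f. f \<in> Q2}"])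
    show "x \<in> vecs ?GF \<and> y \<in> vecs ?GE" if "(x, y) \<in> {(a f, b f) | f. f \<in> Q2}" for x y
    proof -
      have "\<exists>f\<in>Q2. x = a f \<and> y = b f" using that by blast
      then show ?thesis using al(1) bl(1) by auto
    qed
    have "a 0 = 0" "b 0 = 0" using bounded_ops_zero[OF ab hs(1)] bounded_ops_zero[OF bb hs(1)] by auto
    moreover have "0 \<in> Q2" using G2.zero_mem by simp
    ultimately show "(0, 0) \<in> {(a f, b f) | f. f \<in> Q2}" by (intro CollectI exI[of _ 0]) simp
    show "(v + w, s + t) \<in> {(a f, b f) | f. f \<in> Q2}"
      if hyp: "(v, s) \<in> {(a f, b f) | f. f \<in> Q2}" "(w, t) \<in> {(a f, b f) | f. f \<in> Q2}" for v s w t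
    proof -
      obtain f g where fg: "v = a f" "s = b f" "f \<in> Q2" "w = a g" "t = b g" "g \<in> Q2" using hyp by blast
      have "f + g \<in> Q2" using G2.add_mem[of f g] fg by simp
      then show ?thesis using al(2)[of f g] bl(2)[of f g] fg by (intro CollectI exI[of _ "f + g"]) simp
    qed
    show "(c *\<^sub>C v, c *\<^sub>C s) \<in> {(a f, b f) | f. f \<in> Q2}" if hyp: "(v, s) \<in> {(a f, b f) | f. f \<in> Q2}" for c v s
    proof -
      obtain f where f: "v = a f" "s = b f" "f \<in> Q2" using hyp by blast
      have "c *\<^sub>C f \<in> Q2" using G2.scale_mem[of f c] f by simp
      then show ?thesis using al(3)[of f c] bl(3)[of f c] f by (intro CollectI exI[of _ "c *\<^sub>C f"]) simp
    qed
    show "hnorm ?GE y \<le> hnorm ?GF x" if "(x, y) \<in> {(a f, b f) | f. f \<in> Q2}" for x y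
      using that norm_eq by blast
  qed blast
  have Va: "V (a f) = b f" if "f \<in> Q2" for f using V(2) that by blast
  interpret V: colligation E ?F G2 V using V(1) by unfold_locales
  note Vl = V.Vl
  let ?M1 = "mult_op V.transfer :: (complex^'n \<Rightarrow> 'e) \<Rightarrow> complex^'n \<Rightarrow> complex^'n \<Rightarrow> 's"
  have c1: "contraction H1 ?HF ?M1"
    by (rule schur_agler_contraction[OF hs(2,3) V.transfer_schur_agler A.m])
  interpret M1: bounded_op H1 ?HF ?M1 using contractionD(1)[OF c1] by unfold_locales
  obtain \<Gamma> where \<Gamma>: "\<Gamma> \<in> bounded_ops ?HF G2"
    "\<And>h. h \<in> vecs ?HF \<Longrightarrow> V ((\<lambda>i. \<Gamma> (C.Ms i h)), h 0) = (\<Gamma> h, adj H1 ?HF ?M1 h 0)"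
    using V.state_operator[OF A.m] by metis

  text \<open>Both \<open>R\<close> and \<open>\<Gamma> L\<close> solve the state equation of the colligation with inputs \<open>(L f)(0)\<close>, so
    their difference \<open>\<delta>\<close> is bounded by the row of the \<open>\<delta> T\<^sub>i\<close> and vanishes by purity.\<close>

  define \<delta> where "\<delta> f = R f - \<Gamma> (L f)" for f
  define e where "e f = Xa f - adj H1 ?HF ?M1 (L f)" for f
  have \<delta>b: "\<delta> \<in> bounded_ops G2 G2"
    unfolding \<delta>_def[abs_def]
    by (intro bounded_ops_minus R(1) bounded_ops_comp[OF Lb \<Gamma>(1)] hs)
  have \<delta>m: "\<delta> f \<in> Q2" if "f \<in> Q2" for f using bounded_opsD(1)[OF \<delta>b, of f] that by simp
  have em: "e f \<in> vecs H1" if "f \<in> Q2" for f using that Xa_mem Q1H Lm by (simp add: e_def)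
  \<comment> \<open>Subtracting the two state equations cancels the inputs, which leaves 0 in the
    second slot and the output error \<open>e f 0\<close>.\<close>
  have step: "V ((\<lambda>i. \<delta> (S.Ms i f)), 0) = (\<delta> f, e f 0)" if f: "f \<in> Q2" for f
  proof -
    define c where "c = ((\<lambda>i. \<Gamma> (C.Ms i (L f))), L f 0)"
    have \<Gamma>m: "\<Gamma> h \<in> Q2" if "h \<in> vecs ?HF" for h using bounded_opsD(1)[OF \<Gamma>(1) that] by simp
    have c: "c \<in> vecs ?GF" using \<Gamma>m Lm[OF f] by (simp add: c_def vecs_l2_finite)
    have am: "a f \<in> vecs ?GF" using al(1) f by simp
    have "V (a f - c) = V (a f) - V c"
      by (rule bounded_ops_diff[OF contractionD(1)[OF V(1)] hGF am c])
    also have "\<dots> = (\<delta> f, e f 0)"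
      unfolding Va[OF f] unfolding c_def \<Gamma>(2)[OF Lm[OF f]] by (simp add: b_def \<delta>_def e_def)
    also have "a f - c = ((\<lambda>i. \<delta> (S.Ms i f)), 0)"
      by (simp add: a_def c_def \<delta>_def LT[OF f] fun_eq_iff)
    finally show ?thesis .
  qed
  have key: "(hnorm H2 (\<delta> f))\<^sup>2 + (hnorm E (e f 0))\<^sup>2 \<le> (\<Sum>i\<in>UNIV. (hnorm H2 (\<delta> (S.Ms i f)))\<^sup>2)" if f: "f \<in> Q2" for f
  proof -
    let ?u = "((\<lambda>i. \<delta> (S.Ms i f)), 0 :: complex^'n \<Rightarrow> 's)"
    have u: "?u \<in> vecs ?GF" using \<delta>m T f by (simp add: vecs_l2_finite)
    have "(hnorm ?GE (V ?u))\<^sup>2 \<le> (hnorm ?GF ?u)\<^sup>2"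
      using contractionD(2)[OF V(1) u] Vl(1)[OF u] by (intro power_mono GE.hnorm_nonneg) auto
    then show ?thesis
      using hnorm_prod_sq[OF hs(1,2) Vl(1)[OF u]] hnorm_prod_sq[OF l2 hs(3) u]
        G2.hnorm_l2_finite_sq[of "\<lambda>i. \<delta> (S.Ms i f)"] \<delta>m T f by (simp add: step[OF f])
  qed
  obtain K where K: "K > 0" "\<And>f. f \<in> vecs G2 \<Longrightarrow> hnorm G2 (\<delta> f) \<le> K * hnorm G2 f"
    using bounded_ops_bound[OF \<delta>b hs(1)] by blast
  have \<delta>0: "(hnorm H2 (\<delta> f))\<^sup>2 \<le> 0" if f: "f \<in> Q2" for f
  proof (rule S.vanish_by_purity[where Q = Q2 and C = "K\<^sup>2" and b = "\<lambda>f. (hnorm H2 (\<delta> f))\<^sup>2"])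
    show "(hnorm H2 (\<delta> f))\<^sup>2 \<le> K\<^sup>2 * (hnorm H2 f)\<^sup>2" if "f \<in> Q2" for f
      using power_mono[OF K(2)[of f], of 2] that \<delta>m[OF that] Q2H by (simp add: power_mult_distrib)
    show "(hnorm H2 (\<delta> f))\<^sup>2 \<le> (\<Sum>i\<in>UNIV. (hnorm H2 (\<delta> (S.Ms i f)))\<^sup>2)" if "f \<in> Q2" for f
      using key[OF that] by (smt (verit) zero_le_power2)
  qed (use Q2f(3) T f in auto)
  have e0: "e f 0 = 0" if f: "f \<in> Q2" for f
  proof -
    have "(\<Sum>i\<in>UNIV. (hnorm H2 (\<delta> (S.Ms i f)))\<^sup>2) \<le> 0" using \<delta>0 T f by (intro sum_nonpos) auto
    then have "(hnorm E (e f 0))\<^sup>2 \<le> 0" using key[OF f] by (smt (verit) zero_le_power2)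
    then show ?thesis using A.E.hnorm_eq_0[of "e f 0"] em[OF f] by simp
  qed
  \<comment> \<open>The range of \<open>e\<close> is thus invariant under the T_i; all its elements
    vanish at 0, so it is zero.\<close>
  have eT: "A.Ms i (e f) = e (S.Ms i f)" if f: "f \<in> Q2" for i f
    using adj_mult_intertwines[OF A.bergman_axioms C.bergman_axioms contractionD(1)[OF c1] V.transfer_bounded Lm[OF f]]
      Xa_mem[OF f] Q1H Lm[OF f]
    by (simp add: e_def Xa_Ms[OF f] LT[OF f] A.Ms_linear)
  have "e f = 0" if f: "f \<in> Q2" for f
  proof (rule A.invariant_vanishing_at_0[where Q = "e ` Q2"])
    show "A.Ms i h \<in> e ` Q2" if "h \<in> e ` Q2" for h i using that eT T by auto
    show "h 0 = 0" if "h \<in> e ` Q2" for h using that e0 by auto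
  qed (use em f in auto)
  then have XL: "Xa f = adj H1 ?HF ?M1 (L f)" if "f \<in> Q2" for f using that by (simp add: e_def)
  have "adj H1 H2 (mult_op (\<lambda>z. \<Phi>2 z \<circ> V.transfer z)) f = adj G1 G2 X f" if f: "f \<in> Q2" for f
  proof -
    have "adj H1 H2 (mult_op (\<lambda>z. \<Phi>2 z \<circ> V.transfer z)) f = adj H1 ?HF ?M1 (L f)"
      unfolding L_def
      by (rule adj_comp[OF M1.bounded_op_axioms M2.bounded_op_axioms Q2H[OF f]]) (rule mult_op_comp)
    then show ?thesis using XL[OF f] by (simp add: Xa_def)
  qed
  then show ?thesis
    unfolding factors_through_def using V.transfer_schur_agler co by blast
qed

end

theorem theorem3p11:
  fixes E :: "'e::complex_vector hspace"
    and Es :: "'s::complex_vector hspace"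
    and Q1 :: "(complex^'n \<Rightarrow> 'e) set"
    and Q2 :: "(complex^'n \<Rightarrow> 's) set"
    and X :: "(complex^'n \<Rightarrow> 'e) \<Rightarrow> complex^'n \<Rightarrow> 's"
    and m p :: nat
  assumes "1 \<le> m" and "m < p"
    and "hilbert_space E" and "hilbert_space Es"
    and "coinvariant (Hm m E) Q1" and "coinvariant (Hm p Es) Q2"
    and "contraction (Hm m E \<restriction>\<^sub>H Q1) (Hm p Es \<restriction>\<^sub>H Q2) X"
    and "\<And>i f. f \<in> Q1 \<Longrightarrow>
      X (compressed_coord (Hm m E) Q1 i f) = compressed_coord (Hm p Es) Q2 i (X f)"
  shows
    "((\<exists>F :: (complex^'n \<Rightarrow> 's) hspace. hilbert_space F \<and> factors_through m p E Es Q1 Q2 X F) \<longleftrightarrow>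
        positive_op (Hm p Es \<restriction>\<^sub>H Q2)
          (((\<lambda>Y. Y - sigma_op (Hm p Es \<restriction>\<^sub>H Q2) (compressed_coord (Hm p Es) Q2) Y) ^^ (m - 1))
            (id - (X \<circ> adj (Hm m E \<restriction>\<^sub>H Q1) (Hm p Es \<restriction>\<^sub>H Q2) X)))) \<and>
     ((\<exists>F :: 'f::complex_vector hspace. hilbert_space F \<and> factors_through m p E Es Q1 Q2 X F) \<longrightarrow>
      (\<exists>F :: (complex^'n \<Rightarrow> 's) hspace. hilbert_space F \<and> factors_through m p E Es Q1 Q2 X F))"
proof -
  have p: "1 \<le> p" and pm: "1 \<le> p - m" using assms(1,2) by auto
  interpret intertwiner E Es m p Q1 Q2 X
    by (intro intertwiner.intro intertwiner_axioms.intro Hm_bergman p assms)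
  interpret F: bergman Es "p - m" "Hm (p - m) Es :: (complex^'n \<Rightarrow> 's) hspace"
    by (intro Hm_bergman pm assms)
  have sufficient: "\<exists>F :: (complex^'n \<Rightarrow> 's) hspace. hilbert_space F \<and> factors_through m p E Es Q1 Q2 X F"
    if "positive_op G2 (Y (m - 1))"
    using factors_if_positive[OF that] F.H.hilbert_space_axioms by blast
  show ?thesis
    unfolding Y_def[symmetric]
  proof (intro conjI iffI impI)
    assume "\<exists>F :: (complex^'n \<Rightarrow> 's) hspace. hilbert_space F \<and> factors_through m p E Es Q1 Q2 X F"
    then show "positive_op G2 (Y (m - 1))" by (elim exE conjE) (rule positive_if_factors)
  next
    assume "positive_op G2 (Y (m - 1))"
    then show "\<exists>F :: (complex^'n \<Rightarrow> 's) hspace. hilbert_space F \<and> factors_through m p E Es Q1 Q2 X F"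
      by (rule sufficient)
  next
    \<comment> \<open>The passage between types goes through the positivity condition, in which F
      does not occur.\<close>
    assume "\<exists>F :: 'f hspace. hilbert_space F \<and> factors_through m p E Es Q1 Q2 X F"
    then have "positive_op G2 (Y (m - 1))" by (elim exE conjE) (rule positive_if_factors)
    then show "\<exists>F :: (complex^'n \<Rightarrow> 's) hspace. hilbert_space F \<and> factors_through m p E Es Q1 Q2 X F"
      by (rule sufficient)
  qed
qed

end
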